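(* Let $W$ be a Coxeter group, decomposed as $W=W_{\mathrm{gen}}\times W_{\mathrm{aff}}\times W_{\mathrm{sph}}$, and let $H$ be a normal subgroup of $W$. (1) $H$ is finite if and only if $H$ is a subgroup of $W_{\mathrm{sph}}$. (2) $H$ is narrow if and only if $H$ is a subgroup of $W_{\mathrm{aff}}\times W_{\mathrm{sph}}$.
   Context: A group is narrow if it contains no subgroup isomorphic to the free group $F_2$ of rank $2$. Let $S$ be a finite set and $M=(m_{s,t})_{s,t\in S}$ a Coxeter matrix ($m_{s,s}=1$, $m_{s,t}=m_{t,s}\in\{2,3,\dots\}\cup\{\infty\}$ for $s\neq t$). The Coxeter group is $W=\langle S\mid s^2=1\ (s\in S),\ (st)^{m_{s,t}}=1\ (s\neq t,\ m_{s,t}\neq\infty)\rangle$. The Coxeter graph $\Gamma$ has vertex set $S$, with an edge between $s\neq t$ iff $m_{s,t}\neq 2$. For $X\subseteq S$, $W_X$ denotes the subgroup generated by $X$. If $X_1,\dots,X_\ell$ are the vertex sets of the connected components of $\Gamma$, then $W=W_{X_1}\times\cdots\times W_{X_\ell}$; the $W_{X_i}$ are the irreducible components. On $V=\bigoplus_{s\in S}\mathbb{R}\alpha_s$ the canonical form is the symmetric bilinear form with $\langle\alpha_s\mid\alpha_t\rangle=-\cos(\pi/m_{s,t})$ if $m_{s,t}\neq\infty$ and $-1$ otherwise. An irreducible Coxeter group (connected $\Gamma$) is of spherical type if its canonical form is positive definite (equivalently, it is finite), of affine type if the form is positive semidefinite but not positive definite, and generic otherwise. $W_{\mathrm{gen}}$,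 $W_{\mathrm{aff}}$, $W_{\mathrm{sph}}$ are the products of the generic, affine, and spherical irreducible components respectively, so $W=W_{\mathrm{gen}}\times W_{\mathrm{aff}}\times W_{\mathrm{sph}}$. *)

theory Defs
  imports Complex_Main "HOL-Algebra.Algebra" "HOL-Library.Extended_Nat"
begin

definition coxeter_matrix :: "'a set \<Rightarrow> ('a \<Rightarrow> 'a \<Rightarrow> enat) \<Rightarrow> bool" where
  "coxeter_matrix S m \<longleftrightarrow> finite S \<and>
     (\<forall>s\<in>S. m s s = 1) \<and>
     (\<forall>s\<in>S. \<forall>t\<in>S. m s t = m t s) \<and>
     (\<forall>s\<in>S. \<forall>t\<in>S. s \<noteq> t \<longrightarrow> m s t \<ge> 2)"

text \<open>Congruence on words over S generated by the defining relations
  s^2 = 1 and (st)^(m s t) = 1 (for m s t finite). Since all generators are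
  involutions, the monoid presented this way is the Coxeter group.\<close>
inductive cox_eq :: "'a set \<Rightarrow> ('a \<Rightarrow> 'a \<Rightarrow> enat) \<Rightarrow> 'a list \<Rightarrow> 'a list \<Rightarrow> bool"
  for S m where
  refl: "cox_eq S m w w"
| sym: "cox_eq S m u v \<Longrightarrow> cox_eq S m v u"
| trans: "cox_eq S m u v \<Longrightarrow> cox_eq S m v w \<Longrightarrow> cox_eq S m u w"
| cancel: "s \<in> S \<Longrightarrow> cox_eq S m (u @ [s, s] @ v) (u @ v)"
| braid: "s \<in> S \<Longrightarrow> t \<in> S \<Longrightarrow> s \<noteq> t \<Longrightarrow> m s t = enat k \<Longrightarrow>
     cox_eq S m (u @ concat (replicate k [s, t]) @ v) (u @ v)"

definition cox_class :: "'a set \<Rightarrow> ('a \<Rightarrow> 'a \<Rightarrow> enat) \<Rightarrow> 'a list \<Rightarrow> 'a list set" where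
  "cox_class S m w = {v \<in> lists S. cox_eq S m w v}"

definition cox_group :: "'a set \<Rightarrow> ('a \<Rightarrow> 'a \<Rightarrow> enat) \<Rightarrow> 'a list set monoid" where
  "cox_group S m =
     \<lparr> carrier = cox_class S m ` lists S,
       monoid.mult = (\<lambda>A B. {v \<in> lists S. \<exists>a\<in>A. \<exists>b\<in>B. cox_eq S m (a @ b) v}),
       monoid.one = cox_class S m [] \<rparr>"

definition cox_gen :: "'a set \<Rightarrow> ('a \<Rightarrow> 'a \<Rightarrow> enat) \<Rightarrow> 'a \<Rightarrow> 'a list set" where
  "cox_gen S m s = cox_class S m [s]"

definition parabolic :: "'a set \<Rightarrow> ('a \<Rightarrow> 'a \<Rightarrow> enat) \<Rightarrow> 'a set \<Rightarrow> 'a list set set" where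
  "parabolic S m T = generate (cox_group S m) (cox_gen S m ` T)"

definition cox_edge :: "'a set \<Rightarrow> ('a \<Rightarrow> 'a \<Rightarrow> enat) \<Rightarrow> ('a \<times> 'a) set" where
  "cox_edge S m = {(s, t). s \<in> S \<and> t \<in> S \<and> s \<noteq> t \<and> m s t \<noteq> 2}"

definition component :: "'a set \<Rightarrow> ('a \<Rightarrow> 'a \<Rightarrow> enat) \<Rightarrow> 'a \<Rightarrow> 'a set" where
  "component S m s = {t \<in> S. (s, t) \<in> (cox_edge S m)\<^sup>*}"

definition canon_form :: "('a \<Rightarrow> 'a \<Rightarrow> enat) \<Rightarrow> 'a \<Rightarrow> 'a \<Rightarrow> real" where
  "canon_form m s t = (case m s t of enat k \<Rightarrow> - cos (pi / real k) | \<infinity> \<Rightarrow> -1)"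

definition canon_quad :: "('a \<Rightarrow> 'a \<Rightarrow> enat) \<Rightarrow> 'a set \<Rightarrow> ('a \<Rightarrow> real) \<Rightarrow> real" where
  "canon_quad m T c = (\<Sum>s\<in>T. \<Sum>t\<in>T. c s * c t * canon_form m s t)"

definition pos_def_on :: "('a \<Rightarrow> 'a \<Rightarrow> enat) \<Rightarrow> 'a set \<Rightarrow> bool" where
  "pos_def_on m T \<longleftrightarrow> (\<forall>c. (\<exists>s\<in>T. c s \<noteq> 0) \<longrightarrow> canon_quad m T c > 0)"

definition pos_semidef_on :: "('a \<Rightarrow> 'a \<Rightarrow> enat) \<Rightarrow> 'a set \<Rightarrow> bool" where
  "pos_semidef_on m T \<longleftrightarrow> (\<forall>c. canon_quad m T c \<ge> 0)"

definition S_sph :: "'a set \<Rightarrow> ('a \<Rightarrow> 'a \<Rightarrow> enat) \<Rightarrow> 'a set" where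
  "S_sph S m = {s \<in> S. pos_def_on m (component S m s)}"

definition S_aff :: "'a set \<Rightarrow> ('a \<Rightarrow> 'a \<Rightarrow> enat) \<Rightarrow> 'a set" where
  "S_aff S m = {s \<in> S. pos_semidef_on m (component S m s) \<and> \<not> pos_def_on m (component S m s)}"

text \<open>W_sph and W_aff x W_sph, as (internal direct product) subgroups of W.\<close>
definition W_sph :: "'a set \<Rightarrow> ('a \<Rightarrow> 'a \<Rightarrow> enat) \<Rightarrow> 'a list set set" where
  "W_sph S m = parabolic S m (S_sph S m)"

definition W_aff_sph :: "'a set \<Rightarrow> ('a \<Rightarrow> 'a \<Rightarrow> enat) \<Rightarrow> 'a list set set" where
  "W_aff_sph S m = parabolic S m (S_aff S m \<union> S_sph S m)"

text \<open>Letters: (generator a/b as False/True, inverse flag). Free reduction.\<close>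
fun free_reduce :: "(bool \<times> bool) list \<Rightarrow> (bool \<times> bool) list" where
  "free_reduce [] = []"
| "free_reduce (x # xs) =
     (case free_reduce xs of
        [] \<Rightarrow> [x]
      | y # ys \<Rightarrow> (if fst x = fst y \<and> snd x \<noteq> snd y then ys else x # y # ys))"

definition F2 :: "(bool \<times> bool) list monoid" where
  "F2 = \<lparr> carrier = {w. free_reduce w = w},
          monoid.mult = (\<lambda>u v. free_reduce (u @ v)),
          monoid.one = [] \<rparr>"

definition narrow :: "('g, 'b) monoid_scheme \<Rightarrow> 'g set \<Rightarrow> bool" where
  "narrow G H \<longleftrightarrow> \<not> (\<exists>K. subgroup K G \<and> K \<subseteq> H \<and> subgroup_generated G K \<cong> F2)"

end

theory Submission
  imports Defs "HOL-Real_Asymp.Real_Asymp" "HOL-Analysis.Function_Topology"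
begin

text \<open>
  W acts on the space V spanned by the simple roots. By the theorem of Tits every root is a
  nonnegative or a nonpositive combination of simple roots, so the action is faithful and each
  element makes only finitely many positive roots negative.

  If the form on S is positive definite, the functional height (sum of coordinates) is the product
  with a vector rho, and the length of w is at most the product of rho with itself. If the form is
  semidefinite, w determines height o w - height, which is the product with a vector whose norm is
  at most linear in the length of w; for distinct elements these vectors are uniformly separated.
  Hence W has polynomial growth, whereas the number of positive words in two free generators grows
  exponentially.

  Let J be a component on which the form is not positive definite. An eigenvector c of the form
  for its least eigenvalue can be chosen nonnegative, and then w c \<ge> c for all w. If H is finite
  and normal, V(J) is a sum of two submodules, the fixed vectors of H and the vectors with zero
  average. Any submodule is V(J) or lies in the radical, and the average of c is nonzero, so H
  acts trivially on V(J).

  If the form on J is indefinite and h in H acts nontrivially on V(J), some product of two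
  reflections in H is hyperbolic, with isotropic eigenvectors vp and vm. There is a root theta
  having products of the same strict sign with vp and vm; its translates by large powers of
  the hyperbolic element are positive roots with pairwise products at most -1. The corresponding
  reflections generate a free product of groups of order two, and products of two of them lie in H.
\<close>

section \<open>Words and the geometric representation\<close>

text \<open>Reflections need not lie in H. Normality enters through commutators: for
  \<open>h\<close> in H and a reflection \<open>\<rho>\<close>, the element
  \<open>\<rho> h \<rho> h^-1\<close> lies in H and is a product of two reflections. The form may be
  degenerate on a generic component, so vectors are compared through their products with simple
  roots, that is, modulo the radical. Two tools take the place of the Tits cone. One is the
  eigenvector c: every letter of J in a reduced word w lowers the product of w c with c by a fixed
  amount, so this number detects whether w acts on V(J). The other is the set of vectors with
  nonnegative orbit: it is closed under addition and the form is nonpositive on its elements, so its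
  isotropic members have pairwise nonpositive products. Up to a common sign vp and vm belong to it,
  and this yields the sign information about roots relative to the axis. The root in the plane of vp
  and vm does not suffice for a free subgroup: its products with vp and vm have opposite signs, and
  the reflections in its translates lie in one infinite dihedral group. Hence the search for
  theta.\<close>

lemma cox_eq_context:
  "cox_eq S m u v \<Longrightarrow> cox_eq S m (x @ u @ y) (x @ v @ y)"
proof (induction rule: cox_eq.induct)
  case (cancel s u v)
  then show ?case using cox_eq.cancel[of s S m "x @ u" "v @ y"] by simp
next
  case (braid s t k u v)
  then show ?case using cox_eq.braid[of s S t m k "x @ u" "v @ y"] by simp
qed (auto intro: cox_eq.intros)

lemma cox_eq_append:
  assumes "cox_eq S m u u'" "cox_eq S m v v'"
  shows "cox_eq S m (u @ v) (u' @ v')"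
  using cox_eq_context[OF assms(1), of "[]" v] cox_eq_context[OF assms(2), of u' "[]"]
  by (auto intro: cox_eq.trans)

text \<open>Every relator has even length. This excludes equal lengths of \<open>w\<close> and
  \<open>w s\<close> in \<open>reduced_snoc_cases\<close>.\<close>

lemma cox_eq_even_length: "cox_eq S m u v \<Longrightarrow> even (length u) = even (length v)"
proof (induction rule: cox_eq.induct)
  case (braid s t k u v)
  have "length (concat (replicate k [s, t])) = 2 * k" by (induction k) auto
  then show ?case by simp
qed auto

lemma cox_eq_lists: "cox_eq S m u v \<Longrightarrow> u \<in> lists S \<longleftrightarrow> v \<in> lists S"
proof (induction rule: cox_eq.induct)
  case (braid s t k u v)
  have "concat (replicate k [s, t]) \<in> lists S"
    using braid(1,2) by (induct k) auto
  then show ?case by simp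
qed auto

lemma rev_cox_eq_Nil: "w \<in> lists S \<Longrightarrow> cox_eq S m (rev w @ w) []"
proof (induction w)
  case (Cons s w)
  then have "cox_eq S m (rev w @ [s, s] @ w) (rev w @ w)"
    by (intro cox_eq.cancel) auto
  with Cons show ?case by (auto intro: cox_eq.trans)
qed (auto intro: cox_eq.refl)

lemma cox_eq_rev_Nil: "w \<in> lists S \<Longrightarrow> cox_eq S m (w @ rev w) []"
  using rev_cox_eq_Nil[of "rev w"] by (auto simp: in_lists_conv_set)

text \<open>The recursion fixes the last letter \<open>b\<close>, because the last letter of a word
  acts first: \<open>alternating n s t\<close> applied to \<open>alpha s\<close> begins with the
  reflection in \<open>t\<close>.\<close>

fun alternating :: "nat \<Rightarrow> 'a \<Rightarrow> 'a \<Rightarrow> 'a list" where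
  "alternating 0 a b = []"
| "alternating (Suc n) a b = alternating n b a @ [b]"

lemma length_alternating [simp]: "length (alternating n a b) = n"
  by (induction n arbitrary: a b) auto

lemma set_alternating: "set (alternating n a b) \<subseteq> {a, b}"
  by (induction n arbitrary: a b) auto

lemma alternating_Cons:
  "alternating (Suc n) a b = (if even n then b else a) # alternating n a b"
  by (induction n arbitrary: a b) auto

lemma alternating_add:
  "\<exists>p. alternating (i + j) a b = p @ alternating j a b \<and> length p = i"
  by (induction i) (auto simp: alternating_Cons simp del: alternating.simps(2))

lemma alternating_double: "alternating (2 * k) a b = concat (replicate k [a, b])"
  by (induction k) (auto simp: alternating_Cons simp del: alternating.simps(2))

text \<open>\<open>cheb x n\<close> is the Chebyshev polynomial of the second kind of index n - 1,
  so at \<open>cos t\<close> it is \<open>sin (n t) / sin t\<close>. The recursion also covers x =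
  1, the case of an infinite label, where the value is n.\<close>

fun cheb :: "real \<Rightarrow> nat \<Rightarrow> real" where
  "cheb x 0 = 0"
| "cheb x (Suc 0) = 1"
| "cheb x (Suc (Suc n)) = 2 * x * cheb x (Suc n) - cheb x n"

lemma sin_mult_cheb: "sin t * cheb (cos t) n = sin (real n * t)"
proof (induction "cos t" n rule: cheb.induct)
  case (3 n)
  have a: "sin (real (Suc (Suc n)) * t) = sin (real (Suc n) * t + t)"
       "sin (real n * t) = sin (real (Suc n) * t - t)"
    by (simp_all add: algebra_simps)
  have "sin (real (Suc (Suc n)) * t) + sin (real n * t) = 2 * cos t * sin (real (Suc n) * t)"
    unfolding a sin_add sin_diff by simp
  with 3 show ?case by (simp add: algebra_simps)
qed auto

lemma cheb_1: "cheb 1 n = real n"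
proof -
  have "x = 1 \<Longrightarrow> cheb x n = real n" for x
    by (induction x n rule: cheb.induct) auto
  then show ?thesis by simp
qed

section \<open>The reflection action of words on the span of the simple roots\<close>

locale coxeter_system =
  fixes S :: "'a set" and m :: "'a \<Rightarrow> 'a \<Rightarrow> enat"
  assumes coxeter_matrix: "coxeter_matrix S m"
begin

abbreviation "form \<equiv> canon_form m"

abbreviation eqv :: "'a list \<Rightarrow> 'a list \<Rightarrow> bool" where
  "eqv \<equiv> cox_eq S m"

definition bil :: "('a \<Rightarrow> real) \<Rightarrow> ('a \<Rightarrow> real) \<Rightarrow> real" where
  "bil u v = (\<Sum>s\<in>S. \<Sum>t\<in>S. u s * v t * form s t)"

definition alpha :: "'a \<Rightarrow> 'a \<Rightarrow> real" where
  "alpha s = (\<lambda>t. if t = s then 1 else 0)"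

definition srefl :: "'a \<Rightarrow> ('a \<Rightarrow> real) \<Rightarrow> 'a \<Rightarrow> real" where
  "srefl s v = (\<lambda>x. v x - 2 * bil (alpha s) v * alpha s x)"

fun act :: "'a list \<Rightarrow> ('a \<Rightarrow> real) \<Rightarrow> 'a \<Rightarrow> real" where
  "act [] v = v"
| "act (s # w) v = srefl s (act w v)"

lemma finite_S [simp]: "finite S"
  using coxeter_matrix by (simp add: coxeter_matrix_def)

lemma m_sym: "s \<in> S \<Longrightarrow> t \<in> S \<Longrightarrow> m s t = m t s"
  using coxeter_matrix by (auto simp: coxeter_matrix_def)

lemma m_ge_2: "s \<in> S \<Longrightarrow> t \<in> S \<Longrightarrow> s \<noteq> t \<Longrightarrow> m s t \<ge> 2"
  using coxeter_matrix by (auto simp: coxeter_matrix_def)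

lemma m_enat_ge_2: "s \<in> S \<Longrightarrow> t \<in> S \<Longrightarrow> s \<noteq> t \<Longrightarrow> m s t = enat k \<Longrightarrow> k \<ge> 2"
  using m_ge_2[of s t] by (simp add: numeral_eq_enat)

lemma form_sym: "s \<in> S \<Longrightarrow> t \<in> S \<Longrightarrow> form s t = form t s"
  by (simp add: canon_form_def m_sym)

lemma form_refl: "s \<in> S \<Longrightarrow> form s s = 1"
  using coxeter_matrix by (auto simp: coxeter_matrix_def canon_form_def one_enat_def)

lemma form_nonpos:
  assumes "s \<in> S" "t \<in> S" "s \<noteq> t" shows "form s t \<le> 0"
proof (cases "m s t")
  case (enat k)
  then have "k \<ge> 2" using m_enat_ge_2 assms by blast
  then have "pi / real k \<le> pi / 2" by (intro divide_left_mono) auto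
  then have "cos (pi / real k) \<ge> 0"
    by (intro cos_ge_zero) (auto intro: order.trans[of _ 0])
  with enat show ?thesis by (simp add: canon_form_def)
qed (simp add: canon_form_def)

lemma form_ge: "form s t \<ge> -1"
  by (auto simp: canon_form_def split: enat.splits)

lemma abs_form_le_1: "\<bar>form s t\<bar> \<le> 1"
  by (auto simp: canon_form_def split: enat.splits)

lemma form_eq_0_iff:
  assumes "s \<in> S" "t \<in> S" "s \<noteq> t" shows "form s t = 0 \<longleftrightarrow> m s t = 2"
proof (cases "m s t")
  case (enat k)
  then have k: "k \<ge> 2" using m_enat_ge_2 assms by blast
  show ?thesis
  proof (cases "k = 2")
    case True
    with enat show ?thesis by (simp add: canon_form_def numeral_eq_enat)
  next
    case False
    with k have "k \<ge> 3" by simp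
    then have "pi / real k < pi / 2" by (intro divide_strict_left_mono) auto
    moreover have "0 < pi / real k" using k by simp
    ultimately have "cos (pi / real k) > 0" by (intro cos_gt_zero) auto
    with enat False show ?thesis by (auto simp: canon_form_def numeral_eq_enat)
  qed
qed (auto simp: canon_form_def numeral_eq_enat)

lemma bil_sym: "bil u v = bil v u"
  unfolding bil_def by (subst sum.swap) (auto intro!: sum.cong simp: form_sym)

lemma bil_add1 [simp]: "bil (\<lambda>x. u x + v x) w = bil u w + bil v w"
  by (simp add: bil_def algebra_simps sum.distrib)

lemma bil_scale1 [simp]: "bil (\<lambda>x. c * u x) w = c * bil u w"
  by (simp add: bil_def algebra_simps sum_distrib_left)

lemma bil_scale1' [simp]: "bil (\<lambda>x. u x * c) w = c * bil u w"
  using bil_scale1[of c u w] by (simp add: mult.commute)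

lemma bil_uminus1 [simp]: "bil (\<lambda>x. - u x) w = - bil u w"
  using bil_scale1[of "-1" u w] by simp

lemma bil_diff1 [simp]: "bil (\<lambda>x. u x - v x) w = bil u w - bil v w"
  using bil_add1[of u "\<lambda>x. - v x" w] by simp

lemma bil_divide1 [simp]: "bil (\<lambda>x. u x / c) w = bil u w / c"
  using bil_scale1[of "1/c" u w] by simp

lemma bil_zero1 [simp]: "bil (\<lambda>x. 0) w = 0"
  by (simp add: bil_def)

lemma bil_add2 [simp]: "bil w (\<lambda>x. u x + v x) = bil w u + bil w v"
  by (simp add: bil_sym[of w])

lemma bil_scale2 [simp]: "bil w (\<lambda>x. c * u x) = c * bil w u"
  by (simp add: bil_sym[of w])

lemma bil_scale2' [simp]: "bil w (\<lambda>x. u x * c) = c * bil w u"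
  by (simp add: bil_sym[of w])

lemma bil_uminus2 [simp]: "bil w (\<lambda>x. - u x) = - bil w u"
  by (simp add: bil_sym[of w])

lemma bil_diff2 [simp]: "bil w (\<lambda>x. u x - v x) = bil w u - bil w v"
  by (simp add: bil_sym[of w])

lemma bil_divide2 [simp]: "bil w (\<lambda>x. u x / c) = bil w u / c"
  by (simp add: bil_sym[of w])

lemma bil_zero2 [simp]: "bil w (\<lambda>x. 0) = 0"
  by (simp add: bil_sym[of w])

lemma bil_sum1: "finite I \<Longrightarrow> bil (\<lambda>x. \<Sum>i\<in>I. u i x) w = (\<Sum>i\<in>I. bil (u i) w)"
  by (induction I rule: finite_induct) auto

lemma bil_sum2: "finite I \<Longrightarrow> bil w (\<lambda>x. \<Sum>i\<in>I. u i x) = (\<Sum>i\<in>I. bil w (u i))"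
  by (simp add: bil_sym[of w] bil_sum1)

lemma bil_alpha1: "s \<in> S \<Longrightarrow> bil (alpha s) v = (\<Sum>t\<in>S. v t * form s t)"
  unfolding bil_def alpha_def
  by (subst sum.remove[of _ s]) (auto intro!: sum.neutral)

lemma bil_alpha_alpha: "s \<in> S \<Longrightarrow> t \<in> S \<Longrightarrow> bil (alpha s) (alpha t) = form s t"
  unfolding bil_alpha1 unfolding alpha_def
  by (subst sum.remove[of _ t]) (auto intro!: sum.neutral)

lemma bil_alpha_self [simp]: "s \<in> S \<Longrightarrow> bil (alpha s) (alpha s) = 1"
  by (simp add: bil_alpha_alpha form_refl)

lemma bil_expand1: "bil u v = (\<Sum>s\<in>S. u s * bil (alpha s) v)"
proof -
  have "u s * bil (alpha s) v = (\<Sum>t\<in>S. u s * v t * form s t)" if "s \<in> S" for s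
    by (simp only: bil_alpha1[OF that] sum_distrib_left mult.assoc)
  then show ?thesis by (simp add: bil_def[of u v])
qed

lemma alpha_self [simp]: "alpha s s = 1" and alpha_other: "x \<noteq> s \<Longrightarrow> alpha s x = 0"
  by (auto simp: alpha_def)

lemma alpha_nonneg: "alpha s x \<ge> 0"
  by (auto simp: alpha_def)

lemma alpha_expand:
  assumes "\<And>x. x \<notin> T \<Longrightarrow> v x = 0" "finite T"
  shows "v = (\<lambda>x. \<Sum>s\<in>T. v s * alpha s x)"
proof
  fix x
  show "v x = (\<Sum>s\<in>T. v s * alpha s x)"
    using assms by (cases "x \<in> T") (auto simp: alpha_def if_distrib cong: if_cong)
qed

lemma srefl_add: "srefl s (\<lambda>x. u x + v x) = (\<lambda>x. srefl s u x + srefl s v x)"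
  by (auto simp: srefl_def algebra_simps)

lemma srefl_scale: "srefl s (\<lambda>x. c * u x) = (\<lambda>x. c * srefl s u x)"
  by (auto simp: srefl_def algebra_simps)

lemma act_add: "act w (\<lambda>x. u x + v x) = (\<lambda>x. act w u x + act w v x)"
  by (induction w) (auto simp: srefl_add)

lemma act_scale: "act w (\<lambda>x. c * u x) = (\<lambda>x. c * act w u x)"
  by (induction w) (auto simp: srefl_scale)

lemma act_uminus: "act w (\<lambda>x. - u x) = (\<lambda>x. - act w u x)"
  using act_scale[of w "-1" u] by simp

lemma act_diff: "act w (\<lambda>x. u x - v x) = (\<lambda>x. act w u x - act w v x)"
  using act_add[of w u "\<lambda>x. - v x"] by (simp add: act_uminus)

lemma act_divide: "act w (\<lambda>x. u x / c) = (\<lambda>x. act w u x / c)"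
  using act_scale[of w "1/c" u] by simp

lemma act_zero: "act w (\<lambda>x. 0) = (\<lambda>x. 0)"
  using act_scale[of w 0 "\<lambda>x. 0"] by simp

lemma act_sum: "finite I \<Longrightarrow> act w (\<lambda>x. \<Sum>i\<in>I. u i x) = (\<lambda>x. \<Sum>i\<in>I. act w (u i) x)"
  by (induction I rule: finite_induct) (auto simp: act_zero act_add)

lemmas act_linear = act_add act_scale act_uminus act_diff act_divide act_zero

lemma act_append: "act (u @ v) x = act u (act v x)"
  by (induction u) auto

lemma act_expand:
  assumes "\<And>x. x \<notin> T \<Longrightarrow> v x = 0" "finite T"
  shows "act w v = (\<lambda>x. \<Sum>s\<in>T. v s * act w (alpha s) x)"
proof -
  have "act w v = act w (\<lambda>x. \<Sum>s\<in>T. v s * alpha s x)"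
    by (rule arg_cong[OF alpha_expand[OF assms]])
  then show ?thesis
    using act_sum[OF assms(2), of w "\<lambda>s x. v s * alpha s x"] by (simp add: act_scale)
qed

lemma srefl_srefl [simp]: "s \<in> S \<Longrightarrow> srefl s (srefl s v) = v"
  by (auto simp: srefl_def)

lemma bil_srefl: "s \<in> S \<Longrightarrow> bil (srefl s u) (srefl s v) = bil u v"
  by (simp add: srefl_def algebra_simps bil_sym[of u "alpha s"])

lemma bil_act: "w \<in> lists S \<Longrightarrow> bil (act w u) (act w v) = bil u v"
  by (induction w) (auto simp: bil_srefl)

lemma srefl_alpha_self: "s \<in> S \<Longrightarrow> srefl s (alpha s) = (\<lambda>x. - alpha s x)"
  by (auto simp: srefl_def)

text \<open>Each further reflection replaces one coefficient x by
  \<open>2 * (- form s t) * y - x\<close>, with y the other one, which is the Chebyshev recursion.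
  The parity of n tells which coefficient changed last.\<close>

lemma act_alternating:
  assumes "s \<in> S" "t \<in> S" "s \<noteq> t"
  shows "act (alternating n s t) (alpha s) =
     (\<lambda>x. cheb (- form s t) (if even n then Suc n else n) * alpha s x +
          cheb (- form s t) (if even n then n else Suc n) * alpha t x)"
proof (induction n)
  case (Suc n)
  have st: "bil (alpha s) (alpha t) = form s t" "bil (alpha t) (alpha s) = form s t"
    using assms by (auto simp: bil_alpha_alpha form_sym)
  show ?case
    unfolding alternating_Cons using assms Suc st
    by (auto simp: srefl_def algebra_simps)
qed auto

text \<open>With z = pi / k these are values of sin (j z) / sin z, and sin z > 0 because k \<ge>
  2.\<close>

lemma cheb_period:
  assumes "s \<in> S" "t \<in> S" "s \<noteq> t" "m s t = enat k"
  shows "cheb (- form s t) (2 * k) = 0"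
        "cheb (- form s t) (Suc (2 * k)) = 1"
        "cheb (- form s t) (2 * k - 1) = -1"
        "j \<le> k \<Longrightarrow> cheb (- form s t) j \<ge> 0"
proof -
  have k: "k \<ge> 2" using m_enat_ge_2 assms by blast
  define z where "z = pi / real k"
  have f: "- form s t = cos z" using assms by (simp add: canon_form_def z_def)
  have z: "0 < z" "z \<le> pi / 2" using k divide_left_mono[of 2 "real k" pi] by (auto simp: z_def)
  then have sz: "sin z > 0" by (intro sin_gt_zero) auto
  have kz: "real k * z = pi" using k by (simp add: z_def)
  have kz2: "real (Suc (2 * k)) * z = 2 * pi + z" "real (2 * k - 1) * z = 2 * pi - z"
    using k by (auto simp: z_def field_simps of_nat_diff)
  have "sin z * cheb (cos z) (2 * k) = sin (2 * pi)"
    unfolding sin_mult_cheb using kz by (simp add: mult.assoc)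
  then show "cheb (- form s t) (2 * k) = 0" using sz f by simp
  have "sin z * cheb (cos z) (Suc (2 * k)) = sin (2 * pi + z)"
    unfolding sin_mult_cheb kz2 ..
  then have "sin z * cheb (cos z) (Suc (2 * k)) = sin z" by (simp add: sin_add)
  then show "cheb (- form s t) (Suc (2 * k)) = 1" using sz f by simp
  have "sin z * cheb (cos z) (2 * k - 1) = sin (2 * pi - z)"
    unfolding sin_mult_cheb kz2 ..
  then have "sin z * cheb (cos z) (2 * k - 1) = - sin z" by (simp add: sin_diff)
  then have "sin z * cheb (cos z) (2 * k - 1) = sin z * (-1)" by simp
  then show "cheb (- form s t) (2 * k - 1) = -1"
    using sz f by (metis mult_cancel_left less_irrefl)
  show "cheb (- form s t) j \<ge> 0" if "j \<le> k"
  proof -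
    have "real j * z \<le> real k * z" using that z by (intro mult_right_mono) auto
    then have "sin (real j * z) \<ge> 0" using kz z by (intro sin_ge_zero) auto
    then have "sin z * cheb (cos z) j \<ge> 0" by (simp add: sin_mult_cheb)
    then show ?thesis using sz f by (simp add: zero_le_mult_iff)
  qed
qed

text \<open>For a finite label the form is nondegenerate on the plane of \<open>alpha s\<close> and
  \<open>alpha t\<close>. Hence every vector is a plane vector plus one that both reflections fix,
  and on the plane the Chebyshev values give the identity.\<close>

lemma act_braid:
  assumes "s \<in> S" "t \<in> S" "s \<noteq> t" "m s t = enat k"
  shows "act (concat (replicate k [s, t])) v = v"
proof -
  define c where "c = - form s t"
  have k: "k \<ge> 2" using m_enat_ge_2 assms by blast
  let ?w = "alternating (2 * k) s t"
  have st: "bil (alpha s) (alpha t) = - c" "bil (alpha t) (alpha s) = - c"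
    using assms by (auto simp: bil_alpha_alpha form_sym c_def)
  have ws: "act ?w (alpha s) = alpha s"
    using act_alternating[OF assms(1-3), of "2 * k"] cheb_period[OF assms] by simp
  have "?w = alternating (2 * k - 1) t s @ [t]"
    using k by (cases "2 * k") auto
  then have "act ?w (alpha t) = (\<lambda>x. - act (alternating (2 * k - 1) t s) (alpha t) x)"
    using assms by (simp add: act_append srefl_alpha_self act_linear)
  also have "\<dots> = alpha t"
    using act_alternating[OF assms(2,1), of "2 * k - 1"] cheb_period[OF assms] k assms
    by (simp add: form_sym[of t s])
  finally have wt: "act ?w (alpha t) = alpha t" .
  \<comment> \<open>The Gram determinant of the two simple roots.\<close>
  have c1: "1 - c^2 \<noteq> 0"
  proof -
    have "0 < pi / real k" "pi / real k < pi" using k by (auto simp: divide_less_eq)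
    then have "sin (pi / real k) > 0" by (intro sin_gt_zero) auto
    moreover have "c = cos (pi / real k)" using assms by (simp add: c_def canon_form_def)
    ultimately show ?thesis by (simp add: sin_squared_eq[symmetric])
  qed
  define p q where "p = bil (alpha s) v" and "q = bil (alpha t) v"
  define a b where "a = (p + c * q) / (1 - c^2)" and "b = (q + c * p) / (1 - c^2)"
  define v0 where "v0 = (\<lambda>x. v x - a * alpha s x - b * alpha t x)"
  have "bil (alpha s) v0 = p - a + b * c"
    using assms st by (simp add: v0_def p_def)
  moreover have "p - a + b * c = 0" using c1 by (simp add: a_def b_def field_simps power2_eq_square)
  moreover have "bil (alpha t) v0 = q + a * c - b"
    using assms st by (simp add: v0_def q_def)
  moreover have "q + a * c - b = 0" using c1 by (simp add: a_def b_def field_simps power2_eq_square)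
  ultimately have v0: "srefl s v0 = v0" "srefl t v0 = v0" by (auto simp: srefl_def)
  have "act w v0 = v0" if "set w \<subseteq> {s, t}" for w
    using that by (induction w) (auto simp: v0)
  then have wv0: "act ?w v0 = v0" using set_alternating by metis
  have v: "(\<lambda>x. v0 x + (a * alpha s x + b * alpha t x)) = v" by (auto simp: v0_def)
  have "act ?w (\<lambda>x. v0 x + (a * alpha s x + b * alpha t x)) =
      (\<lambda>x. v0 x + (a * alpha s x + b * alpha t x))"
    by (simp add: act_linear ws wt wv0)
  then have "act ?w v = v" unfolding v .
  then show ?thesis by (simp add: alternating_double)
qed

lemma act_eqv: "eqv u v \<Longrightarrow> act u x = act v x"
proof (induction rule: cox_eq.induct)
  case (braid s t k u v)
  then show ?case using act_braid by (simp add: act_append)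
qed (auto simp: act_append)

lemma act_rev_act: "w \<in> lists S \<Longrightarrow> act (rev w) (act w v) = v"
  using act_eqv[OF rev_cox_eq_Nil] by (simp flip: act_append)

lemma act_act_rev: "w \<in> lists S \<Longrightarrow> act w (act (rev w) v) = v"
  using act_eqv[OF cox_eq_rev_Nil] by (simp flip: act_append)

lemma bil_act_rev: "w \<in> lists S \<Longrightarrow> bil (act w u) v = bil u (act (rev w) v)"
  using bil_act[of w u "act (rev w) v"] by (simp add: act_act_rev)

section \<open>Reduced words and the positivity of roots\<close>

definition reduced :: "'a list \<Rightarrow> bool" where
  "reduced w \<longleftrightarrow> w \<in> lists S \<and> (\<forall>v. eqv w v \<longrightarrow> length w \<le> length v)"

lemma reduced_lists: "reduced w \<Longrightarrow> w \<in> lists S"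
  by (simp add: reduced_def)

lemma reduced_Nil: "reduced []"
  by (simp add: reduced_def)

lemma ex_reduced:
  assumes "w \<in> lists S" obtains v where "eqv w v" "reduced v" "length v \<le> length w"
proof -
  obtain v where v: "eqv w v" "\<And>v'. eqv w v' \<Longrightarrow> length v \<le> length v'"
    using ex_has_least_nat[of "eqv w" w length] cox_eq.refl by blast
  then have "reduced v"
    unfolding reduced_def using assms cox_eq_lists[OF v(1)] cox_eq.trans[OF v(1)] by auto
  then show ?thesis using that v(1) v(2)[OF cox_eq.refl] by auto
qed

lemma reduced_appendD:
  assumes "reduced (u @ v)" shows "reduced u" "reduced v"
proof -
  have "length u \<le> length u'" if "eqv u u'" for u'
    using assms cox_eq_append[OF that cox_eq.refl, of v] by (fastforce simp: reduced_def)
  then show "reduced u" using assms by (simp add: reduced_def)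
  have "length v \<le> length v'" if "eqv v v'" for v'
    using assms cox_eq_append[OF cox_eq.refl that, of u] by (fastforce simp: reduced_def)
  then show "reduced v" using assms by (simp add: reduced_def)
qed

lemma reduced_eqvI: "reduced w \<Longrightarrow> eqv w v \<Longrightarrow> length v \<le> length w \<Longrightarrow> reduced v"
  unfolding reduced_def using cox_eq.trans[of S m w v] cox_eq_lists[of S m w v]
  by (auto intro: order.trans)

text \<open>A weak exchange property. By parity \<open>w s\<close> cannot have the length of
  \<open>w\<close>, so if it is not reduced it has an expression \<open>v\<close> shorter than
  \<open>w\<close>, and \<open>w = (w s) s\<close> is represented by \<open>v s\<close>.\<close>

lemma reduced_snoc_cases:
  assumes "reduced w" "s \<in> S"
  shows "reduced (w @ [s]) \<or> (\<exists>v. eqv w (v @ [s]) \<and> reduced (v @ [s]) \<and> length v < length w)"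
proof (cases "reduced (w @ [s])")
  case False
  have ws: "w @ [s] \<in> lists S" using assms by (simp add: reduced_def)
  obtain v where v: "eqv (w @ [s]) v" "reduced v" "length v \<le> length (w @ [s])"
    using ex_reduced[OF ws] by blast
  have "length v \<noteq> length (w @ [s])"
    using v False reduced_eqvI[OF v(2) cox_eq.sym[OF v(1)]] by auto
  moreover have "even (length v) = even (length (w @ [s]))"
    using cox_eq_even_length[OF v(1)] by simp
  then have "length v \<noteq> length w" by auto
  ultimately have less: "length v < length w" using v by auto
  have "eqv (w @ [s, s] @ []) (w @ [])" using assms by (intro cox_eq.cancel)
  moreover have "eqv ((w @ [s]) @ [s]) (v @ [s])" using v by (intro cox_eq_append cox_eq.refl)
  ultimately have e: "eqv w (v @ [s])" by (auto intro: cox_eq.trans cox_eq.sym)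
  then have "reduced (v @ [s])" using reduced_eqvI[OF assms(1)] less by simp
  with e less show ?thesis by blast
qed simp

text \<open>The alternating word of length 2k is trivial. Cutting it into pieces of lengths k - 1
  and k + 1 makes the longer piece the inverse of the shorter one.\<close>

lemma eqv_alternating_shorter:
  assumes "s \<in> S" "t \<in> S" "s \<noteq> t" "m s t = enat k"
  obtains q where "eqv (alternating (Suc k) t s) q" "length q = k - 1"
proof -
  have k: "k \<ge> 2" using m_enat_ge_2 assms by blast
  have "alternating (2 * k) t s = alternating ((k - 1) + Suc k) t s" using k by (simp add: mult_2)
  then obtain p where p: "alternating (2 * k) t s = p @ alternating (Suc k) t s" "length p = k - 1"
    using alternating_add[of "k - 1" "Suc k" t s] by auto
  have "eqv ([] @ concat (replicate k [t, s]) @ []) ([] @ [])"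
    using assms by (intro cox_eq.braid) (auto simp: m_sym)
  then have e: "eqv (p @ alternating (Suc k) t s) []" using p by (simp add: alternating_double)
  have "set (p @ alternating (Suc k) t s) \<subseteq> {t, s}" using set_alternating[of "2 * k" t s] p by simp
  then have pS: "p \<in> lists S" using assms by auto
  have "eqv (rev p @ p @ alternating (Suc k) t s) (rev p)"
    using cox_eq_append[OF cox_eq.refl[of S m "rev p"] e] by simp
  moreover have "eqv ((rev p @ p) @ alternating (Suc k) t s) ([] @ alternating (Suc k) t s)"
    using rev_cox_eq_Nil[OF pS] by (intro cox_eq_append cox_eq.refl)
  ultimately have "eqv (alternating (Suc k) t s) (rev p)"
    by (metis append_assoc append_Nil cox_eq.sym cox_eq.trans)
  then show ?thesis using that[of "rev p"] p by simp
qed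

text \<open>Write a reduced word ending in t as v @ u with u the longest possible alternating
  suffix in s and t. Maximality of u makes both v s and v t reduced, so the roots obtained from v
  are positive by induction, and u moves alpha s to a nonnegative combination of alpha s and alpha t.\<close>
theorem act_alpha_nonneg:
  "reduced (w @ [s]) \<Longrightarrow> 0 \<le> act w (alpha s) x"
proof (induction "length w" arbitrary: w s x rule: less_induct)
  case less
  have sS: "s \<in> S" and wS: "w \<in> lists S" using less.prems by (auto simp: reduced_def)
  have rw: "reduced w" using less.prems reduced_appendD by blast
  show ?case
  proof (cases w rule: rev_cases)
    case Nil
    then show ?thesis by (simp add: alpha_nonneg)
  next
    case (snoc w0 t)
    have tS: "t \<in> S" using wS snoc by simp
    have st: "s \<noteq> t"
    proof
      assume "s = t"
      then have "eqv (w0 @ [t, t] @ []) (w0 @ [])" using tS by (intro cox_eq.cancel)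
      then have "length (w @ [s]) \<le> length w0" using less.prems snoc \<open>s = t\<close>
        unfolding reduced_def by (metis append.right_neutral append_Cons append_Nil append_assoc)
      then show False using snoc by simp
    qed
    \<comment> \<open>Any expression of the same length counts, not only a suffix of
      \<open>w\<close> itself, so that rewriting \<open>v\<close> may lengthen the alternating
      part.\<close>
    define P where "P n \<longleftrightarrow> (\<exists>v. eqv w (v @ alternating n s t) \<and> length v + n = length w)" for n
    have P1: "P 1" unfolding P_def using snoc cox_eq.refl by (intro exI[of _ w0]) auto
    have Pb: "\<And>n. P n \<Longrightarrow> n \<le> length w" unfolding P_def by auto
    define n where "n = (GREATEST n. P n)"
    have Pn: "P n" using GreatestI_nat[of P, OF P1 Pb] by (simp add: n_def)
    have n1: "n \<ge> 1" using Greatest_le_nat[of P, OF P1 Pb] by (simp add: n_def)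
    have notP: "\<not> P (Suc n)" using Greatest_le_nat[of P "Suc n", OF _ Pb] by (auto simp: n_def)
    obtain v where v: "eqv w (v @ alternating n s t)" "length v + n = length w"
      using Pn by (auto simp: P_def)
    have rvu: "reduced (v @ alternating n s t)" using reduced_eqvI[OF rw v(1)] v(2) by simp
    then have rv: "reduced v" using reduced_appendD by blast
    \<comment> \<open>\<open>a\<close> is the first letter of the alternating suffix and
      \<open>b\<close> the letter that would extend it; together they are \<open>s\<close> and
      \<open>t\<close>.\<close>
    define a b where "a = (if even (n - 1) then t else s)" and "b = (if even n then t else s)"
    have ab: "{a, b} = {s, t}" using n1 by (auto simp: a_def b_def)
    have "alternating n s t = a # alternating (n - 1) s t"
      using alternating_Cons[of "n - 1" s t] n1 by (simp add: a_def)
    then have ra: "reduced (v @ [a])" using rvu reduced_appendD(1)[of "v @ [a]"] by auto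
    have rb: "reduced (v @ [b])"
    proof (rule ccontr)
      assume "\<not> reduced (v @ [b])"
      then obtain v' where v': "eqv v (v' @ [b])" "length v' < length v" "reduced (v' @ [b])"
        using reduced_snoc_cases[OF rv, of b] sS tS
        by (metis b_def)
      have "length v \<le> length (v' @ [b])" using rv v'(1) unfolding reduced_def by blast
      then have l: "length v = Suc (length v')" using v' by simp
      have "eqv w ((v' @ [b]) @ alternating n s t)"
        using v(1) cox_eq_append[OF v'(1) cox_eq.refl] cox_eq.trans by blast
      moreover have "(v' @ [b]) @ alternating n s t = v' @ alternating (Suc n) s t"
        by (simp add: alternating_Cons b_def del: alternating.simps(2))
      ultimately have "P (Suc n)" unfolding P_def using l v(2) by (intro exI[of _ v']) auto
      with notP show False by simp
    qed
    have red: "reduced (v @ [s])" "reduced (v @ [t])" using ra rb ab by (auto simp: doubleton_eq_iff)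
    have lv: "length v < length w" using v n1 by simp
    have pos: "act v (alpha s) x \<ge> 0" "act v (alpha t) x \<ge> 0" using less.hyps lv red by auto
    \<comment> \<open>Otherwise the suffix followed by \<open>s\<close> contains an alternating word
      of length k + 1, which can be shortened, against \<open>reduced (w @ [s])\<close>. Up to index
      k the Chebyshev values are nonnegative.\<close>
    have small: "n < k" if mst: "m s t = enat k" for k
    proof (rule ccontr)
      assume "\<not> n < k"
      then obtain p where p: "alternating (Suc n) t s = p @ alternating (Suc k) t s" "length p = n - k"
        using alternating_add[of "n - k" "Suc k" t s] by auto
      obtain q where q: "eqv (alternating (Suc k) t s) q" "length q = k - 1"
        using eqv_alternating_shorter[OF sS tS st mst] by blast
      have k: "k \<ge> 2" using m_enat_ge_2 sS tS st mst by blast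
      have "eqv (w @ [s]) ((v @ alternating n s t) @ [s])"
        using v(1) by (intro cox_eq_append cox_eq.refl)
      also have "(v @ alternating n s t) @ [s] = v @ p @ alternating (Suc k) t s"
        using p(1) by simp
      finally have "eqv (w @ [s]) (v @ p @ alternating (Suc k) t s)" .
      moreover have "eqv (v @ p @ alternating (Suc k) t s) (v @ p @ q)"
        using q(1) by (intro cox_eq_append cox_eq.refl)
      ultimately have "eqv (w @ [s]) (v @ p @ q)" by (rule cox_eq.trans)
      then have "length (w @ [s]) \<le> length (v @ p @ q)" using less.prems unfolding reduced_def by blast
      then show False using v(2) p(2) q(2) k \<open>\<not> n < k\<close> by simp
    qed
    have cpos: "cheb (- form s t) j \<ge> 0" if "j \<le> Suc n" for j
    proof (cases "m s t")
      case (enat k)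
      then show ?thesis using small[OF enat] that by (intro cheb_period(4)[OF sS tS st enat]) simp
    next
      case infinity
      then show ?thesis by (simp add: canon_form_def cheb_1)
    qed
    have "act w (alpha s) = act v (act (alternating n s t) (alpha s))"
      using act_eqv[OF v(1)] by (simp add: act_append)
    then show ?thesis
      using pos cpos[of n] cpos[of "Suc n"]
      unfolding act_alternating[OF sS tS st] act_linear by auto
  qed
qed

section \<open>Roots and heights\<close>

lemma canon_quad_eq_bil: "canon_quad m S v = bil v v"
  by (simp add: canon_quad_def bil_def)

definition height :: "('a \<Rightarrow> real) \<Rightarrow> real" where
  "height v = (\<Sum>s\<in>S. v s)"

text \<open>The orbit is taken under all of W, also for a component J, which makes stability under
  the action immediate.\<close>

definition roots_of :: "'a set \<Rightarrow> ('a \<Rightarrow> real) set" where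
  "roots_of J = {\<beta>. \<exists>w\<in>lists S. \<exists>s\<in>J. \<beta> = act w (alpha s)}"

definition nonneg :: "('a \<Rightarrow> real) \<Rightarrow> bool" where
  "nonneg v \<longleftrightarrow> (\<forall>x. 0 \<le> v x)"

lemma height_alpha [simp]: "s \<in> S \<Longrightarrow> height (alpha s) = 1"
  by (simp add: height_def alpha_def)

lemma height_diff: "height (\<lambda>x. u x - v x) = height u - height v"
  by (simp add: height_def sum_subtractf)

lemma height_scale: "height (\<lambda>x. c * u x) = c * height u"
  by (simp add: height_def sum_distrib_left)

lemma height_nonneg: "nonneg v \<Longrightarrow> height v \<ge> 0"
  by (simp add: height_def nonneg_def sum_nonneg)

lemma height_srefl: "s \<in> S \<Longrightarrow> height (srefl s v) = height v - 2 * bil (alpha s) v"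
  by (simp add: srefl_def height_diff height_scale)

lemma act_outside: "w \<in> lists S \<Longrightarrow> x \<notin> S \<Longrightarrow> act w v x = v x"
  by (induction w) (auto simp: srefl_def alpha_def)

lemma alpha_root: "s \<in> J \<Longrightarrow> alpha s \<in> roots_of J"
  unfolding roots_of_def by (rule CollectI, rule bexI[of _ "[]"], rule bexI[of _ s]) auto

lemma roots_ofE:
  assumes "\<beta> \<in> roots_of J"
  obtains w s where "\<beta> = act w (alpha s)" "w \<in> lists S" "s \<in> J"
  using assms unfolding roots_of_def by blast

lemma act_root:
  assumes w: "w \<in> lists S" and "\<beta> \<in> roots_of J" shows "act w \<beta> \<in> roots_of J"
proof -
  from assms(2) obtain u s where u: "\<beta> = act u (alpha s)" "u \<in> lists S" "s \<in> J" by (elim roots_ofE)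
  then have "act w \<beta> = act (w @ u) (alpha s)" "w @ u \<in> lists S" using w by (auto simp: act_append)
  then show ?thesis unfolding roots_of_def using u(3) by blast
qed

lemma root_uminus: "J \<subseteq> S \<Longrightarrow> \<beta> \<in> roots_of J \<Longrightarrow> (\<lambda>x. - \<beta> x) \<in> roots_of J"
proof -
  assume J: "J \<subseteq> S" and "\<beta> \<in> roots_of J"
  then obtain w s where w: "\<beta> = act w (alpha s)" "w \<in> lists S" "s \<in> J"
    by (auto simp: roots_of_def)
  then have "(\<lambda>x. - \<beta> x) = act (w @ [s]) (alpha s)"
    using J by (simp add: act_append srefl_alpha_self subsetD act_uminus)
  then show ?thesis using w J unfolding roots_of_def by fastforce
qed

lemma roots_mono: "J \<subseteq> Y \<Longrightarrow> roots_of J \<subseteq> roots_of Y"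
  by (auto simp: roots_of_def)

lemma bil_root_self: "\<beta> \<in> roots_of S \<Longrightarrow> bil \<beta> \<beta> = 1"
  by (elim roots_ofE) (simp add: bil_act)

lemma act_alpha_nonpos:
  assumes "reduced (w @ [s])"
  shows "act (w @ [s]) (alpha s) x \<le> 0"
proof -
  have "s \<in> S" using assms by (simp add: reduced_def)
  then show ?thesis
    using act_alpha_nonneg[OF assms, of x] by (simp add: act_append srefl_alpha_self act_uminus)
qed

lemma root_cases:
  assumes "\<beta> \<in> roots_of S"
  obtains "nonneg \<beta>" | "nonneg (\<lambda>x. - \<beta> x)"
proof -
  obtain w s where w: "\<beta> = act w (alpha s)" "w \<in> lists S" "s \<in> S"
    using assms unfolding roots_of_def by blast
  obtain v where v: "eqv w v" "reduced v" using ex_reduced[OF w(2)] by blast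
  have \<beta>: "\<beta> = act v (alpha s)" using w act_eqv[OF v(1)] by simp
  from reduced_snoc_cases[OF v(2) w(3)] show thesis
  proof
    assume "reduced (v @ [s])"
    then show thesis using that(1) act_alpha_nonneg \<beta> by (simp add: nonneg_def)
  next
    assume "\<exists>u. eqv v (u @ [s]) \<and> reduced (u @ [s]) \<and> length u < length v"
    then obtain u where u: "eqv v (u @ [s])" "reduced (u @ [s])" by blast
    then have "\<beta> = act (u @ [s]) (alpha s)" using \<beta> act_eqv by metis
    then show thesis using that(2) act_alpha_nonpos[OF u(2)] by (simp add: nonneg_def)
  qed
qed

lemma root_nonnegI:
  assumes "\<beta> \<in> roots_of S" "\<beta> x > 0" shows "nonneg \<beta>"
  using assms by (metis root_cases nonneg_def neg_0_le_iff_le not_less)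

text \<open>The last letter of a reduced expression is such an \<open>s\<close>.\<close>

lemma ex_negative_root:
  assumes "w \<in> lists S" "\<not> eqv w []"
  shows "\<exists>s\<in>S. \<forall>x. act w (alpha s) x \<le> 0"
proof -
  obtain v where v: "eqv w v" "reduced v" using ex_reduced[OF assms(1)] by blast
  then obtain u s where u: "v = u @ [s]" using assms(2) by (cases v rule: rev_cases) auto
  have "s \<in> S" using v u by (simp add: reduced_def)
  then show ?thesis using act_alpha_nonpos v u act_eqv[OF v(1)] by auto
qed

lemma act_faithful:
  assumes "w \<in> lists S" "\<And>s. s \<in> S \<Longrightarrow> act w (alpha s) = alpha s"
  shows "eqv w []"
proof (rule ccontr)
  assume "\<not> eqv w []"
  then obtain s where "s \<in> S" "\<forall>x. act w (alpha s) x \<le> 0" using ex_negative_root assms by blast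
  then have "alpha s s \<le> 0" using assms(2) by metis
  then show False by simp
qed

lemma bil_self_le_height:
  assumes "nonneg v" shows "bil v v \<le> (height v)\<^sup>2"
proof -
  have "v s * v t * form s t \<le> v s * v t" for s t
    using mult_left_mono[of "form s t" 1 "v s * v t"] abs_form_le_1[of s t] assms
    by (simp add: nonneg_def)
  then have "bil v v \<le> (\<Sum>s\<in>S. \<Sum>t\<in>S. v s * v t)" unfolding bil_def by (intro sum_mono)
  also have "\<dots> = (height v)\<^sup>2"
    by (simp add: height_def power2_eq_square sum_product)
  finally show ?thesis .
qed

text \<open>Coordinates of roots need not be integers, so the gap comes from the norm: a root has
  norm one, and the entries of the form are at most one in absolute value.\<close>

lemma height_root_ge_1:
  assumes "\<beta> \<in> roots_of S" "nonneg \<beta>" shows "height \<beta> \<ge> 1"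
proof -
  have "1 \<le> (height \<beta>)\<^sup>2" using bil_self_le_height[OF assms(2)] bil_root_self[OF assms(1)] by simp
  then show ?thesis using height_nonneg[OF assms(2)]
    by (metis abs_of_nonneg power2_le_imp_le one_power2 zero_le_one)
qed

text \<open>The reflection changes only the coordinate \<open>s\<close>, so any other positive
  coordinate keeps the root positive. A positive root supported on \<open>s\<close> alone has
  coefficient one by its norm.\<close>

lemma srefl_root_negative:
  assumes "\<beta> \<in> roots_of S" "nonneg \<beta>" "s \<in> S" "\<not> nonneg (srefl s \<beta>)"
  shows "\<beta> = alpha s"
proof -
  have r: "srefl s \<beta> \<in> roots_of S" using act_root[of "[s]" \<beta> S] assms by simp
  have z: "\<beta> x = 0" if "x \<noteq> s" for x
  proof (rule ccontr)
    assume "\<beta> x \<noteq> 0"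
    then have "\<beta> x > 0" using assms(2) by (simp add: nonneg_def order.strict_iff_order)
    then have "srefl s \<beta> x > 0" using that by (simp add: srefl_def alpha_other)
    then show False using root_nonnegI[OF r] assms(4) by blast
  qed
  then have b: "\<beta> = (\<lambda>x. \<beta> s * alpha s x)" by (auto simp: alpha_def)
  have "1 = bil (\<lambda>x. \<beta> s * alpha s x) (\<lambda>x. \<beta> s * alpha s x)"
    using bil_root_self[OF assms(1)] b by simp
  then have "\<beta> s * \<beta> s = 1" using assms(3) by simp
  moreover have "\<beta> s \<ge> 0" using assms(2) by (simp add: nonneg_def)
  ultimately have "\<beta> s = 1" by (metis abs_of_nonneg abs_1 abs_square_eq_1 power2_eq_square)
  then show ?thesis using b by simp
qed

text \<open>Each new letter \<open>s\<close> in front of \<open>w\<close> adds at most one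
  inversion, the root that \<open>w\<close> sends to \<open>alpha s\<close>.\<close>

lemma finite_inversions:
  "w \<in> lists S \<Longrightarrow> finite {\<beta> \<in> roots_of S. nonneg \<beta> \<and> \<not> nonneg (act w \<beta>)}"
proof (induction w)
  case (Cons s w)
  then have s: "s \<in> S" and w: "w \<in> lists S" by auto
  have "{\<beta> \<in> roots_of S. nonneg \<beta> \<and> \<not> nonneg (act (s # w) \<beta>)} \<subseteq>
      insert (act (rev w) (alpha s)) {\<beta> \<in> roots_of S. nonneg \<beta> \<and> \<not> nonneg (act w \<beta>)}"
  proof safe
    fix \<beta> assume \<beta>: "\<beta> \<in> roots_of S" "nonneg \<beta>" "\<not> nonneg (act (s # w) \<beta>)"
       "nonneg (act w \<beta>)" "\<beta> \<noteq> act (rev w) (alpha s)"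
    then have "act w \<beta> = alpha s" using srefl_root_negative[of "act w \<beta>" s] act_root[OF w] s by simp
    then have "\<beta> = act (rev w) (alpha s)" using act_rev_act[OF w, of \<beta>] by simp
    then show False using \<beta> by simp
  qed
  then show ?case using Cons.IH[OF w] finite_subset by auto
qed simp

text \<open>Move v by a word that almost minimises the height over the orbit: then every simple root
  has almost nonpositive product with it.\<close>
lemma bil_self_nonpos_of_nonneg_orbit:
  assumes "\<And>w. w \<in> lists S \<Longrightarrow> nonneg (act w v)"
  shows "bil v v \<le> 0"
proof (rule ccontr)
  assume "\<not> bil v v \<le> 0"
  then have pos: "bil v v > 0" by simp
  define A where "A = (\<lambda>w. height (act w v)) ` lists S"
  define I where "I = Inf A"
  have A0: "a \<ge> 0" if "a \<in> A" for a using that assms height_nonneg by (auto simp: A_def)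
  have ne: "A \<noteq> {}" by (auto simp: A_def)
  have bd: "bdd_below A" using A0 by (auto simp: bdd_below_def)
  have I0: "I \<ge> 0" unfolding I_def using A0 ne by (intro cInf_greatest)
  \<comment> \<open>Small enough that \<open>(I + 1) * (e / 2)\<close>, a bound for the norm of
    \<open>y\<close>, is at most half the norm of \<open>v\<close>, which the action preserves. The
    1 keeps the height of \<open>y\<close> below \<open>I + 1\<close>.\<close>
  define e where "e = min 1 (bil v v / (I + 1))"
  have e: "e > 0" "e \<le> 1" using pos I0 by (auto simp: e_def)
  obtain w where w: "w \<in> lists S" "height (act w v) < I + e"
    using cInf_lessD[OF ne, of "I + e"] e by (auto simp: A_def I_def)
  define y where "y = act w v"
  have y0: "nonneg y" using assms w by (simp add: y_def)
  have "bil (alpha s) y \<le> e / 2" if "s \<in> S" for s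
  proof -
    have "height (act (s # w) v) \<ge> I"
      unfolding I_def A_def using w that by (intro cInf_lower bd[unfolded A_def] imageI) simp
    then show ?thesis using w height_srefl[OF that, of y] by (simp add: y_def)
  qed
  then have "bil y y \<le> (\<Sum>s\<in>S. y s * (e / 2))"
    unfolding bil_expand1[of y y] using y0 by (intro sum_mono mult_left_mono) (auto simp: nonneg_def)
  also have "\<dots> = height y * (e / 2)" by (simp add: height_def sum_distrib_right sum_divide_distrib)
  also have "\<dots> \<le> (I + 1) * (e / 2)" using w e by (intro mult_right_mono) (auto simp: y_def)
  also have "\<dots> \<le> (I + 1) * (bil v v / (I + 1) / 2)"
    using I0 unfolding e_def by (intro mult_left_mono divide_right_mono) auto
  also have "\<dots> = bil v v / 2" using I0 by (simp add: field_simps)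
  finally show False using pos bil_act[OF w(1), of v v] by (simp add: y_def)
qed

text \<open>Appending a letter \<open>s\<close> to a reduced word, if the result is reduced, adds
  \<open>- 2 * bil (alpha s) c\<close> times a positive root to the image of \<open>c\<close>, and
  this factor is nonnegative.\<close>

lemma act_ge_of_antidominant:
  assumes "\<And>s. s \<in> S \<Longrightarrow> bil (alpha s) c \<le> 0" "w \<in> lists S"
  shows "c x \<le> act w c x"
proof -
  have "reduced w \<Longrightarrow> c x \<le> act w c x" for w
  proof (induction w rule: rev_induct)
    case (snoc s w)
    have s: "s \<in> S" using snoc by (simp add: reduced_def)
    have "0 \<le> - bil (alpha s) c * act w (alpha s) x"
      using act_alpha_nonneg[OF snoc.prems] assms(1)[OF s] by (intro mult_nonneg_nonneg) auto
    moreover have "c x \<le> act w c x" using snoc reduced_appendD by blast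
    ultimately show ?case by (simp add: act_append srefl_def act_linear)
  qed simp
  moreover obtain v where "eqv w v" "reduced v" using ex_reduced[OF assms(2)] by blast
  ultimately show ?thesis using act_eqv by metis
qed

section \<open>Semidefinite forms: bounded length and separated embeddings\<close>

lemma semidef_Cauchy_Schwarz:
  fixes f :: "('a \<Rightarrow> real) \<Rightarrow> ('a \<Rightarrow> real) \<Rightarrow> real"
  assumes psd: "\<And>u. f u u \<ge> 0" and sym: "\<And>u v. f u v = f v u"
    and lin: "\<And>u v w c. f (\<lambda>x. u x + c * v x) w = f u w + c * f v w"
  shows "(f u v)\<^sup>2 \<le> f u u * f v v"
proof -
  have q: "0 \<le> f u u + 2 * c * f u v + c\<^sup>2 * f v v" for c
    using psd[of "\<lambda>x. u x + c * v x"] sym[of u "\<lambda>x. u x + c * v x"]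
     sym[of v "\<lambda>x. u x + c * v x"] sym[of v u]
    by (simp add: lin algebra_simps power2_eq_square)
  show ?thesis
  proof (cases "f v v = 0")
    case True
    have "f u v = 0"
    proof (rule ccontr)
      assume "f u v \<noteq> 0"
      \<comment> \<open>Here the quadratic is linear in c, and at this c it equals -1.\<close>
      then show False using q[of "- (f u u + 1) / (2 * f u v)"] True psd[of u]
            by (simp add: field_simps)
    qed
    then show ?thesis using True by simp
  next
    case False
    then have "f v v > 0" using psd[of v] by simp
    then show ?thesis using q[of "- f u v / f v v"]
      by (simp add: power2_eq_square field_simps)
  qed
qed

text \<open>Gram-Schmidt on the simple roots, one at a time: the residual form stays semidefinite
  and vanishes on every root already treated. Cauchy-Schwarz for the residual form lets a root of
  residual norm zero be skipped, so degenerate forms are covered.\<close>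

lemma semidef_orthonormal_family:
  assumes psd: "\<And>v. bil v v \<ge> 0"
  obtains k and e :: "nat \<Rightarrow> 'a \<Rightarrow> real"
  where "\<And>u v. bil u v = (\<Sum>i<k. bil (e i) u * bil (e i) v)"
proof -
  have "\<exists>k (e :: nat \<Rightarrow> 'a \<Rightarrow> real).
     (\<forall>u. bil u u - (\<Sum>i<k. bil (e i) u * bil (e i) u) \<ge> 0) \<and>
     (\<forall>t\<in>T. \<forall>v. bil (alpha t) v - (\<Sum>i<k. bil (e i) (alpha t) * bil (e i) v) = 0)"
    if "finite T" for T
    using that
  proof (induction T rule: finite_induct)
    case empty
    show ?case using psd by (intro exI[of _ 0]) simp
  next
    case (insert t T)
    then obtain k and e :: "nat \<Rightarrow> 'a \<Rightarrow> real" where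
      ke0: "(\<forall>u. bil u u - (\<Sum>i<k. bil (e i) u * bil (e i) u) \<ge> 0) \<and>
        (\<forall>t\<in>T. \<forall>v. bil (alpha t) v - (\<Sum>i<k. bil (e i) (alpha t) * bil (e i) v) = 0)"
      by (elim exE)
    then have ke: "\<And>u. bil u u - (\<Sum>i<k. bil (e i) u * bil (e i) u) \<ge> 0"
      "\<And>t v. t \<in> T \<Longrightarrow> bil (alpha t) v - (\<Sum>i<k. bil (e i) (alpha t) * bil (e i) v) = 0"
      by blast+
    define f where "f u v = bil u v - (\<Sum>i<k. bil (e i) u * bil (e i) v)" for u v
    have f_lin: "f (\<lambda>x. u x + c * v x) w = f u w + c * f v w" for u c v w
      by (simp add: f_def algebra_simps sum.distrib sum_distrib_left)
    have f_sym: "f u v = f v u" for u v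
      by (simp add: f_def bil_sym[of u v] mult.commute)
    have f_psd: "f u u \<ge> 0" for u using ke(1) by (simp add: f_def)
    have CS: "(f u v)\<^sup>2 \<le> f u u * f v v" for u v
      by (rule semidef_Cauchy_Schwarz[OF f_psd f_sym f_lin])
    define d where "d = f (alpha t) (alpha t)"
    show ?case
    proof (cases "d = 0")
      case True
      have "f (alpha t) v = 0" for v using CS[of "alpha t" v] True by (simp add: d_def)
      then show ?thesis using ke by (intro exI[of _ k] exI[of _ e]) (auto simp: f_def)
    next
      case False
      then have d: "d > 0" using f_psd[of "alpha t"] by (simp add: d_def)
      \<comment> \<open>\<open>alpha t\<close> minus its part in the family, scaled so that
        subtracting the square of \<open>bil g\<close> from the residual form kills
        \<open>alpha t\<close>.\<close>
      define g where "g = (\<lambda>x. (alpha t x - (\<Sum>i<k. bil (e i) (alpha t) * e i x)) / sqrt d)"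
      have g: "bil g v = f (alpha t) v / sqrt d" for v
        by (simp add: g_def f_def bil_sum1)
      define e' where "e' = e(k := g)"
      have f': "bil u v - (\<Sum>i<Suc k. bil (e' i) u * bil (e' i) v) =
           f u v - f (alpha t) u * f (alpha t) v / d" for u v
      proof -
        have "(\<Sum>i<k. bil (e' i) u * bil (e' i) v) = (\<Sum>i<k. bil (e i) u * bil (e i) v)"
          by (intro sum.cong) (auto simp: e'_def)
        moreover have "bil g u * bil g v = f (alpha t) u * f (alpha t) v / d"
          using d by (simp add: g)
        ultimately show ?thesis by (simp add: f_def e'_def)
      qed
      have "f u u - f (alpha t) u * f (alpha t) u / d \<ge> 0" for u
        using CS[of "alpha t" u] d by (simp add: d_def power2_eq_square field_simps)
      moreover have "f (alpha t') v - f (alpha t) (alpha t') * f (alpha t) v / d = 0"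
        if "t' \<in> insert t T" for t' v
      proof (cases "t' = t")
        case True
        then show ?thesis using d by (simp add: d_def)
      next
        case False
        then have "f (alpha t') u = 0" for u using that ke(2) by (simp add: f_def)
        then show ?thesis using f_sym[of "alpha t"] by simp
      qed
      ultimately show ?thesis by (intro exI[of _ "Suc k"] exI[of _ e'], unfold f', blast)
    qed
  qed
  from this[OF finite_S] obtain k and e :: "nat \<Rightarrow> 'a \<Rightarrow> real" where
    "(\<forall>u. bil u u - (\<Sum>i<k. bil (e i) u * bil (e i) u) \<ge> 0) \<and>
     (\<forall>t\<in>S. \<forall>v. bil (alpha t) v - (\<Sum>i<k. bil (e i) (alpha t) * bil (e i) v) = 0)"
    by (elim exE)
  then have ke: "bil (alpha t) v = (\<Sum>i<k. bil (e i) (alpha t) * bil (e i) v)" if "t \<in> S" for t v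
    using that by simp
  have "bil u v = (\<Sum>i<k. bil (e i) u * bil (e i) v)" for u v
  proof -
    have "bil u v = (\<Sum>s\<in>S. u s * (\<Sum>i<k. bil (e i) (alpha s) * bil (e i) v))"
      unfolding bil_expand1[of u v] by (intro sum.cong) (auto simp: ke)
    also have "\<dots> = (\<Sum>i<k. (\<Sum>s\<in>S. u s * bil (alpha s) (e i)) * bil (e i) v)"
      by (simp add: sum_distrib_left sum_distrib_right sum.swap[of _ S] bil_sym[of "e _"] mult.assoc)
    also have "\<dots> = (\<Sum>i<k. bil (e i) u * bil (e i) v)"
      by (simp add: bil_expand1[symmetric] bil_sym)
    finally show ?thesis .
  qed
  then show ?thesis using that by blast
qed

text \<open>Each letter of a reduced word lowers the product of \<rho> with its image by twice the
  height of a positive root, hence by at least 2. As \<rho> plus its image has nonnegative norm,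
  this product never falls below \<open>- bil \<rho> \<rho>\<close>.\<close>

lemma posdef_bounded_length:
  assumes posdef: "\<And>v. \<exists>s\<in>S. v s \<noteq> 0 \<Longrightarrow> bil v v > 0"
  shows "\<exists>N. \<forall>w. reduced w \<longrightarrow> length w \<le> N"
proof -
  have psd: "bil v v \<ge> 0" for v
  proof (cases "\<exists>s\<in>S. v s \<noteq> 0")
    case False
    then show ?thesis by (simp add: bil_expand1[of v v])
  qed (use posdef in \<open>auto intro: less_imp_le\<close>)
  obtain e :: "nat \<Rightarrow> 'a \<Rightarrow> real" and k
    where e: "\<And>u v. bil u v = (\<Sum>i<k. bil (e i) u * bil (e i) v)"
    by (rule semidef_orthonormal_family[OF psd]) (rule that)
  define \<rho> where "\<rho> = (\<lambda>x. \<Sum>i<k. height (e i) * e i x)"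
  have \<rho>: "height v = bil \<rho> v" for v
  proof -
    \<comment> \<open>What the family misses of \<open>v\<close> has norm zero, so by definiteness
      it vanishes on S.\<close>
    define d where "d = (\<lambda>x. v x - (\<Sum>i<k. bil (e i) v * e i x))"
    have "bil d d = bil v d - (\<Sum>i<k. bil (e i) v * bil (e i) d)"
      by (subst (1) d_def) (simp add: bil_sum1)
    also have "\<dots> = 0" by (simp only: e[of v d] diff_self)
    finally have "\<not> (\<exists>s\<in>S. d s \<noteq> 0)" using posdef[of d] by auto
    then have "height v = (\<Sum>s\<in>S. \<Sum>i<k. bil (e i) v * e i s)"
      by (simp add: height_def d_def)
    also have "\<dots> = (\<Sum>i<k. bil (e i) v * height (e i))"
      by (subst sum.swap) (simp add: height_def sum_distrib_left)
    also have "\<dots> = bil \<rho> v" by (simp add: \<rho>_def bil_sum1 mult.commute)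
    finally show ?thesis .
  qed
  have len: "reduced w \<Longrightarrow> 2 * real (length w) \<le> bil \<rho> \<rho> - bil \<rho> (act w \<rho>)" for w
  proof (induction w rule: rev_induct)
    case (snoc s w)
    have s: "s \<in> S" using snoc by (simp add: reduced_def)
    have w: "reduced w" using snoc reduced_appendD by blast
    have "act w (alpha s) \<in> roots_of S" using act_root[OF reduced_lists[OF w] alpha_root[OF s]] .
    moreover have "nonneg (act w (alpha s))" using act_alpha_nonneg[OF snoc.prems] by (simp add: nonneg_def)
    ultimately have "bil \<rho> (act w (alpha s)) \<ge> 1"
      using height_root_ge_1[of "act w (alpha s)"] by (simp only: \<rho>)
    moreover have "bil (alpha s) \<rho> = 1" using \<rho>[of "alpha s"] s by (simp add: bil_sym[of "alpha s" \<rho>])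
    ultimately show ?case using snoc.IH[OF w] by (simp add: act_append srefl_def act_linear)
  qed simp
  have "length w \<le> nat \<lceil>bil \<rho> \<rho>\<rceil>" if "reduced w" for w
  proof -
    have "bil (\<lambda>x. \<rho> x + act w \<rho> x) (\<lambda>x. \<rho> x + act w \<rho> x) \<ge> 0" by fact
    then have "bil \<rho> \<rho> + bil \<rho> (act w \<rho>) \<ge> 0"
      using bil_act[OF reduced_lists[OF that], of \<rho> \<rho>] by (simp add: bil_sym[of "act w \<rho>" \<rho>])
    then show ?thesis using len[OF that] by linarith
  qed
  then show ?thesis by blast
qed

text \<open>In the definite case this is \<open>w^-1 \<rho> - \<rho>\<close>. The recursion
  expresses it through roots alone, so it makes sense even when no \<rho> represents the
  height.\<close>

fun height_cocycle :: "'a list \<Rightarrow> 'a \<Rightarrow> real" where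
  "height_cocycle [] = (\<lambda>x. 0)"
| "height_cocycle (s # w) = (\<lambda>x. height_cocycle w x - 2 * act (rev w) (alpha s) x)"

lemma height_act:
  "w \<in> lists S \<Longrightarrow> height (act w v) = height v + bil (height_cocycle w) v"
  by (induction w) (auto simp: height_srefl bil_act_rev bil_act[of "rev _"] in_lists_conv_set)

text \<open>If \<open>w\<close> and \<open>w'\<close> differ, some root \<open>v\<close> is sent to
  a simple root by \<open>w\<close> and to a negative root by \<open>w'\<close>, so the products of
  \<open>v\<close> with the two cocycles differ by at least one. Roots have coordinates of absolute
  value at most one, hence the coordinate vectors differ by at least one in the sum norm.\<close>

lemma semidef_separated_embedding:
  assumes psd: "\<And>v. bil v v \<ge> 0"
  obtains k and y :: "'a list \<Rightarrow> nat \<Rightarrow> real"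
  where "\<And>w i. w \<in> lists S \<Longrightarrow> i < k \<Longrightarrow> \<bar>y w i\<bar> \<le> 2 * real (length w)"
    and "\<And>w w'. w \<in> lists S \<Longrightarrow> w' \<in> lists S \<Longrightarrow> \<forall>i<k. real k * \<bar>y w i - y w' i\<bar> < 1 \<Longrightarrow> eqv w w'"
proof -
  obtain e :: "nat \<Rightarrow> 'a \<Rightarrow> real" and k
    where e: "\<And>u v. bil u v = (\<Sum>i<k. bil (e i) u * bil (e i) v)"
    by (rule semidef_orthonormal_family[OF psd]) (rule that)
  define y where "y w i = bil (e i) (height_cocycle w)" for w i
  have e1: "\<bar>bil (e i) \<beta>\<bar> \<le> 1" if "\<beta> \<in> roots_of S" "i < k" for \<beta> i
  proof -
    have "(bil (e i) \<beta>)\<^sup>2 \<le> (\<Sum>i<k. bil (e i) \<beta> * bil (e i) \<beta>)"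
      using that(2) by (subst sum.remove[of _ i]) (auto simp: power2_eq_square intro: sum_nonneg)
    also have "\<dots> = 1" using e[of \<beta> \<beta>] bil_root_self[OF that(1)] by simp
    finally show ?thesis by (simp add: abs_square_le_1)
  qed
  have "\<bar>y w i\<bar> \<le> 2 * real (length w)" if "w \<in> lists S" "i < k" for w i
    using that(1)
  proof (induction w)
    case Nil
    then show ?case by (simp add: y_def)
  next
    case (Cons s w)
    have "act (rev w) (alpha s) \<in> roots_of S" using Cons by (intro act_root alpha_root) (auto simp: in_lists_conv_set)
    then have "\<bar>bil (e i) (act (rev w) (alpha s))\<bar> \<le> 1" using e1 that by blast
    moreover have "\<bar>y w i\<bar> \<le> 2 * real (length w)" using Cons by simp
    moreover have "y (s # w) i = y w i - 2 * bil (e i) (act (rev w) (alpha s))" by (simp add: y_def)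
    ultimately show ?case by simp
  qed
  moreover have "eqv w w'"
    if w: "w \<in> lists S" "w' \<in> lists S" and close: "\<forall>i<k. real k * \<bar>y w i - y w' i\<bar> < 1" for w w'
  proof (rule ccontr)
    assume neq: "\<not> eqv w w'"
    have "\<not> eqv (w' @ rev w) []"
    proof
      assume "eqv (w' @ rev w) []"
      then have "eqv ((w' @ rev w) @ w) ([] @ w)" by (intro cox_eq_append cox_eq.refl)
      moreover have "eqv (w' @ (rev w @ w)) (w' @ [])"
        using rev_cox_eq_Nil[OF w(1)] by (intro cox_eq_append cox_eq.refl)
      ultimately show False using neq by (auto intro: cox_eq.trans cox_eq.sym)
    qed
    moreover have rw: "rev w \<in> lists S" using w by (auto simp: in_lists_conv_set)
    ultimately obtain s where s: "s \<in> S" "\<forall>x. act (w' @ rev w) (alpha s) x \<le> 0"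
      using ex_negative_root[of "w' @ rev w"] w by auto
    define v where "v = act (rev w) (alpha s)"
    have vr: "v \<in> roots_of S" unfolding v_def by (intro act_root alpha_root rw s)
    have "height (act w v) = 1" using w s by (simp add: v_def act_act_rev)
    moreover have "height (act w' v) \<le> 0"
      using s unfolding height_def v_def act_append by (intro sum_nonpos) auto
    ultimately have "1 \<le> bil (height_cocycle w) v - bil (height_cocycle w') v"
      using w by (simp add: height_act)
    also have "\<dots> = (\<Sum>i<k. (y w i - y w' i) * bil (e i) v)"
      by (simp add: e[of "height_cocycle w" v] e[of "height_cocycle w'" v] y_def sum_subtractf algebra_simps)
    also have "\<dots> \<le> (\<Sum>i<k. \<bar>y w i - y w' i\<bar> * 1)"
    proof (intro sum_mono)
      fix i assume "i \<in> {..<k}"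
      then have "\<bar>bil (e i) v\<bar> \<le> 1" using e1 vr by simp
      then have "\<bar>y w i - y w' i\<bar> * \<bar>bil (e i) v\<bar> \<le> \<bar>y w i - y w' i\<bar> * 1"
        by (intro mult_left_mono) auto
      then show "(y w i - y w' i) * bil (e i) v \<le> \<bar>y w i - y w' i\<bar> * 1"
        by (metis abs_ge_self abs_mult order.trans)
    qed
    finally have le: "1 \<le> (\<Sum>i<k. \<bar>y w i - y w' i\<bar>)" by simp
    then have k: "k > 0" by (cases k) auto
    have "(\<Sum>i<k. \<bar>y w i - y w' i\<bar>) < (\<Sum>i<k. 1 / real k)"
      using close k by (intro sum_strict_mono) (auto simp: field_simps)
    also have "\<dots> = 1" using k by simp
    finally show False using le by simp
  qed
  ultimately show ?thesis using that by blast
qed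

end

section \<open>The word problem and parabolic subgroups\<close>

lemma cox_eq_mono:
  assumes "T \<subseteq> S" shows "cox_eq T m u v \<Longrightarrow> cox_eq S m u v"
proof (induction rule: cox_eq.induct)
  case (cancel s u v)
  then show ?case using assms by (intro cox_eq.cancel) auto
next
  case (braid s t k u v)
  then show ?case using assms by (intro cox_eq.braid) auto
qed (auto intro: cox_eq.refl cox_eq.sym cox_eq.trans)

section \<open>Free reduction and its encoding by four involutions\<close>

lemma length_free_reduce: "length (free_reduce w) \<le> length w"
  by (induction w) (auto split: list.splits)

lemma free_reduce_Cons_fixed:
  assumes "free_reduce (x # xs) = x # xs"
  shows "free_reduce xs = xs \<and> (\<forall>y ys. xs = y # ys \<longrightarrow> \<not> (fst x = fst y \<and> snd x \<noteq> snd y))"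
  using assms length_free_reduce[of xs]
  by (cases "free_reduce xs") (auto split: if_splits)

lemma free_reduce_idem [simp]: "free_reduce (free_reduce w) = free_reduce w"
proof (induction w)
  case (Cons x xs)
  show ?case
  proof (cases "free_reduce xs")
    case (Cons y ys)
    then show ?thesis using Cons.IH free_reduce_Cons_fixed[of y ys] by auto
  qed simp
qed simp

lemma free_reduce_positive: "free_reduce (map (\<lambda>x. (x, False)) bs) = map (\<lambda>x. (x, False)) bs"
  by (induction bs) (auto split: list.splits)

text \<open>The free generators are sent to the products of the involutions 0, 1 and of the involutions
  2, 3; reduced words then become words in the involutions without repeated neighbours.\<close>
fun letter_code :: "bool \<times> bool \<Rightarrow> nat list" where
  "letter_code (False, False) = [0, 1]"
| "letter_code (False, True) = [1, 0]"
| "letter_code (True, False) = [2, 3]"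
| "letter_code (True, True) = [3, 2]"

text \<open>The last involution in the code of a letter starts the code of the inverse letter and of
  no other.\<close>

lemma distinct_adj_letter_code:
  "free_reduce w = w \<Longrightarrow> distinct_adj (concat (map letter_code w))"
proof (induction w)
  case (Cons x xs)
  then have IH: "distinct_adj (concat (map letter_code xs))"
    and ne: "\<And>y ys. xs = y # ys \<Longrightarrow> \<not> (fst x = fst y \<and> snd x \<noteq> snd y)"
    using free_reduce_Cons_fixed by blast+
  show ?case
  proof (cases xs)
    case Nil
    then show ?thesis by (cases x rule: letter_code.cases) auto
  next
    case (Cons y ys)
    then show ?thesis using IH ne[OF Cons]
      by (cases x rule: letter_code.cases; cases y rule: letter_code.cases) auto
  qed
qed simp

lemma letter_code_eq: "letter_code x @ u = letter_code y @ v \<Longrightarrow> x = y \<and> u = v"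
  by (cases x rule: letter_code.cases; cases y rule: letter_code.cases) auto

lemma letter_code_nonempty: "letter_code x \<noteq> []"
  by (cases x rule: letter_code.cases) auto

lemma inj_letter_code: "concat (map letter_code u) = concat (map letter_code v) \<Longrightarrow> u = v"
proof (induction u arbitrary: v)
  case Nil
  then show ?case using letter_code_nonempty by (cases v) auto
next
  case (Cons x u)
  then obtain y v' where v: "v = y # v'" using letter_code_nonempty by (cases v) auto
  then have "letter_code x @ concat (map letter_code u) = letter_code y @ concat (map letter_code v')"
    using Cons.prems by simp
  from letter_code_eq[OF this] show ?case using Cons.IH[of v'] v by simp
qed

text \<open>The left side has the shape of the size of the integer box in
  \<open>narrow_of_semidef\<close>, with 2N + 1 points in each direction.\<close>

lemma exp_beats_poly: "\<exists>n::nat. (c * real n + 3) ^ k < 2 ^ n"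
proof -
  have "(\<lambda>n. (real n ^ k) * (\<bar>c\<bar> + 3) ^ k / 2 ^ n) \<longlonglongrightarrow> 0"
  proof -
    have "(\<lambda>n. real n ^ k / 2 ^ n) \<longlonglongrightarrow> 0" by real_asymp
    from tendsto_mult_right_zero[OF this, of "(\<bar>c\<bar> + 3) ^ k"] show ?thesis
      by (simp add: field_simps)
  qed
  then have "eventually (\<lambda>n. (real n ^ k) * (\<bar>c\<bar> + 3) ^ k / 2 ^ n < 1) sequentially"
    by (rule order_tendstoD) simp
  then have "eventually (\<lambda>n. (real n ^ k) * (\<bar>c\<bar> + 3) ^ k / 2 ^ n < 1 \<and> n \<ge> 1) sequentially"
    using eventually_ge_at_top by (rule eventually_conj)
  then obtain n where n: "(real n ^ k) * (\<bar>c\<bar> + 3) ^ k / 2 ^ n < 1" "n \<ge> 1"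
    using eventually_happens by force
  have "(c * real n + 3) ^ k \<le> \<bar>c * real n + 3\<bar> ^ k" by (simp flip: power_abs)
  also have "\<dots> \<le> (real n * (\<bar>c\<bar> + 3)) ^ k"
  proof (intro power_mono)
    have "\<bar>c * real n + 3\<bar> \<le> \<bar>c\<bar> * real n + 3" using abs_triangle_ineq[of "c * real n" 3]
      by (simp add: abs_mult)
    then show "\<bar>c * real n + 3\<bar> \<le> real n * (\<bar>c\<bar> + 3)" using n(2) by (simp add: algebra_simps)
  qed simp
  also have "\<dots> < 2 ^ n" using n by (simp add: power_mult_distrib divide_less_eq)
  finally show ?thesis by blast
qed

context coxeter_system
begin

section \<open>The group of word classes and its parabolic subgroups\<close>

abbreviation "cls \<equiv> cox_class S m"

abbreviation "W \<equiv> cox_group S m"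

lemma cls_eq_iff: "u \<in> lists S \<Longrightarrow> v \<in> lists S \<Longrightarrow> cls u = cls v \<longleftrightarrow> eqv u v"
  unfolding cox_class_def
  by (auto intro: cox_eq.refl cox_eq.sym cox_eq.trans)

lemma mem_cls: "v \<in> cls u \<longleftrightarrow> v \<in> lists S \<and> eqv u v"
  by (simp add: cox_class_def)

lemma mult_cls:
  assumes "u \<in> lists S" "v \<in> lists S" shows "cls u \<otimes>\<^bsub>W\<^esub> cls v = cls (u @ v)"
proof -
  have "(\<exists>a\<in>cls u. \<exists>b\<in>cls v. eqv (a @ b) x) \<longleftrightarrow> eqv (u @ v) x" for x
  proof
    assume "\<exists>a\<in>cls u. \<exists>b\<in>cls v. eqv (a @ b) x"
    then obtain a b where "eqv u a" "eqv v b" "eqv (a @ b) x" by (auto simp: mem_cls)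
    then show "eqv (u @ v) x" using cox_eq_append cox_eq.trans by metis
  next
    assume "eqv (u @ v) x"
    then show "\<exists>a\<in>cls u. \<exists>b\<in>cls v. eqv (a @ b) x"
      using assms cox_eq.refl unfolding mem_cls Bex_def by blast
  qed
  then show ?thesis by (simp add: cox_group_def cox_class_def)
qed

lemma carrier_W: "carrier W = cls ` lists S"
  by (simp add: cox_group_def)

lemma one_W: "\<one>\<^bsub>W\<^esub> = cls []"
  by (simp add: cox_group_def)

lemma cls_carrier: "w \<in> lists S \<Longrightarrow> cls w \<in> carrier W"
  by (simp add: carrier_W)

lemma rev_lists: "w \<in> lists S \<Longrightarrow> rev w \<in> lists S"
  by auto

lemma append_lists: "u \<in> lists S \<Longrightarrow> v \<in> lists S \<Longrightarrow> u @ v \<in> lists S"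
  by auto

lemma group_W: "group W"
proof (rule groupI)
  fix x y z assume "x \<in> carrier W" "y \<in> carrier W" "z \<in> carrier W"
  then obtain a b c where abc: "a \<in> lists S" "b \<in> lists S" "c \<in> lists S" "x = cls a" "y = cls b" "z = cls c"
    unfolding carrier_W by blast
  then show "x \<otimes>\<^bsub>W\<^esub> y \<otimes>\<^bsub>W\<^esub> z = x \<otimes>\<^bsub>W\<^esub> (y \<otimes>\<^bsub>W\<^esub> z)"
    by (simp add: mult_cls append_lists)
  show "x \<otimes>\<^bsub>W\<^esub> y \<in> carrier W"
    using abc by (simp add: mult_cls append_lists cls_carrier)
next
  show "\<one>\<^bsub>W\<^esub> \<in> carrier W" by (simp add: one_W cls_carrier)
next
  fix x assume "x \<in> carrier W"
  then obtain a where a: "a \<in> lists S" "x = cls a" unfolding carrier_W by blast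
  then show "\<one>\<^bsub>W\<^esub> \<otimes>\<^bsub>W\<^esub> x = x" using mult_cls[of "[]" a] by (simp add: one_W)
  have "cls (rev a) \<otimes>\<^bsub>W\<^esub> x = \<one>\<^bsub>W\<^esub>"
    unfolding one_W a(2) mult_cls[OF rev_lists[OF a(1)] a(1)]
    using rev_cox_eq_Nil[OF a(1)] a(1) by (subst cls_eq_iff) auto
  then show "\<exists>y\<in>carrier W. y \<otimes>\<^bsub>W\<^esub> x = \<one>\<^bsub>W\<^esub>"
    using cls_carrier[OF rev_lists[OF a(1)]] by blast
qed

lemma inv_cls_eqI:
  assumes "u \<in> lists S" "v \<in> lists S" "eqv (u @ v) []" shows "inv\<^bsub>W\<^esub> (cls v) = cls u"
proof (rule group.inv_equality[OF group_W])
  show "cls u \<otimes>\<^bsub>W\<^esub> cls v = \<one>\<^bsub>W\<^esub>"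
    unfolding one_W mult_cls[OF assms(1,2)] using assms by (subst cls_eq_iff) auto
qed (simp_all add: assms cls_carrier)

lemma inv_cls: "w \<in> lists S \<Longrightarrow> inv\<^bsub>W\<^esub> (cls w) = cls (rev w)"
  by (intro inv_cls_eqI rev_cox_eq_Nil rev_lists)

lemma parabolic_eq:
  assumes "T \<subseteq> S" shows "parabolic S m T = cls ` lists T"
proof
  have TS: "lists T \<subseteq> lists S" using assms by (rule lists_mono)
  show "parabolic S m T \<subseteq> cls ` lists T"
  proof
    fix x assume "x \<in> parabolic S m T"
    then have "x \<in> generate W (cox_gen S m ` T)" by (simp add: parabolic_def)
    then show "x \<in> cls ` lists T"
    proof (induction rule: generate.induct)
      case one
      then show ?case by (auto simp: one_W)
    next
      case (incl h)
      then show ?case by (auto simp: cox_gen_def)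
    next
      case (inv h)
      then obtain s where s: "s \<in> T" "h = cls [s]" by (auto simp: cox_gen_def)
      then have "inv\<^bsub>W\<^esub> h = cls [s]" using inv_cls[of "[s]"] assms by auto
      then show ?case using s by auto
    next
      case (eng h1 h2)
      then obtain u v where uv: "u \<in> lists T" "v \<in> lists T" "h1 = cls u" "h2 = cls v" by blast
      then have "h1 \<otimes>\<^bsub>W\<^esub> h2 = cls (u @ v)" using TS mult_cls[of u v] by blast
      moreover have "u @ v \<in> lists T" using uv by auto
      ultimately show ?case by blast
    qed
  qed
  show "cls ` lists T \<subseteq> parabolic S m T"
  proof
    fix x assume "x \<in> cls ` lists T"
    then obtain w where w: "w \<in> lists T" "x = cls w" by blast
    have "cls w \<in> generate W (cox_gen S m ` T)" using w(1)
    proof (induction w)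
      case Nil
      then show ?case using generate.one[of W] by (simp add: one_W)
    next
      case (Cons s w)
      then have "cls ([s] @ w) = cls [s] \<otimes>\<^bsub>W\<^esub> cls w"
        using assms TS by (intro mult_cls[symmetric]) auto
      moreover have "cls [s] \<in> generate W (cox_gen S m ` T)"
        using Cons by (intro generate.incl) (auto simp: cox_gen_def)
      ultimately show ?case using Cons generate.eng by fastforce
    qed
    then show "x \<in> parabolic S m T" by (simp add: parabolic_def w)
  qed
qed

lemma coxeter_system_subset: "T \<subseteq> S \<Longrightarrow> coxeter_system T m"
proof
  assume T: "T \<subseteq> S"
  then show "Defs.coxeter_matrix T m"
    using coxeter_matrix finite_subset[OF T finite_S] unfolding coxeter_matrix_def by blast
qed

text \<open>The length bound is applied in the Coxeter system of T itself; equalities there pass to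
  W by \<open>cox_eq_mono\<close>.\<close>

lemma finite_parabolic_of_posdef:
  assumes T: "T \<subseteq> S" and pd: "pos_def_on m T"
  shows "finite (parabolic S m T)"
proof -
  interpret T: coxeter_system T m by (rule coxeter_system_subset[OF T])
  have "T.bil v v > 0" if "\<exists>s\<in>T. v s \<noteq> 0" for v
    using pd that by (simp add: pos_def_on_def T.canon_quad_eq_bil)
  then obtain N where N: "\<And>w. T.reduced w \<Longrightarrow> length w \<le> N"
    using T.posdef_bounded_length by blast
  have "cls ` lists T \<subseteq> cls ` {w. set w \<subseteq> T \<and> length w \<le> N}"
  proof
    fix x assume "x \<in> cls ` lists T"
    then obtain w where w: "w \<in> lists T" "x = cls w" by blast
    obtain v where v: "cox_eq T m w v" "T.reduced v" by (rule T.ex_reduced[OF w(1)])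
    have vT: "v \<in> lists T" using v(2) by (rule T.reduced_lists)
    have "eqv w v" using cox_eq_mono[OF T v(1)] .
    then have "x = cls v"
      using w vT lists_mono[OF T] cls_eq_iff[of w v] by blast
    then show "x \<in> cls ` {w. set w \<subseteq> T \<and> length w \<le> N}"
      using vT N[OF v(2)] by auto
  qed
  moreover have "finite {w. set w \<subseteq> T \<and> length w \<le> N}"
    by (rule finite_lists_length_le) simp
  ultimately show ?thesis unfolding parabolic_eq[OF T] by (rule finite_subset[OF _ finite_imageI])
qed

text \<open>Two free generators give \<open>2 ^ n\<close> distinct positive products of n factors,
  of word length linear in n. Rounding k times their coordinates keeps them apart, and the rounded
  vectors lie in a box of polynomial size.\<close>

lemma narrow_of_semidef:
  assumes T: "T \<subseteq> S" and psd: "pos_semidef_on m T" and H: "H \<subseteq> parabolic S m T"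
  shows "narrow W H"
  unfolding narrow_def
proof
  interpret T: coxeter_system T m by (rule coxeter_system_subset[OF T])
  have TS: "lists T \<subseteq> lists S" using T by (rule lists_mono)
  assume "\<exists>K. subgroup K W \<and> K \<subseteq> H \<and> subgroup_generated W K \<cong> F2"
  then obtain K \<psi> where K: "subgroup K W" "K \<subseteq> H" and iso: "\<psi> \<in> iso (subgroup_generated W K) F2"
    by (auto simp: is_iso_def)
  have carK: "carrier (subgroup_generated W K) = K"
    by (rule subgroup.carrier_subgroup_generated_subgroup[OF K(1)])
  have hom: "\<psi> (x \<otimes>\<^bsub>W\<^esub> y) = free_reduce (\<psi> x @ \<psi> y)" if "x \<in> K" "y \<in> K" for x y
    using iso that hom_mult[of \<psi> "subgroup_generated W K" F2 x y] carK
    by (auto simp: iso_def F2_def)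
  have surj: "\<psi> ` K = carrier F2" and inj: "inj_on \<psi> K" using iso carK by (auto simp: iso_def bij_betw_def)
  have letters: "\<exists>a\<in>lists T. cls a \<in> K \<and> \<psi> (cls a) = [(x, False)]" for x
  proof -
    have "[(x, False)] \<in> \<psi> ` K" unfolding surj by (simp add: F2_def)
    then show ?thesis using K(2) H unfolding parabolic_eq[OF T] by force
  qed
  then obtain a where a: "\<And>x. a x \<in> lists T" "\<And>x. cls (a x) \<in> K" "\<And>x::bool. \<psi> (cls (a x)) = [(x, False)]"
    by metis
  define w where "w bs = concat (map a bs)" for bs
  have wT: "w bs \<in> lists T" for bs using a(1) by (induction bs) (auto simp: w_def)
  \<comment> \<open>Nonempty products only, which keeps the identity and its image out of the
    induction.\<close>
  have w_psi: "bs \<noteq> [] \<Longrightarrow> cls (w bs) \<in> K \<and> \<psi> (cls (w bs)) = map (\<lambda>x. (x, False)) bs" for bs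
  proof (induction bs)
    case (Cons x bs)
    show ?case
    proof (cases "bs = []")
      case True
      then show ?thesis using a by (simp add: w_def)
    next
      case False
      then have IH: "cls (w bs) \<in> K" "\<psi> (cls (w bs)) = map (\<lambda>x. (x, False)) bs" using Cons by auto
      have e: "cls (w (x # bs)) = cls (a x) \<otimes>\<^bsub>W\<^esub> cls (w bs)"
        using mult_cls[of "a x" "w bs"] a(1) wT TS by (simp add: w_def subsetD)
      have "cls (w (x # bs)) \<in> K" unfolding e by (rule subgroup.m_closed[OF K(1) a(2) IH(1)])
      moreover have "\<psi> (cls (w (x # bs))) = free_reduce ([(x, False)] @ map (\<lambda>x. (x, False)) bs)"
        unfolding e hom[OF a(2) IH(1)] a(3) IH(2) ..
      ultimately show ?thesis using free_reduce_positive[of "x # bs"] by simp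
    qed
  qed simp
  have distinct: "bs = bs'" if "T.eqv (w bs) (w bs')" "bs \<noteq> []" "bs' \<noteq> []" for bs bs'
  proof -
    have "eqv (w bs) (w bs')" using cox_eq_mono[OF T that(1)] .
    then have "cls (w bs) = cls (w bs')" using cls_eq_iff wT TS by blast
    then have "map (\<lambda>x. (x, False)) bs = map (\<lambda>x. (x, False)) bs'"
      using w_psi that(2,3) by metis
    then show ?thesis by (simp add: inj_on_def inj_map_eq_map)
  qed
  define L where "L = length (a False) + length (a True)"
  have "length (a x) \<le> L" for x by (cases x) (auto simp: L_def)
  then have len: "length (w bs) \<le> L * length bs" for bs
    by (induction bs) (auto simp: w_def intro: add_mono)
  have "T.bil v v \<ge> 0" for v
    using psd by (simp add: pos_semidef_on_def T.canon_quad_eq_bil)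
  then obtain k and y :: "'a list \<Rightarrow> nat \<Rightarrow> real"
    where y: "\<And>w i. w \<in> lists T \<Longrightarrow> i < k \<Longrightarrow> \<bar>y w i\<bar> \<le> 2 * real (length w)"
    and sep: "\<And>w w'. w \<in> lists T \<Longrightarrow> w' \<in> lists T \<Longrightarrow> \<forall>i<k. real k * \<bar>y w i - y w' i\<bar> < 1 \<Longrightarrow> T.eqv w w'"
    by (rule T.semidef_separated_embedding) (erule that)
  have count: "2 ^ n \<le> (real (4 * k * L) * real n + 3) ^ k" if "n \<ge> 1" for n
  proof -
    define Bs where "Bs = {bs :: bool list. length bs = n}"
    define f where "f bs = restrict (\<lambda>i. \<lfloor>real k * y (w bs) i\<rfloor>) {..<k}" for bs
    \<comment> \<open>The coordinates times k are at most \<open>2 * k * L * n\<close> in absolute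
      value; the extra one leaves room for rounding.\<close>
    define N where "N = int (2 * k * L * n) + 1"
    have ne: "bs \<noteq> []" if "bs \<in> Bs" for bs using that \<open>n \<ge> 1\<close> by (auto simp: Bs_def)
    have "inj_on f Bs"
    proof (rule inj_onI)
      fix bs bs' assume bs: "bs \<in> Bs" "bs' \<in> Bs" "f bs = f bs'"
      have "real k * \<bar>y (w bs) i - y (w bs') i\<bar> < 1" if "i < k" for i
      proof -
        have "\<lfloor>real k * y (w bs) i\<rfloor> = \<lfloor>real k * y (w bs') i\<rfloor>"
          using fun_cong[OF bs(3), of i] that by (simp add: f_def)
        then have "\<bar>real k * y (w bs) i - real k * y (w bs') i\<bar> < 1" by linarith
        then show ?thesis by (simp add: abs_mult flip: right_diff_distrib)
      qed
      then have "T.eqv (w bs) (w bs')" by (intro sep wT allI impI)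
      then show "bs = bs'" using distinct ne bs by blast
    qed
    moreover have "f ` Bs \<subseteq> {..<k} \<rightarrow>\<^sub>E {-N..N}"
    proof
      fix g assume "g \<in> f ` Bs"
      then obtain bs where bs: "bs \<in> Bs" "g = f bs" by blast
      have "\<lfloor>real k * y (w bs) i\<rfloor> \<in> {-N..N}" if "i < k" for i
      proof -
        have "\<bar>y (w bs) i\<bar> \<le> 2 * real (length (w bs))" using y wT that by blast
        also have "\<dots> \<le> 2 * real (L * n)" using len[of bs] bs(1) unfolding Bs_def mem_Collect_eq by (simp only: of_nat_le_iff)
        finally have "real k * \<bar>y (w bs) i\<bar> \<le> real k * (2 * real (L * n))" by (intro mult_left_mono) auto
        then have "\<bar>real k * y (w bs) i\<bar> \<le> real (2 * k * L * n)" by (simp add: abs_mult)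
        then show ?thesis unfolding N_def atLeastAtMost_iff by linarith
      qed
      then show "g \<in> {..<k} \<rightarrow>\<^sub>E {-N..N}" by (auto simp: bs f_def)
    qed
    moreover have "finite ({..<k} \<rightarrow>\<^sub>E {-N..N})" by (intro finite_PiE) auto
    ultimately have "card Bs \<le> card ({..<k} \<rightarrow>\<^sub>E {-N..N})" by (rule card_inj_on_le)
    moreover have "card Bs = 2 ^ n" using card_lists_length_eq[of "UNIV :: bool set" n]
      by (simp add: Bs_def)
    moreover have "card ({..<k} \<rightarrow>\<^sub>E {-N..N}) = (4 * k * L * n + 3) ^ k"
      by (simp add: card_PiE N_def nat_add_distrib algebra_simps nat_mult_distrib)
    ultimately have "2 ^ n \<le> (4 * k * L * n + 3) ^ k" by simp
    then have "real (2 ^ n) \<le> real ((4 * k * L * n + 3) ^ k)" by (simp only: of_nat_le_iff)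
    then show ?thesis by simp
  qed
  obtain n where n: "(real (4 * k * L) * real n + 3) ^ k < 2 ^ n" using exp_beats_poly by blast
  moreover have "n \<noteq> 0"
  proof
    assume "n = 0"
    then have "3 ^ k < (1::real)" using n by simp
    moreover have "(1::real) \<le> 3 ^ k" by (rule one_le_power) simp
    ultimately show False by linarith
  qed
  ultimately show False using count[of n] by simp
qed

lemma eqv_cancel_left:
  assumes "r \<in> lists S" "eqv (r @ u) (r @ v)" shows "eqv u v"
proof -
  have c: "eqv (rev r @ r @ x) x" for x
    using cox_eq_append[OF rev_cox_eq_Nil[OF assms(1), of m] cox_eq.refl, of x] by simp
  have "eqv (rev r @ (r @ u)) (rev r @ (r @ v))"
    by (rule cox_eq_append[OF cox_eq.refl assms(2)])
  with c[of u] c[of v] show ?thesis by (blast intro: cox_eq.sym cox_eq.trans)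
qed

text \<open>In the free product of four groups of order two, the product of the first pair and that
  of the second pair generate a free group. Membership in H is asked of these products, since the
  reflections themselves may lie outside H.\<close>

lemma not_narrow_of_free_product:
  fixes R :: "nat \<Rightarrow> 'a list"
  assumes H: "subgroup H W"
    and R: "\<And>j. j < 4 \<Longrightarrow> R j \<in> lists S" "\<And>j. j < 4 \<Longrightarrow> eqv (R j @ R j) []"
    and mem: "cls (R 0 @ R 1) \<in> H" "cls (R 2 @ R 3) \<in> H"
    and free: "\<And>js. js \<in> lists {..<4} \<Longrightarrow> distinct_adj js \<Longrightarrow> js \<noteq> [] \<Longrightarrow> \<not> eqv (concat (map R js)) []"
  shows "\<not> narrow W H"
proof -
  interpret W: group W by (rule group_W)
  define p where "p js = concat (map R js)" for js
  define c where "c w = concat (map letter_code w)" for w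
  have pS: "p js \<in> lists S" if "js \<in> lists {..<4}" for js
    using that R(1) by (induction js) (auto simp: p_def)
  have p_app: "p (js @ ks) = p js @ p ks" for js ks by (simp add: p_def)
  have c_app: "c (u @ v) = c u @ c v" for u v by (simp add: c_def)
  have c4: "c w \<in> lists {..<4}" for w
  proof (induction w)
    case (Cons x w)
    then show ?case by (cases x rule: letter_code.cases) (auto simp: c_def)
  qed (simp add: c_def)
  have p_rev: "eqv (p (rev js) @ p js) []" if "js \<in> lists {..<4}" for js
    using that
  proof (induction js)
    case (Cons j js)
    then have "eqv (p (rev js) @ (R j @ R j) @ p js) (p (rev js) @ [] @ p js)"
      using R(2) by (intro cox_eq_append cox_eq.refl) auto
    then show ?case using Cons by (auto simp: p_def intro: cox_eq.trans)
  qed (simp add: p_def cox_eq.refl)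
  have p_inj: "js = ks"
    if "js \<in> lists {..<4}" "ks \<in> lists {..<4}" "distinct_adj js" "distinct_adj ks" "eqv (p js) (p ks)" for js ks
    using that
  proof (induction js arbitrary: ks rule: list.induct)
    case Nil
    then show ?case using free[of ks] cox_eq.sym by (auto simp: p_def)
  next
    case (Cons j js)
    show ?case
    proof (cases ks)
      case Nil
      then show ?thesis using free[OF Cons.prems(1,3)] Cons.prems(5) by (simp add: p_def)
    next
      case (Cons k ks')
      show ?thesis
      proof (cases "j = k")
        case True
        then have "eqv (p js) (p ks')"
          using eqv_cancel_left[of "R j" "p js" "p ks'"] R(1)[of j] Cons.prems Cons by (auto simp: p_def)
        moreover have "distinct_adj js" "distinct_adj ks'"
          using Cons.prems Cons by (auto simp: distinct_adj_Cons)
        ultimately show ?thesis using Cons.IH[of ks'] Cons.prems Cons True by auto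
      next
        case False
        \<comment> \<open>Two words with different first letters: the inverse of one followed by the
          other has no equal neighbours at the joint either, so \<open>free\<close> shows that it is
          nontrivial.\<close>
        have "distinct_adj (rev (j # js) @ ks)"
          using False Cons Cons.prems unfolding distinct_adj_append_iff by (auto simp del: rev.simps simp: last_rev)
        moreover have "rev (j # js) @ ks \<in> lists {..<4}" using Cons.prems by auto
        ultimately have "\<not> eqv (p (rev (j # js) @ ks)) []" using free Cons unfolding p_def by blast
        moreover have "eqv (p (rev (j # js)) @ p (j # js)) (p (rev (j # js)) @ p ks)"
          using Cons.prems by (intro cox_eq_append cox_eq.refl)
        ultimately show ?thesis using p_rev[OF Cons.prems(1)] p_app
          by (metis cox_eq.sym cox_eq.trans)
      qed
    qed
  qed
  define \<phi> where "\<phi> w = cls (p (c w))" for w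
  have pc: "p (c w) \<in> lists S" for w using pS c4 by blast
  have code_cancel: "eqv (p (letter_code x @ letter_code y)) []"
    if "fst x = fst y" "snd x \<noteq> snd y" for x y
  proof -
    have "eqv (R i @ (R j @ R j) @ R i) []" if "i < 4" "j < 4" for i j
    proof -
      have "eqv (R i @ (R j @ R j) @ R i) (R i @ [] @ R i)"
        using R that by (intro cox_eq_append cox_eq.refl)
      then show ?thesis using R(2)[OF that(1)] by (auto intro: cox_eq.trans)
    qed
    from this[of 0 1] this[of 1 0] this[of 2 3] this[of 3 2] show ?thesis
      using that by (cases x rule: letter_code.cases; cases y rule: letter_code.cases) (auto simp: p_def)
  qed
  have red: "eqv (p (c (free_reduce w))) (p (c w))" for w
  proof (induction w)
    case (Cons x xs)
    have e: "eqv (p (letter_code x) @ p (c (free_reduce xs))) (p (letter_code x) @ p (c xs))"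
      using Cons.IH by (intro cox_eq_append cox_eq.refl)
    have cx: "p (c (x # w)) = p (letter_code x) @ p (c w)" for x w by (simp add: c_def p_app)
    show ?case
    proof (cases "free_reduce xs")
      case Nil
      then show ?thesis using e by (simp add: cx)
    next
      case (Cons y ys)
      show ?thesis
      proof (cases "fst x = fst y \<and> snd x \<noteq> snd y")
        case True
        then have "eqv (p (letter_code x @ letter_code y) @ p (c ys)) ([] @ p (c ys))"
          using code_cancel by (intro cox_eq_append cox_eq.refl) auto
        then show ?thesis using e True Cons by (auto simp: cx p_app intro: cox_eq.trans cox_eq.sym)
      next
        case False
        then show ?thesis using e Cons by (simp only: free_reduce.simps list.case if_False) (simp add: cx)
      qed
    qed
  qed (simp add: cox_eq.refl)
  have phi_mult: "\<phi> u \<otimes>\<^bsub>W\<^esub> \<phi> v = \<phi> (free_reduce (u @ v))" for u v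
  proof -
    have "\<phi> u \<otimes>\<^bsub>W\<^esub> \<phi> v = cls (p (c (u @ v)))"
      unfolding \<phi>_def using mult_cls pc by (simp add: c_app p_app)
    also have "\<dots> = \<phi> (free_reduce (u @ v))"
      unfolding \<phi>_def using red pc by (subst cls_eq_iff) (auto intro: cox_eq.sym)
    finally show ?thesis .
  qed
  define K where "K = \<phi> ` carrier F2"
  have F2_iff: "w \<in> carrier F2 \<longleftrightarrow> free_reduce w = w" for w by (simp add: F2_def)
  have phi_in_K: "\<phi> (free_reduce w) \<in> K" for w by (simp add: K_def F2_iff)
  have phi_red: "\<phi> (free_reduce w) = \<phi> w" for w
    unfolding \<phi>_def using red pc by (subst cls_eq_iff) (auto)
  have inj: "inj_on \<phi> (carrier F2)"
  proof (rule inj_onI)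
    fix u v assume uv: "u \<in> carrier F2" "v \<in> carrier F2" "\<phi> u = \<phi> v"
    then have "eqv (p (c u)) (p (c v))" using cls_eq_iff pc by (simp add: \<phi>_def)
    then have "c u = c v" using uv c4
      by (intro p_inj) (auto simp: c_def F2_iff intro: distinct_adj_letter_code)
    then show "u = v" unfolding c_def by (rule inj_letter_code)
  qed
  have subK: "subgroup K W"
  proof (rule W.subgroupI)
    show "K \<subseteq> carrier W" using pc by (auto simp: K_def \<phi>_def cls_carrier)
    show "K \<noteq> {}" using phi_in_K by blast
  next
    fix x assume "x \<in> K"
    then obtain w where w: "x = \<phi> w" by (auto simp: K_def)
    define w' where "w' = rev (map (\<lambda>(a, i). (a, \<not> i)) w)"
    have "letter_code (a, \<not> i) = rev (letter_code (a, i))" for a i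
      by (cases a; cases i) auto
    then have "c (rev (map (\<lambda>(a, i). (a, \<not> i)) v)) = rev (c v)" for v
      by (induction v) (auto simp: c_def)
    then have "c w' = rev (c w)" by (simp add: w'_def)
    then have "inv\<^bsub>W\<^esub> x = \<phi> w'"
      unfolding w \<phi>_def using p_rev[OF c4, of w] pc[of w'] pc[of w]
      by (intro inv_cls_eqI) (auto)
    then show "inv\<^bsub>W\<^esub> x \<in> K" using phi_in_K[of w'] by (simp add: phi_red)
  next
    fix x y assume "x \<in> K" "y \<in> K"
    then show "x \<otimes>\<^bsub>W\<^esub> y \<in> K" using phi_mult phi_in_K by (auto simp: K_def)
  qed
  have "\<phi> w \<in> H" for w
  proof (induction w)
    case Nil
    then show ?case using subgroup.one_closed[OF H] by (simp add: \<phi>_def c_def p_def one_W)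
  next
    case (Cons x w)
    have lc: "letter_code x \<in> lists {..<4}" using c4[of "[x]"] by (simp add: c_def)
    have "cls (p (letter_code x)) \<in> H"
    proof -
      have inv: "cls (R j @ R i) \<in> H" if "cls (R i @ R j) \<in> H" "i < 4" "j < 4" for i j
      proof -
        have "eqv (R j @ (R i @ R i) @ R j) (R j @ [] @ R j)"
          using R that by (intro cox_eq_append cox_eq.refl)
        then have "eqv ((R j @ R i) @ (R i @ R j)) []"
          using R(2)[OF that(3)] by (auto intro: cox_eq.trans)
        then have "inv\<^bsub>W\<^esub> (cls (R i @ R j)) = cls (R j @ R i)"
          using R(1) that by (intro inv_cls_eqI append_lists)
        then show ?thesis using subgroup.m_inv_closed[OF H that(1)] by simp
      qed
      show ?thesis using mem inv[of 0 1] inv[of 2 3]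
        by (cases x rule: letter_code.cases) (auto simp: p_def)
    qed
    moreover have "\<phi> (x # w) = cls (p (letter_code x)) \<otimes>\<^bsub>W\<^esub> \<phi> w"
      unfolding \<phi>_def using mult_cls[OF pS[OF lc] pc] by (simp add: c_def p_app)
    ultimately show ?case using subgroup.m_closed[OF H] Cons by simp
  qed
  then have KH: "K \<subseteq> H" by (auto simp: K_def)
  have "inv_into (carrier F2) \<phi> \<in> iso (subgroup_generated W K) F2"
    unfolding iso_def hom_def
  proof (safe, goal_cases)
    case (1 x)
    then show ?case
      using inv_into_into[of x \<phi> "carrier F2"] subgroup.carrier_subgroup_generated_subgroup[OF subK] by (simp add: K_def)
  next
    case (2 x y)
    then obtain u v where uv: "u \<in> carrier F2" "v \<in> carrier F2" "x = \<phi> u" "y = \<phi> v"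
      using subgroup.carrier_subgroup_generated_subgroup[OF subK] by (auto simp: K_def)
    have "free_reduce (u @ v) \<in> carrier F2" by (simp add: F2_iff)
    then show ?case using uv inv_into_f_f[OF inj] phi_mult by (simp add: F2_def)
  next
    case 3
    have "bij_betw \<phi> (carrier F2) K" using inj by (simp add: K_def bij_betw_def)
    then show ?case using subgroup.carrier_subgroup_generated_subgroup[OF subK] bij_betw_inv_into by simp
  qed
  then have "subgroup_generated W K \<cong> F2" by (auto simp: is_iso_def)
  then show ?thesis using subK KH by (auto simp: narrow_def)
qed

section \<open>Irreducible components and finite normal subgroups\<close>

text \<open>Unions of components, described by commutation with the remaining generators.\<close>

definition separated :: "'a set \<Rightarrow> bool" where
  "separated T \<longleftrightarrow> T \<subseteq> S \<and> (\<forall>s\<in>T. \<forall>t\<in>S - T. m s t = 2)"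

lemma separated_compl: "separated T \<Longrightarrow> separated (S - T)"
  unfolding separated_def using m_sym by (metis DiffD1 DiffD2 DiffI Diff_subset subsetD)

lemma form_separated: "separated T \<Longrightarrow> s \<in> T \<Longrightarrow> t \<in> S - T \<Longrightarrow> form s t = 0"
  using form_eq_0_iff[of s t] unfolding separated_def by blast

lemma commute_letters:
  assumes "s \<in> S" "t \<in> S" "s \<noteq> t" "m s t = 2"
  shows "eqv [s, t] [t, s]"
proof -
  have "eqv ([] @ concat (replicate 2 [s, t]) @ []) ([] @ [])"
    using assms by (intro cox_eq.braid) (auto simp: numeral_eq_enat)
  then have 1: "eqv ([s, t] @ [s, t]) []" by (simp add: numeral_2_eq_2)
  have "eqv ([s] @ [t, t] @ [s]) ([s] @ [s])" using assms by (intro cox_eq.cancel)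
  moreover have "eqv ([] @ [s, s] @ []) ([] @ [])" using assms by (intro cox_eq.cancel)
  ultimately have "eqv ([s, t] @ [t, s]) []" by (auto intro: cox_eq.trans)
  from cox_eq.trans[OF 1 cox_eq.sym[OF this]]
  have "eqv ([s, t] @ [s, t]) ([s, t] @ [t, s])" .
  then show ?thesis using assms eqv_cancel_left[of "[s, t]" "[s, t]" "[t, s]"] by simp
qed

lemma commute_word:
  assumes "s \<in> S" "\<And>t. t \<in> set u \<Longrightarrow> t \<in> S \<and> t \<noteq> s \<and> m s t = 2"
  shows "eqv (s # u) (u @ [s])"
  using assms(2)
proof (induction u)
  case (Cons t u)
  have "eqv ([s, t] @ u) ([t, s] @ u)"
    using Cons.prems[of t] assms(1) by (intro cox_eq_append commute_letters cox_eq.refl) auto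
  moreover have "eqv ([t] @ (s # u)) ([t] @ (u @ [s]))"
    using Cons by (intro cox_eq_append cox_eq.refl) auto
  ultimately show ?case by (auto intro: cox_eq.trans)
qed (simp add: cox_eq.refl)

lemma eqv_filter:
  assumes T: "separated T" and "w \<in> lists S"
  shows "eqv w (filter (\<lambda>s. s \<in> T) w @ filter (\<lambda>s. s \<notin> T) w)"
  using assms(2)
proof (induction w rule: list.induct)
  case (Cons s w)
  let ?u = "filter (\<lambda>s. s \<in> T) w" and ?v = "filter (\<lambda>s. s \<notin> T) w"
  have s: "s \<in> S" and w: "w \<in> lists S" using Cons.prems by auto
  have e: "eqv ([s] @ w) ([s] @ (?u @ ?v))" using Cons.IH[OF w] by (intro cox_eq_append cox_eq.refl)
  show ?case
  proof (cases "s \<in> T")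
    case True
    then show ?thesis using e by simp
  next
    case False
    have "t \<in> S \<and> t \<noteq> s \<and> m s t = 2" if "t \<in> set ?u" for t
    proof -
      have "t \<in> T" "t \<in> S" using that w by auto
      moreover have "m t s = 2" using T \<open>t \<in> T\<close> s False unfolding separated_def by blast
      ultimately show ?thesis using m_sym[OF s] False by auto
    qed
    then have "eqv (s # ?u) (?u @ [s])" by (rule commute_word[OF s])
    then have "eqv ((s # ?u) @ ?v) ((?u @ [s]) @ ?v)" by (intro cox_eq_append cox_eq.refl)
    then show ?thesis using e False by (auto intro: cox_eq.trans)
  qed
qed (simp add: cox_eq.refl)

lemma bil_alpha_separated:
  assumes "separated T" "s \<in> S - T" "\<And>x. x \<in> S - T \<Longrightarrow> v x = 0"
  shows "bil (alpha s) v = 0"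
proof -
  have "v t * form s t = 0" if "t \<in> S" for t
    using assms form_separated[of T t s] that form_sym[of s t] by (cases "t \<in> T") auto
  then show ?thesis using assms(2) by (simp add: bil_alpha1 sum.neutral)
qed

lemma act_separated:
  assumes "separated T" "w \<in> lists (S - T)" "\<And>x. x \<in> S - T \<Longrightarrow> v x = 0"
  shows "act w v = v"
  using assms(2)
proof (induction w)
  case (Cons s w)
  then show ?case using bil_alpha_separated[OF assms(1) _ assms(3), of s] by (simp add: srefl_def)
qed simp

text \<open>The letters of \<open>w\<close> can be sorted into a part in T and a part outside. The
  outer part fixes the roots in T by orthogonality and the others because \<open>w\<close> does, so
  it is trivial by faithfulness.\<close>

lemma word_in_separated:
  assumes T: "separated T" and w: "w \<in> lists S"
    and triv: "\<And>s. s \<in> S - T \<Longrightarrow> act w (alpha s) = alpha s"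
  shows "cls w \<in> parabolic S m T"
proof -
  let ?u = "filter (\<lambda>s. s \<in> T) w" and ?v = "filter (\<lambda>s. s \<notin> T) w"
  have TS: "T \<subseteq> S" using T by (simp add: separated_def)
  have u: "?u \<in> lists T" and v: "?v \<in> lists (S - T)" using w by auto
  have vS: "?v \<in> lists S" and uS: "?u \<in> lists S" using w by auto
  have f: "filter (\<lambda>s. s \<in> S - T) w = ?v" "filter (\<lambda>s. s \<notin> S - T) w = ?u"
    using w by (auto intro!: filter_cong)
  have e1: "eqv w (?u @ ?v)" by (rule eqv_filter[OF T w])
  have e2: "eqv w (?v @ ?u)" using eqv_filter[OF separated_compl[OF T] w] unfolding f .
  have "eqv ?v []"
  proof (rule act_faithful[OF vS])
    fix s assume s: "s \<in> S"
    show "act ?v (alpha s) = alpha s"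
    proof (cases "s \<in> T")
      case True
      then show ?thesis by (intro act_separated[OF T v]) (auto simp: alpha_def)
    next
      case False
      have "act ?u (alpha s) = alpha s"
        using u TS False by (intro act_separated[OF separated_compl[OF T]]) (auto simp: alpha_def)
      then have "act w (alpha s) = act ?v (alpha s)" using act_eqv[OF e2] by (simp add: act_append)
      then show ?thesis using triv[of s] s False by simp
    qed
  qed
  then have "eqv (?u @ ?v) (?u @ [])" by (intro cox_eq_append cox_eq.refl)
  with e1 have "eqv w ?u" by (auto intro: cox_eq.trans)
  then have "cls w = cls ?u" using w uS by (simp only: cls_eq_iff)
  then show ?thesis unfolding parabolic_eq[OF TS] using u by blast
qed

abbreviation "compo \<equiv> component S m"

lemma comp_self: "s \<in> S \<Longrightarrow> s \<in> compo s"
  by (simp add: component_def)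

lemma comp_subset: "compo s \<subseteq> S"
  by (auto simp: component_def)

lemma finite_comp [simp]: "finite (compo s)"
  using finite_subset[OF comp_subset finite_S] .

lemma sym_edge: "sym (cox_edge S m)"
  by (auto simp: sym_def cox_edge_def m_sym)

lemma comp_eq:
  assumes "t \<in> compo s" shows "compo t = compo s"
proof -
  have "(s, t) \<in> (cox_edge S m)\<^sup>*" using assms by (simp add: component_def)
  moreover have "(t, s) \<in> (cox_edge S m)\<^sup>*"
    using sym_rtrancl[OF sym_edge] calculation by (auto dest: symD)
  ultimately show ?thesis by (auto simp: component_def)
qed

lemma separated_of_closed:
  assumes "T \<subseteq> S" "\<And>s. s \<in> T \<Longrightarrow> compo s \<subseteq> T" shows "separated T"
  unfolding separated_def
proof (intro conjI ballI assms(1))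
  fix s t assume st: "s \<in> T" "t \<in> S - T"
  show "m s t = 2"
  proof (rule ccontr)
    assume "m s t \<noteq> 2"
    then have "(s, t) \<in> cox_edge S m" using st assms by (auto simp: cox_edge_def)
    then have "t \<in> compo s" using st by (auto simp: component_def)
    then show False using st assms(2) by blast
  qed
qed

lemma separated_comp: "separated (compo s)"
  using comp_eq by (intro separated_of_closed comp_subset) auto

lemma canon_quad_components:
  assumes T: "T \<subseteq> S" "\<And>s. s \<in> T \<Longrightarrow> compo s \<subseteq> T"
  shows "canon_quad m T c = (\<Sum>C\<in>compo ` T. canon_quad m C c)"
proof -
  have finT: "finite T" using finite_subset[OF T(1)] by simp
  define g where "g s t = c s * c t * form s t" for s t
  have "canon_quad m T c = (\<Sum>s\<in>T. \<Sum>t\<in>compo s. g s t)"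
    unfolding canon_quad_def g_def
  proof (rule sum.cong[OF HOL.refl])
    fix s assume s: "s \<in> T"
    show "(\<Sum>t\<in>T. c s * c t * form s t) = (\<Sum>t\<in>compo s. c s * c t * form s t)"
    proof (rule sum.mono_neutral_right[OF finT T(2)[OF s]], rule ballI)
      fix t assume t: "t \<in> T - compo s"
      then have "form s t = 0"
        using s T(1) comp_self[of s] by (intro form_separated[OF separated_comp[of s]]) auto
      then show "c s * c t * form s t = 0" by simp
    qed
  qed
  also have "\<dots> = (\<Sum>C\<in>compo ` T. \<Sum>s\<in>{s \<in> T. compo s = C}. \<Sum>t\<in>compo s. g s t)"
    by (rule sum.group[symmetric]) (use finT in auto)
  also have "\<dots> = (\<Sum>C\<in>compo ` T. canon_quad m C c)"
  proof (rule sum.cong[OF HOL.refl])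
    fix C assume "C \<in> compo ` T"
    then obtain r where r: "r \<in> T" "C = compo r" by blast
    have "{s \<in> T. compo s = C} = C"
    proof (intro equalityI subsetI)
      fix s assume "s \<in> {s \<in> T. compo s = C}"
      then show "s \<in> C" using comp_self[of s] T(1) by blast
    next
      fix s assume s: "s \<in> C"
      then have "compo s = C" using comp_eq[of s r] r(2) by simp
      moreover have "s \<in> T" using s r T(2) by blast
      ultimately show "s \<in> {s \<in> T. compo s = C}" by simp
    qed
    moreover have "compo s = C" if "s \<in> C" for s using that r comp_eq by simp
    ultimately show "(\<Sum>s\<in>{s \<in> T. compo s = C}. \<Sum>t\<in>compo s. g s t) = canon_quad m C c"
      by (simp add: canon_quad_def g_def)
  qed
  finally show ?thesis .
qed

lemma S_sph_subset: "S_sph S m \<subseteq> S" and S_aff_subset: "S_aff S m \<subseteq> S"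
  by (auto simp: S_sph_def S_aff_def)

lemma comp_S_sph: "s \<in> S_sph S m \<Longrightarrow> compo s \<subseteq> S_sph S m"
  using comp_eq comp_subset by (fastforce simp: S_sph_def)

lemma comp_S_aff: "s \<in> S_aff S m \<Longrightarrow> compo s \<subseteq> S_aff S m"
  using comp_eq comp_subset by (fastforce simp: S_aff_def)

lemma canon_quad_cong: "(\<And>s. s \<in> T \<Longrightarrow> c s = d s) \<Longrightarrow> canon_quad m T c = canon_quad m T d"
  unfolding canon_quad_def by (intro sum.cong) auto

lemma posdef_imp_semidef: "pos_def_on m T \<Longrightarrow> pos_semidef_on m T"
  unfolding pos_semidef_on_def
proof
  fix c assume "pos_def_on m T"
  show "0 \<le> canon_quad m T c"
  proof (cases "\<exists>s\<in>T. c s \<noteq> 0")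
    case True
    then show ?thesis using \<open>pos_def_on m T\<close> by (auto simp: pos_def_on_def intro: less_imp_le)
  next
    case False
    then have "canon_quad m T c = canon_quad m T (\<lambda>_. 0)" by (intro canon_quad_cong) auto
    then show ?thesis by (simp add: canon_quad_def)
  qed
qed

lemma pos_semidef_aff_sph: "pos_semidef_on m (S_aff S m \<union> S_sph S m)"
proof -
  let ?T = "S_aff S m \<union> S_sph S m"
  have "canon_quad m C c \<ge> 0" if "C \<in> compo ` ?T" for c C
    using that posdef_imp_semidef by (auto simp: S_aff_def S_sph_def pos_semidef_on_def)
  moreover have "canon_quad m ?T c = (\<Sum>C\<in>compo ` ?T. canon_quad m C c)" for c
    using S_sph_subset S_aff_subset comp_S_sph comp_S_aff by (intro canon_quad_components) blast+
  ultimately show ?thesis by (simp add: pos_semidef_on_def sum_nonneg)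
qed

lemma pos_def_sph: "pos_def_on m (S_sph S m)"
  unfolding pos_def_on_def
proof (intro allI impI)
  let ?T = "S_sph S m"
  fix c :: "'a \<Rightarrow> real"
  assume "\<exists>s\<in>?T. c s \<noteq> 0"
  then obtain s where s: "s \<in> ?T" "c s \<noteq> 0" by blast
  have e: "canon_quad m ?T c = (\<Sum>C\<in>compo ` ?T. canon_quad m C c)"
    using S_sph_subset comp_S_sph by (intro canon_quad_components) blast+
  have fin: "finite ?T" using finite_subset[OF S_sph_subset] by simp
  have "canon_quad m C c \<ge> 0" if "C \<in> compo ` ?T" for C
    using that posdef_imp_semidef by (auto simp: S_sph_def pos_semidef_on_def)
  moreover have "canon_quad m (compo s) c > 0"
    using s comp_self[of s] by (auto simp: S_sph_def pos_def_on_def)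
  ultimately show "canon_quad m ?T c > 0"
    unfolding e using fin s by (intro sum_pos2[of _ "compo s"]) auto
qed

section \<open>Least eigenvectors and stable subspaces of a component\<close>

lemma canon_quad_eq_bil_supported:
  assumes "J \<subseteq> S" "\<And>x. x \<notin> J \<Longrightarrow> v x = 0"
  shows "canon_quad m J v = bil v v"
  unfolding canon_quad_def bil_def
proof (rule sum.mono_neutral_cong_left)
  fix s assume "s \<in> J"
  show "(\<Sum>t\<in>J. v s * v t * form s t) = (\<Sum>t\<in>S. v s * v t * form s t)"
    using assms by (intro sum.mono_neutral_left) auto
qed (use assms in auto)

text \<open>The least eigenvalue of the form on J. Replacing a minimiser of the quadratic form on the
  unit sphere by its coordinatewise absolute value does not increase the form, since the
  off-diagonal entries are nonpositive.\<close>
lemma nonneg_min_eigenvector: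
  assumes J: "J \<subseteq> S" "J \<noteq> {}"
  obtains l c where "\<And>x. c x \<ge> 0" "\<And>x. x \<notin> J \<Longrightarrow> c x = 0" "\<exists>x\<in>J. c x > 0"
    "\<And>s. s \<in> J \<Longrightarrow> bil (alpha s) c = l * c s"
    "\<And>v. (\<And>x. x \<notin> J \<Longrightarrow> v x = 0) \<Longrightarrow> bil v v \<ge> l * (\<Sum>x\<in>J. (v x)\<^sup>2)"
proof -
  have finJ: "finite J" using finite_subset[OF J(1)] by simp
  define N where "N v = (\<Sum>x\<in>J. (v x)\<^sup>2)" for v :: "'a \<Rightarrow> real"
  \<comment> \<open>Outside J the factor is the single point 0, so the product over the whole type
    is compact and its elements are supported on J.\<close>
  define A where "A = (\<lambda>x. if x \<in> J then {-1..1::real} else {0})"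
  define K where "K = PiE UNIV A \<inter> {v. N v = 1}"
  have "compactin (product_topology (\<lambda>_. euclidean) UNIV) (PiE UNIV A)"
    unfolding compactin_PiE by (auto simp: A_def)
  then have "compact (PiE UNIV A)" by (simp add: euclidean_product_topology)
  moreover have contN: "continuous_on UNIV N"
    unfolding N_def by (intro continuous_intros continuous_on_product_coordinates)
  then have "closed {v. N v = 1}" by (intro closed_Collect_eq) auto
  ultimately have K: "compact K" unfolding K_def by (rule compact_Int_closed)
  obtain j where j: "j \<in> J" using J by blast
  have "alpha j \<in> K"
    using j finJ by (auto simp: K_def A_def N_def alpha_def if_distrib[of "\<lambda>x. x ^ 2"] cong: if_cong)
  then have Kne: "K \<noteq> {}" by blast
  have "continuous_on K (\<lambda>v. bil v v)"
    unfolding bil_def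
    by (intro continuous_intros continuous_on_subset[OF continuous_on_product_coordinates]) auto
  then obtain c0 where c0: "c0 \<in> K" "\<And>v. v \<in> K \<Longrightarrow> bil c0 c0 \<le> bil v v"
    using continuous_attains_inf[OF K Kne] by blast
  define l where "l = bil c0 c0"
  have N0: "N v = 0 \<Longrightarrow> x \<in> J \<Longrightarrow> v x = 0" for v x
    using finJ by (simp add: N_def sum_nonneg_eq_0_iff)
  have low: "bil v v \<ge> l * N v" if v: "\<And>x. x \<notin> J \<Longrightarrow> v x = 0" for v
  proof (cases "N v = 0")
    case True
    then have "v = (\<lambda>x. 0)" using N0[OF True] v by blast
    then show ?thesis using True by simp
  next
    case False
    then have pos: "N v > 0" by (simp add: N_def sum_nonneg order.strict_iff_order)
    define u where "u = (\<lambda>x. v x / sqrt (N v))"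
    have "N u = N v / N v" unfolding N_def[of u] using pos
      by (simp add: u_def power_divide sum_divide_distrib[symmetric] N_def)
    then have Nu: "N u = 1" using pos by simp
    have "\<bar>u x\<bar> \<le> 1" if "x \<in> J" for x
    proof -
      have "(u x)\<^sup>2 \<le> N u" unfolding N_def using that finJ by (intro member_le_sum) auto
      then show ?thesis using Nu by (simp add: abs_square_le_1)
    qed
    then have "- 1 \<le> u x \<and> u x \<le> 1" if "x \<in> J" for x using that by (fastforce simp: abs_le_iff)
    moreover have "u x = 0" if "x \<notin> J" for x using v that by (simp add: u_def)
    ultimately have "u \<in> K" using Nu by (auto simp: K_def A_def PiE_UNIV_domain)
    then have "l \<le> bil u u" using c0 by (simp add: l_def)
    then show ?thesis using pos by (simp add: u_def field_simps)
  qed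
  define c where "c = (\<lambda>x. \<bar>c0 x\<bar>)"
  have c0J: "c0 x = 0" if "x \<notin> J" for x using c0(1) that by (auto simp: K_def A_def PiE_def Pi_def split: if_splits)
  have Nc: "N c = 1" using c0(1) by (simp add: K_def N_def c_def)
  have "bil c c \<le> bil c0 c0"
    unfolding bil_def
  proof (intro sum_mono)
    fix s t assume st: "s \<in> S" "t \<in> S"
    show "c s * c t * form s t \<le> c0 s * c0 t * form s t"
    proof (cases "s = t")
      case True
      then show ?thesis by (simp add: c_def)
    next
      case False
      have "c0 s * c0 t \<le> c s * c t" by (metis abs_ge_self abs_mult c_def)
      then show ?thesis using form_nonpos[OF st False] by (rule mult_right_mono_neg)
    qed
  qed
  moreover have "bil c c \<ge> l * N c" using c0J by (intro low) (simp add: c_def)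
  ultimately have lc: "bil c c = l" using Nc by (simp add: l_def)
  have eig: "bil (alpha s) c = l * c s" if s: "s \<in> J" for s
  proof -
    define a where "a = bil (alpha s) c - l * c s"
    have sS: "s \<in> S" using s J by blast
    \<comment> \<open>Variation of the minimiser in the direction \<open>alpha s\<close>: a
      nonnegative quadratic in e without constant term, so its linear coefficient must
      vanish.\<close>
    have q: "0 \<le> 2 * e * a + e\<^sup>2 * (1 - l)" for e
    proof -
      define v where "v = (\<lambda>x. c x + e * alpha s x)"
      have "bil v v \<ge> l * N v" using c0J s by (intro low) (auto simp: v_def c_def alpha_def)
      moreover have "bil v v = l + 2 * e * bil (alpha s) c + e\<^sup>2"
        using lc sS by (simp add: v_def bil_sym[of c "alpha s"] power2_eq_square algebra_simps)
      moreover have "N v = N c + 2 * e * (\<Sum>x\<in>J. c x * alpha s x) + e\<^sup>2 * N (alpha s)"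
        by (simp add: N_def v_def power2_eq_square algebra_simps sum.distrib sum_distrib_left)
      moreover have "(\<Sum>x\<in>J. c x * alpha s x) = c s" "N (alpha s) = 1"
        using s finJ by (auto simp: N_def alpha_def if_distrib[of "\<lambda>x. x ^ 2"] if_distrib[of "\<lambda>x. _ * x"] cong: if_cong)
      ultimately show ?thesis using Nc by (simp add: a_def algebra_simps)
    qed
    have "a = 0"
    proof (rule ccontr)
      assume a: "a \<noteq> 0"
      \<comment> \<open>With k > 1 - l the quadratic is at most \<open>- a\<^sup>2 / k\<close> at
        \<open>e = - a / k\<close>.\<close>
      define k where "k = \<bar>1 - l\<bar> + 1"
      have k: "k > 0" "1 - l < k" by (auto simp: k_def)
      have "0 \<le> 2 * (- a / k) * a + (- a / k)\<^sup>2 * (1 - l)" by (rule q)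
      also have "\<dots> \<le> 2 * (- a / k) * a + (- a / k)\<^sup>2 * k"
        using k by (intro add_left_mono mult_left_mono) auto
      also have "\<dots> = - a\<^sup>2 / k" using k by (simp add: power2_eq_square field_simps)
      also have "\<dots> < 0" using a k by simp
      finally show False by simp
    qed
    then show ?thesis by (simp add: a_def)
  qed
  have "\<exists>x\<in>J. c x > 0"
  proof (rule ccontr)
    assume "\<not> (\<exists>x\<in>J. c x > 0)"
    then have "c x = 0" if "x \<in> J" for x using that by (fastforce simp: c_def)
    then have "N c = 0" by (simp add: N_def)
    then show False using Nc by simp
  qed
  then show ?thesis using that[of c l] eig low c0J by (auto simp: c_def N_def)
qed

text \<open>The sign of the least eigenvalue decides the type: l > 0 forces definiteness and l \<ge>
  0 semidefiniteness.\<close>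

lemma component_eigenvector:
  assumes r: "r \<in> S"
  obtains l c where "\<forall>x. c x \<ge> 0" "\<forall>x. x \<notin> compo r \<longrightarrow> c x = 0" "\<exists>x\<in>compo r. c x > 0"
    "\<forall>s\<in>compo r. bil (alpha s) c = l * c s"
    "pos_def_on m (compo r) \<or> l \<le> 0" "pos_semidef_on m (compo r) \<or> l < 0"
proof -
  have ne: "compo r \<noteq> {}" using comp_self[OF r] by blast
  show thesis
  proof (rule nonneg_min_eigenvector[OF comp_subset ne])
    fix l and c :: "'a \<Rightarrow> real"
    assume c: "\<And>x. c x \<ge> 0" "\<And>x. x \<notin> compo r \<Longrightarrow> c x = 0" "\<exists>x\<in>compo r. c x > 0"
      and eig: "\<And>s. s \<in> compo r \<Longrightarrow> bil (alpha s) c = l * c s"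
      and low: "\<And>v. (\<And>x. x \<notin> compo r \<Longrightarrow> v x = 0) \<Longrightarrow> bil v v \<ge> l * (\<Sum>x\<in>compo r. (v x)\<^sup>2)"
    have quad: "canon_quad m (compo r) v \<ge> l * (\<Sum>x\<in>compo r. (v x)\<^sup>2)" for v
    proof -
      define v' where "v' = (\<lambda>x. if x \<in> compo r then v x else 0)"
      have "l * (\<Sum>x\<in>compo r. (v x)\<^sup>2) = l * (\<Sum>x\<in>compo r. (v' x)\<^sup>2)" by (simp add: v'_def)
      also have "\<dots> \<le> bil v' v'" by (rule low) (simp add: v'_def)
      also have "\<dots> = canon_quad m (compo r) v'"
        by (rule canon_quad_eq_bil_supported[OF comp_subset, symmetric]) (simp add: v'_def)
      also have "\<dots> = canon_quad m (compo r) v" by (rule canon_quad_cong) (simp add: v'_def)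
      finally show ?thesis .
    qed
    have "pos_def_on m (compo r)" if l: "l > 0"
      unfolding pos_def_on_def
    proof (intro allI impI)
      fix v :: "'a \<Rightarrow> real"
      assume "\<exists>s\<in>compo r. v s \<noteq> 0"
      then obtain s where "s \<in> compo r" "v s \<noteq> 0" by blast
      then have "(\<Sum>x\<in>compo r. (v x)\<^sup>2) > 0" by (intro sum_pos2[of _ s]) auto
      then have "0 < l * (\<Sum>x\<in>compo r. (v x)\<^sup>2)" using l by simp
      then show "canon_quad m (compo r) v > 0" using quad[of v] by linarith
    qed
    moreover have "pos_semidef_on m (compo r)" if l: "l \<ge> 0"
      unfolding pos_semidef_on_def
    proof
      fix v
      have "0 \<le> l * (\<Sum>x\<in>compo r. (v x)\<^sup>2)" using l by (intro mult_nonneg_nonneg sum_nonneg) auto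
      then show "canon_quad m (compo r) v \<ge> 0" using quad[of v] by linarith
    qed
    ultimately show thesis
      using c eig by (intro that[of c l]) (auto simp: not_le[symmetric])
  qed
qed

lemma antidominant_of_eigenvector:
  assumes "\<And>x. c x \<ge> 0" "\<And>x. x \<notin> compo r \<Longrightarrow> c x = 0"
    "\<And>s. s \<in> compo r \<Longrightarrow> bil (alpha s) c = l * c s" "l \<le> 0" "s \<in> S"
  shows "bil (alpha s) c \<le> 0"
proof (cases "s \<in> compo r")
  case True
  then show ?thesis using assms by (simp add: mult_nonpos_nonneg)
next
  case False
  then show ?thesis using assms bil_alpha_separated[OF separated_comp[of r], of s c] by simp
qed

text \<open>P stands for a subspace, which is stable under reflections and not contained in the radical.\<close>
lemma irreducible_subspace:
  assumes lin: "\<And>u v k. P u \<Longrightarrow> P v \<Longrightarrow> P (\<lambda>x. u x + k * v x)"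
    and stable: "\<And>u s. s \<in> compo r \<Longrightarrow> P u \<Longrightarrow> P (srefl s u)"
    and u: "P u" "s \<in> compo r" "bil (alpha s) u \<noteq> 0" and t: "t \<in> compo r"
  shows "P (alpha t)"
proof -
  have step: "P (alpha s)" if "P u" "s \<in> compo r" "bil (alpha s) u \<noteq> 0" for u s
  proof -
    define b where "b = bil (alpha s) u"
    have 1: "P (\<lambda>x. u x + (-1) * srefl s u x)" by (intro lin stable that)
    \<comment> \<open>\<open>u - s u\<close> is \<open>2 * b\<close> times \<open>alpha s\<close>.
      Closure is given for sums \<open>u + k * v\<close>, so the factor \<open>1 / (2 * b)\<close>
      is written as 1 plus the rest.\<close>
    have "P (\<lambda>x. (u x + (-1) * srefl s u x) + (1 / (2 * b) - 1) * (u x + (-1) * srefl s u x))"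
      by (rule lin[OF 1 1])
    moreover have "(\<lambda>x. (u x + (-1) * srefl s u x) + (1 / (2 * b) - 1) * (u x + (-1) * srefl s u x)) = alpha s"
      using that by (auto simp: srefl_def b_def field_simps)
    ultimately show ?thesis by simp
  qed
  have "compo s = compo r" using u comp_eq by simp
  then have "(s, t) \<in> (cox_edge S m)\<^sup>*" using t by (auto simp: component_def)
  then show ?thesis
  proof (induction rule: rtrancl_induct)
    case base
    show ?case using step u by blast
  next
    case (step y z)
    then have "z \<in> compo s" by (auto simp: component_def cox_edge_def dest: rtrancl_into_rtrancl)
    moreover have "bil (alpha z) (alpha y) \<noteq> 0"
      using step form_eq_0_iff[of y z] by (auto simp: cox_edge_def bil_alpha_alpha form_sym[of z])
    ultimately show ?case using step.IH \<open>compo s = compo r\<close>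
        \<open>\<And>u s. P u \<Longrightarrow> s \<in> compo r \<Longrightarrow> bil (alpha s) u \<noteq> 0 \<Longrightarrow> P (alpha s)\<close> by blast
  qed
qed

lemma subspace_spanned:
  assumes lin: "\<And>u v k. P u \<Longrightarrow> P v \<Longrightarrow> P (\<lambda>x. u x + k * v x)"
    and al: "\<And>t. t \<in> T \<Longrightarrow> P (alpha t)" and T: "finite T" "T \<noteq> {}" and v: "\<And>x. x \<notin> T \<Longrightarrow> v x = 0"
  shows "P v"
proof -
  obtain t where "t \<in> T" using T by blast
  then have z: "P (\<lambda>x. 0)" using lin[OF al al, of t t "-1"] by simp
  have "U \<subseteq> T \<Longrightarrow> P (\<lambda>x. \<Sum>s\<in>U. v s * alpha s x)" if "finite U" for U
    using that
  proof (induction U rule: finite_induct)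
    case (insert s U)
    then show ?case using lin[OF _ al[of s], of "\<lambda>x. \<Sum>s\<in>U. v s * alpha s x" "v s"]
      by (simp add: add.commute)
  qed (use z in simp)
  then have "P (\<lambda>x. \<Sum>s\<in>T. v s * alpha s x)" using T by blast
  then show ?thesis using alpha_expand[of T v, OF v T(1)] by simp
qed

end

section \<open>Normal subgroups, averaging and the finite case\<close>

locale coxeter_normal = coxeter_system +
  fixes H :: "'a list set set"
  assumes normal: "normal H (cox_group S m)"
begin

definition words :: "'a list set" where
  "words = {w \<in> lists S. cls w \<in> H}"

lemma subgroup_H: "subgroup H W"
  using normal by (simp add: normal_def)

lemma words_lists: "w \<in> words \<Longrightarrow> w \<in> lists S"
  by (simp add: words_def)

lemma words_Nil: "[] \<in> words"
  using subgroup.one_closed[OF subgroup_H] by (simp add: words_def one_W)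

lemma words_append: "u \<in> words \<Longrightarrow> v \<in> words \<Longrightarrow> u @ v \<in> words"
  using subgroup.m_closed[OF subgroup_H, of "cls u" "cls v"] mult_cls[of u v]
  by (auto simp: words_def)

lemma words_rev: "w \<in> words \<Longrightarrow> rev w \<in> words"
  using subgroup.m_inv_closed[OF subgroup_H, of "cls w"] inv_cls[of w] by (auto simp: words_def)

lemma words_conj:
  assumes g: "g \<in> lists S" and w: "w \<in> words" shows "g @ w @ rev g \<in> words"
proof -
  have wS: "w \<in> lists S" using w by (rule words_lists)
  have "cls g \<otimes>\<^bsub>W\<^esub> cls w \<otimes>\<^bsub>W\<^esub> inv\<^bsub>W\<^esub> (cls g) \<in> H"
    using w g normal.inv_op_closed2[OF normal] cls_carrier by (auto simp: words_def)
  then have "cls (g @ w @ rev g) \<in> H"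
    using g wS by (simp add: inv_cls mult_cls append_lists rev_lists)
  then show ?thesis using g wS by (simp add: words_def append_lists rev_lists)
qed

lemma H_cases:
  assumes "A \<in> H" obtains w where "w \<in> words" "A = cls w"
proof -
  have "A \<in> cls ` lists S" using subgroup.subset[OF subgroup_H] assms unfolding carrier_W by blast
  then show ?thesis using that assms by (auto simp: words_def)
qed

lemma cls_mem_H: "w \<in> words \<Longrightarrow> cls w \<in> H"
  by (simp add: words_def)

text \<open>Conjugates of \<open>h\<close> by \<open>s\<close> stay in H, so the fixed vectors of a
  normal subgroup form a W-stable space.\<close>

lemma act_word_srefl:
  assumes fixed: "\<And>h. h \<in> words \<Longrightarrow> act h u = u" and "s \<in> S" "h \<in> words"
  shows "act h (srefl s u) = srefl s u"
proof -
  have "[s] @ h @ rev [s] \<in> words" using assms by (intro words_conj) auto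
  then have "srefl s (act h (srefl s u)) = u" using fixed by (fastforce simp: act_append)
  then show ?thesis using srefl_srefl[OF \<open>s \<in> S\<close>] by metis
qed

text \<open>If some average has a nonzero product with a simple root of the component, the fixed
  vectors are a stable subspace outside the radical and contain all simple roots. Otherwise the
  kernel of averaging is such a subspace and contains \<open>c\<close>; but the average of
  \<open>c\<close> is at least \<open>n * c\<close>, which is not zero.\<close>

lemma finite_normal_acts_trivially:
  assumes fin: "finite H" and r: "r \<in> S" "\<not> pos_def_on m (compo r)"
    and h: "h \<in> words" and t: "t \<in> compo r"
  shows "act h (alpha t) = alpha t"
proof -
  define rep where "rep A = (SOME w. w \<in> words \<and> cls w = A)" for A
  have rep: "rep A \<in> words" "cls (rep A) = A" if "A \<in> H" for A
  proof -
    have "\<exists>w. w \<in> words \<and> cls w = A" using H_cases[OF that] by blast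
    from someI_ex[OF this] show "rep A \<in> words" "cls (rep A) = A" by (simp_all add: rep_def)
  qed
  have rep_act: "act (rep (cls w)) v = act w v" if "w \<in> words" for w v
  proof -
    have "cls w \<in> H" using that by (simp add: words_def)
    then have "eqv (rep (cls w)) w"
      using rep[of "cls w"] cls_eq_iff[of "rep (cls w)" w] words_lists that by simp
    then show ?thesis by (rule act_eqv)
  qed
  \<comment> \<open>Invariance of the sum under the bijection of H that sends w to p w q. With p in
    H and q empty it shows that averages are fixed, with p = q = s that averaging commutes with
    reflections.\<close>
  have translate: "(\<Sum>A\<in>H. act (p @ rep A @ q) v x) = (\<Sum>A\<in>H. act (rep A) v x)"
    if p: "p \<in> lists S" and q: "q \<in> lists S"
    and st: "\<And>w. w \<in> words \<Longrightarrow> p @ w @ q \<in> words" "\<And>w. w \<in> words \<Longrightarrow> rev p @ w @ rev q \<in> words" for p q v x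
  proof (rule sum.reindex_bij_witness[where i = "\<lambda>A. cls (rev p @ rep A @ rev q)" and j = "\<lambda>A. cls (p @ rep A @ q)"])
    have cc: "cls (a @ rep (cls w) @ b) = cls (a @ w @ b)" if "a \<in> lists S" "b \<in> lists S" "w \<in> words" for a b w
    proof -
      have "cls w \<in> H" using that by (simp add: words_def)
      then have "eqv (rep (cls w)) w" "rep (cls w) \<in> lists S"
        using rep[of "cls w"] cls_eq_iff[of "rep (cls w)" w] words_lists that by auto
      then show ?thesis using that words_lists by (subst cls_eq_iff) (auto intro!: cox_eq_context)
    qed
    have cancel: "cls (rev a @ a @ w @ b @ rev b) = cls w" if "a \<in> lists S" "b \<in> lists S" "w \<in> lists S" for a b w
    proof -
      have "eqv ((rev a @ a) @ w @ (b @ rev b)) ([] @ w @ [])"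
        using that by (intro cox_eq_append cox_eq.refl rev_cox_eq_Nil cox_eq_rev_Nil)
      then show ?thesis using that by (subst cls_eq_iff) auto
    qed
    fix A assume A: "A \<in> H"
    have r: "rep A \<in> words" and rS: "rep A \<in> lists S" using rep A words_lists by auto
    show "cls (p @ rep A @ q) \<in> H" "cls (rev p @ rep A @ rev q) \<in> H"
      using st r by (auto simp: words_def)
    show "cls (rev p @ rep (cls (p @ rep A @ q)) @ rev q) = A"
      using cancel[OF p q rS] rep(2)[OF A]
      by (subst cc) (use p q st r rev_lists in auto)
    show "cls (p @ rep (cls (rev p @ rep A @ rev q)) @ q) = A"
      using cancel[OF rev_lists[OF p] rev_lists[OF q] rS] rep(2)[OF A]
      by (subst cc) (use p q st r rev_lists in auto)
    show "act (rep (cls (p @ rep A @ q))) v x = act (p @ rep A @ q) v x" using rep_act st r by simp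
  qed
  define avg where "avg v = (\<lambda>x. \<Sum>A\<in>H. act (rep A) v x)" for v
  have avg_lin: "avg (\<lambda>x. u x + k * v x) = (\<lambda>x. avg u x + k * avg v x)" for u v k
    by (simp add: avg_def act_linear sum.distrib sum_distrib_left)
  have act_avg: "act w (avg v) = (\<lambda>x. \<Sum>A\<in>H. act (w @ rep A) v x)" for w v
    by (simp add: avg_def act_sum[OF fin] act_append)
  have avg_fixed: "act w (avg v) = avg v" if "w \<in> words" for w v
  proof
    fix x
    have "(\<Sum>A\<in>H. act (w @ rep A @ []) v x) = (\<Sum>A\<in>H. act (rep A) v x)"
      using that words_append words_rev words_lists by (intro translate) auto
    then show "act w (avg v) x = avg v x" by (simp add: act_avg) (simp add: avg_def)
  qed
  have avg_srefl: "avg (srefl s v) = srefl s (avg v)" if s: "s \<in> S" for s v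
  proof
    fix x
    have "(\<Sum>A\<in>H. act ([s] @ rep A @ [s]) (srefl s v) x) = (\<Sum>A\<in>H. act (rep A) (srefl s v) x)"
      using s words_conj[of "[s]"] by (intro translate) auto
    moreover have "act ([s] @ rep A @ [s]) (srefl s v) = act ([s] @ rep A) v" for A
      using s by (simp add: act_append)
    ultimately have "(\<Sum>A\<in>H. act ([s] @ rep A) v x) = avg (srefl s v) x"
      by (simp add: avg_def)
    then show "avg (srefl s v) x = srefl s (avg v) x"
      using act_avg[of "[s]" v] by simp
  qed
  have subS: "compo r \<subseteq> S" by (rule comp_subset)
  show ?thesis
  proof (cases "\<exists>v. \<exists>s\<in>compo r. bil (alpha s) (avg v) \<noteq> 0")
    case True
    then obtain v s where v: "s \<in> compo r" "bil (alpha s) (avg v) \<noteq> 0" by blast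
    have "\<forall>h\<in>words. act h (alpha t) = alpha t"
    proof (rule irreducible_subspace[where P = "\<lambda>u. \<forall>h\<in>words. act h u = u", OF _ _ _ v t])
      show "\<forall>h\<in>words. act h (srefl s u) = srefl s u" if "s \<in> compo r" "\<forall>h\<in>words. act h u = u" for u s
        using act_word_srefl[of u s] that subS by blast
    qed (auto simp: act_linear avg_fixed)
    then show ?thesis using h by blast
  next
    case False
    define n where "n = real (card H)"
    have "H \<noteq> {}" using cls_mem_H[OF h] by blast
    then have n: "n > 0" using fin by (simp add: n_def card_gt_0_iff)
    have avg_avg: "avg (avg v) = (\<lambda>x. n * avg v x)" for v
    proof
      fix x
      have "act (rep A) (avg v) = avg v" if "A \<in> H" for A using avg_fixed rep that by blast
      then show "avg (avg v) x = n * avg v x" by (simp add: avg_def[of "avg v"] n_def)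
    qed
    obtain l c where c: "\<forall>x. c x \<ge> 0" "\<forall>x. x \<notin> compo r \<longrightarrow> c x = 0" "\<exists>x\<in>compo r. c x > 0"
      and eig: "\<forall>s\<in>compo r. bil (alpha s) c = l * c s"
      and pd: "pos_def_on m (compo r) \<or> l \<le> 0" "pos_semidef_on m (compo r) \<or> l < 0"
      by (rule component_eigenvector[OF r(1)])
    have "l \<le> 0" using r pd by blast
    then have anti: "bil (alpha s) c \<le> 0" if "s \<in> S" for s
      using antidominant_of_eigenvector[of c r l s] c eig that by simp
    have lin: "avg (\<lambda>x. u x + k * v x) = (\<lambda>x. 0)" if "avg u = (\<lambda>x. 0)" "avg v = (\<lambda>x. 0)" for u v k
      using that by (simp add: avg_lin)
    have "avg (alpha t) = (\<lambda>x. 0)" if "t \<in> compo r" for t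
    proof (rule irreducible_subspace[where P = "\<lambda>u. avg u = (\<lambda>x. 0)", OF lin _ _ comp_self[OF r(1)] _ that])
      fix u s assume "s \<in> compo r" "avg u = (\<lambda>x. 0)"
      then show "avg (srefl s u) = (\<lambda>x. 0)" using avg_srefl[of s u] subS by (auto simp: srefl_def)
    next
      \<comment> \<open>The part of \<open>alpha r\<close> with average zero. Its product with
        \<open>alpha r\<close> is 1, because averages are orthogonal to the simple roots in this
        case.\<close>
      let ?u = "\<lambda>x. alpha r x + (- 1 / n) * avg (alpha r) x"
      show "avg ?u = (\<lambda>x. 0)" using n by (simp only: avg_lin avg_avg) simp
      show "bil (alpha r) ?u \<noteq> 0" using False comp_self[OF r(1)] r(1) by simp
    qed
    note al = this
    have "avg c = (\<lambda>x. 0)"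
    proof (rule subspace_spanned[where P = "\<lambda>u. avg u = (\<lambda>x. 0)" and T = "compo r"])
      show "avg (alpha t) = (\<lambda>x. 0)" if "t \<in> compo r" for t by (rule al[OF that])
      show "compo r \<noteq> {}" using comp_self[OF r(1)] by blast
    qed (use c(2) lin in simp_all)
    moreover obtain x where x: "c x > 0" using c by blast
    have "avg c x \<ge> (\<Sum>A\<in>H. c x)"
      unfolding avg_def using act_ge_of_antidominant[OF anti words_lists[OF rep(1)]] by (intro sum_mono)
    moreover have "n * c x > 0" using n x by simp
    ultimately have False by (simp add: n_def)
    then show ?thesis ..
  qed
qed

theorem finite_iff_sph: "finite H \<longleftrightarrow> H \<subseteq> W_sph S m"
proof
  assume fin: "finite H"
  show "H \<subseteq> W_sph S m"
  proof
    fix A assume "A \<in> H"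
    then obtain w where w: "w \<in> words" "A = cls w" by (rule H_cases)
    have "separated (S_sph S m)" by (intro separated_of_closed S_sph_subset comp_S_sph)
    then have "cls w \<in> parabolic S m (S_sph S m)"
    proof (rule word_in_separated[OF _ words_lists[OF w(1)]])
      fix s assume "s \<in> S - S_sph S m"
      then have "s \<in> S" "\<not> pos_def_on m (compo s)" by (auto simp: S_sph_def)
      then show "act w (alpha s) = alpha s"
        using finite_normal_acts_trivially[OF fin _ _ w(1)] comp_self by blast
    qed
    then show "A \<in> W_sph S m" using w by (simp add: W_sph_def)
  qed
next
  assume "H \<subseteq> W_sph S m"
  then show "finite H"
    using finite_parabolic_of_posdef[OF S_sph_subset pos_def_sph] finite_subset
    unfolding W_sph_def by blast
qed

section \<open>Generic components\<close>

definition root_refl :: "('a \<Rightarrow> real) \<Rightarrow> ('a \<Rightarrow> real) \<Rightarrow> 'a \<Rightarrow> real" where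
  "root_refl \<beta> v = (\<lambda>x. v x - 2 * bil \<beta> v * \<beta> x)"

lemma act_conj_refl:
  assumes "w \<in> lists S" "s \<in> S"
  shows "act (w @ [s] @ rev w) v = root_refl (act w (alpha s)) v"
  using assms
  by (simp add: act_append srefl_def root_refl_def act_linear act_act_rev bil_act_rev)

lemma conj_refl_square:
  assumes "w \<in> lists S" "s \<in> S"
  shows "eqv ((w @ [s] @ rev w) @ (w @ [s] @ rev w)) []"
proof -
  have "eqv ((w @ [s]) @ (rev w @ w) @ ([s] @ rev w)) ((w @ [s]) @ [] @ ([s] @ rev w))"
    using assms by (intro cox_eq_append cox_eq.refl rev_cox_eq_Nil)
  moreover have "eqv (w @ [s, s] @ rev w) (w @ rev w)" using assms by (intro cox_eq.cancel)
  moreover have "eqv (w @ rev w) []" using assms by (intro cox_eq_rev_Nil)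
  ultimately show ?thesis by (auto intro: cox_eq.trans)
qed

lemma act_supported:
  assumes "w \<in> lists S" "\<And>x. x \<notin> compo r \<Longrightarrow> v x = 0" "x \<notin> compo r"
  shows "act w v x = 0"
  using assms(1,3)
proof (induction w arbitrary: x rule: list.induct)
  case (Cons s w)
  then have s: "s \<in> S" and IH: "\<And>x. x \<notin> compo r \<Longrightarrow> act w v x = 0" by auto
  show ?case
  proof (cases "s \<in> compo r")
    case True
    then have "x \<noteq> s" using Cons by auto
    then show ?thesis using IH Cons by (simp add: srefl_def alpha_other)
  next
    case False
    then have "bil (alpha s) (act w v) = 0"
      using bil_alpha_separated[OF separated_comp[of r], of s "act w v"] IH s by simp
    then show ?thesis using IH Cons by (simp add: srefl_def)
  qed
qed (use assms in simp)

lemma root_supported: "\<beta> \<in> roots_of (compo r) \<Longrightarrow> x \<notin> compo r \<Longrightarrow> \<beta> x = 0"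
  by (elim roots_ofE) (auto intro!: act_supported simp: alpha_def)

lemma comp_roots: "\<beta> \<in> roots_of (compo r) \<Longrightarrow> \<beta> \<in> roots_of S"
  using roots_mono[OF comp_subset] by blast

lemma bil_supported_cong:
  assumes "\<And>x. x \<notin> compo r \<Longrightarrow> v x = 0" "\<And>t. t \<in> compo r \<Longrightarrow> bil (alpha t) u = k * bil (alpha t) u'"
  shows "bil v u = k * bil v u'"
proof -
  have "v s * bil (alpha s) u = k * (v s * bil (alpha s) u')" for s
    using assms by (cases "s \<in> compo r") auto
  then have "(\<Sum>s\<in>S. v s * bil (alpha s) u) = (\<Sum>s\<in>S. k * (v s * bil (alpha s) u'))"
    by (intro sum.cong HOL.refl)
  then show ?thesis by (simp only: bil_expand1[of v] sum_distrib_left)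
qed

end

section \<open>The negative eigenvector of a generic component\<close>

locale generic_component = coxeter_normal +
  fixes r :: 'a and l :: real and c :: "'a \<Rightarrow> real"
  assumes r: "r \<in> S" and c_nonneg: "\<forall>x. c x \<ge> 0" and c_out: "\<forall>x. x \<notin> compo r \<longrightarrow> c x = 0"
    and c_ne: "\<exists>x\<in>compo r. c x > 0" and eig: "\<forall>s\<in>compo r. bil (alpha s) c = l * c s" and l: "l < 0"
begin

abbreviation "Phi \<equiv> roots_of (compo r)"

lemma bil_alpha_c: "s \<in> S \<Longrightarrow> bil (alpha s) c = l * c s"
  using eig c_out bil_alpha_separated[OF separated_comp[of r], of s c]
  by (cases "s \<in> compo r") auto

lemma bil_c: "bil v c = l * (\<Sum>s\<in>S. v s * c s)"
  by (simp add: bil_expand1[of v] bil_alpha_c sum_distrib_left mult.left_commute)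

lemma c_antidominant: "s \<in> S \<Longrightarrow> bil (alpha s) c \<le> 0"
  using l c_nonneg by (simp add: bil_alpha_c mult_nonpos_nonneg)

text \<open>Perron-Frobenius: where c vanishes at y, the equation
  \<open>bil (alpha y) c = l * c y = 0\<close> is a sum of nonpositive terms, so each is zero and c
  vanishes at the neighbours of y as well.\<close>

lemma c_pos:
  assumes "s \<in> compo r" shows "c s > 0"
proof (rule ccontr)
  assume "\<not> c s > 0"
  then have z: "c s = 0" using c_nonneg by (simp add: order.antisym not_less)
  obtain x where x: "x \<in> compo r" "c x > 0" using c_ne by blast
  have "(s, x) \<in> (cox_edge S m)\<^sup>*" using x comp_eq[OF assms] by (auto simp: component_def)
  then have "c x = 0"
  proof (induction rule: rtrancl_induct)
    case base
    then show ?case using z .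
  next
    case (step y x)
    have y: "y \<in> S" and xy: "x \<in> S" "x \<noteq> y" "m y x \<noteq> 2" using step by (auto simp: cox_edge_def)
    have le: "c t * form y t \<le> 0" if "t \<in> S" for t
      using form_nonpos[OF y that] c_nonneg step.IH by (cases "t = y") (auto intro: mult_nonneg_nonpos)
    have "(\<Sum>t\<in>S. c t * form y t) = 0" using bil_alpha_c[OF y] step.IH by (simp add: bil_alpha1[OF y])
    then have "\<forall>t\<in>S. c t * form y t = 0"
      using sum_nonneg_eq_0_iff[of S "\<lambda>t. - (c t * form y t)"] le by (simp add: sum_negf)
    then show ?case using form_eq_0_iff[of y x] y xy by auto
  qed
  then show False using x by simp
qed

text \<open>Positive roots have height at least one, and c is bounded below on the component;
  \<kappa> is \<open>- l\<close> times its least coordinate there.\<close>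

lemma bil_root_c_bound:
  obtains \<kappa> where "\<kappa> > 0" "\<And>\<beta>. \<beta> \<in> Phi \<Longrightarrow> nonneg \<beta> \<Longrightarrow> bil \<beta> c \<le> - \<kappa>"
    "\<And>s. s \<in> compo r \<Longrightarrow> bil (alpha s) c \<le> - \<kappa>"
proof -
  define k where "k = Min (c ` compo r)"
  have ne: "c ` compo r \<noteq> {}" using comp_self[OF r] by blast
  have k: "k > 0" using ne c_pos by (simp add: k_def)
  have kc: "k \<le> c s" if "s \<in> compo r" for s using that by (simp add: k_def)
  have b: "bil \<beta> c \<le> - (- l * k)" if "\<beta> \<in> Phi" "nonneg \<beta>" for \<beta>
  proof -
    have "\<beta> s * k \<le> \<beta> s * c s" for s
      using kc[of s] root_supported[OF that(1), of s] that(2)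
      by (cases "s \<in> compo r") (auto simp: nonneg_def intro: mult_left_mono)
    then have "height \<beta> * k \<le> (\<Sum>s\<in>S. \<beta> s * c s)"
      unfolding height_def sum_distrib_right by (intro sum_mono)
    moreover have "k \<le> height \<beta> * k"
      using height_root_ge_1[OF comp_roots[OF that(1)] that(2)] k by simp
    ultimately have "k \<le> (\<Sum>s\<in>S. \<beta> s * c s)" by linarith
    then show ?thesis using l by (simp add: bil_c mult_left_mono_neg)
  qed
  show ?thesis
  proof (rule that[of "- l * k"])
    show "- l * k > 0" using l k by (simp add: mult_neg_pos)
    show "bil (alpha s) c \<le> - (- l * k)" if "s \<in> compo r" for s
      using that by (intro b alpha_root) (auto simp: nonneg_def alpha_nonneg)
  qed (rule b)
qed

text \<open>A letter of the component subtracts twice the product of two negative numbers that are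
  bounded away from zero; the other letters fix c. So the form itself counts the letters of the
  component in a reduced word.\<close>

lemma bil_act_c_decreases:
  obtains \<delta> where "\<delta> > 0"
    "\<And>w. reduced w \<Longrightarrow> bil (act w c) c \<le> bil c c - \<delta> * real (length (filter (\<lambda>s. s \<in> compo r) w))"
proof -
  obtain k where k: "k > 0" and k1: "\<And>\<beta>. \<beta> \<in> Phi \<Longrightarrow> nonneg \<beta> \<Longrightarrow> bil \<beta> c \<le> - k"
    and k2: "\<And>s. s \<in> compo r \<Longrightarrow> bil (alpha s) c \<le> - k"
    by (rule bil_root_c_bound) (rule that)
  have "reduced w \<Longrightarrow> bil (act w c) c \<le> bil c c - 2 * k * k * real (length (filter (\<lambda>s. s \<in> compo r) w))" for w
  proof (induction w rule: rev_induct)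
    case (snoc s w)
    have s: "s \<in> S" using snoc.prems by (simp add: reduced_def)
    have w: "reduced w" using snoc.prems reduced_appendD by blast
    have e: "bil (act (w @ [s]) c) c = bil (act w c) c - 2 * (bil (alpha s) c * bil (act w (alpha s)) c)"
      by (simp add: act_append srefl_def act_linear)
    show ?case
    proof (cases "s \<in> compo r")
      case True
      have "act w (alpha s) \<in> Phi" by (rule act_root[OF reduced_lists[OF w] alpha_root[OF True]])
      moreover have "nonneg (act w (alpha s))" using act_alpha_nonneg[OF snoc.prems] by (simp add: nonneg_def)
      ultimately have "bil (act w (alpha s)) c \<le> - k" by (rule k1)
      then have "k * k \<le> (- bil (alpha s) c) * (- bil (act w (alpha s)) c)"
        using k k2[OF True] by (intro mult_mono) auto
      then show ?thesis using e snoc.IH[OF w] True by (simp add: algebra_simps)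
    next
      case False
      then have "bil (alpha s) c = 0" using bil_alpha_c[OF s] c_out by simp
      then show ?thesis using e snoc.IH[OF w] False by simp
    qed
  qed simp
  moreover have "2 * k * k > 0" using k by simp
  ultimately show ?thesis using that by blast
qed

text \<open>Without a drop, a reduced expression has no letter from the component.\<close>

lemma act_trivial_of_bil_c:
  assumes "h \<in> lists S" "bil (act h c) c \<ge> bil c c" "t \<in> compo r"
  shows "act h (alpha t) = alpha t"
proof -
  obtain \<delta> where d: "\<delta> > 0"
    "\<And>w. reduced w \<Longrightarrow> bil (act w c) c \<le> bil c c - \<delta> * real (length (filter (\<lambda>s. s \<in> compo r) w))"
    by (rule bil_act_c_decreases) (rule that)
  obtain w where w: "eqv h w" "reduced w" by (rule ex_reduced[OF assms(1)])
  have "bil c c \<le> bil c c - \<delta> * real (length (filter (\<lambda>s. s \<in> compo r) w))"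
    using d(2)[OF w(2)] assms(2) act_eqv[OF w(1)] by simp
  then have "filter (\<lambda>s. s \<in> compo r) w = []" using d(1) by (simp add: mult_le_0_iff)
  then have "w \<in> lists (S - compo r)" using reduced_lists[OF w(2)] by (auto simp: filter_empty_conv)
  then have "act w (alpha t) = alpha t"
    by (rule act_separated[OF separated_comp]) (use assms(3) in \<open>auto simp: alpha_def\<close>)
  then show ?thesis using act_eqv[OF w(1)] by simp
qed

text \<open>If no letter of the component prolonged \<open>w\<close>, all its simple roots would
  become negative and \<open>w c\<close> nonpositive, against \<open>w c \<ge> c\<close>.\<close>

lemma ex_long_reduced: "\<exists>w. reduced w \<and> w \<in> lists (compo r) \<and> length w = n"
proof (induction n)
  case 0
  then show ?case by (intro exI[of _ "[]"]) (simp add: reduced_Nil)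
next
  case (Suc n)
  then obtain w where w: "reduced w" "w \<in> lists (compo r)" "length w = n" by blast
  have "\<exists>s\<in>compo r. reduced (w @ [s])"
  proof (rule ccontr)
    assume no: "\<not> (\<exists>s\<in>compo r. reduced (w @ [s]))"
    have neg: "act w (alpha s) x \<le> 0" if s: "s \<in> compo r" for s x
    proof -
      have "s \<in> S" using s comp_subset by blast
      then obtain v where "eqv w (v @ [s])" "reduced (v @ [s])"
        using reduced_snoc_cases[OF w(1)] no s by blast
      then show ?thesis using act_alpha_nonpos act_eqv by metis
    qed
    obtain x where x: "c x > 0" using c_ne by blast
    have "act w c x = (\<Sum>s\<in>compo r. c s * act w (alpha s) x)"
      using act_expand[of "compo r" c w] c_out by simp
    also have "\<dots> \<le> 0" using neg c_nonneg by (intro sum_nonpos mult_nonneg_nonpos) auto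
    finally show False
      using act_ge_of_antidominant[OF c_antidominant reduced_lists[OF w(1)], of x] x by simp
  qed
  then obtain s where "s \<in> compo r" "reduced (w @ [s])" by blast
  then show ?case using w by (intro exI[of _ "w @ [s]"]) auto
qed

text \<open>The vectors with bounded products with all roots form a stable subspace. Containing
  \<open>u\<close>, it would contain c by irreducibility, but the products of c with its images
  under long reduced words in the component tend to minus infinity.\<close>

lemma roots_unbounded:
  assumes u: "s \<in> compo r" "bil (alpha s) u \<noteq> 0"
  shows "\<exists>\<beta>\<in>Phi. M < \<bar>bil \<beta> u\<bar>"
proof (rule ccontr)
  assume "\<not> (\<exists>\<beta>\<in>Phi. M < \<bar>bil \<beta> u\<bar>)"
  then have Pu: "\<exists>M. \<forall>\<beta>\<in>Phi. \<bar>bil \<beta> u\<bar> \<le> M" by (auto simp: not_less)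
  have lin: "\<exists>M. \<forall>\<beta>\<in>Phi. \<bar>bil \<beta> (\<lambda>x. u x + k * v x)\<bar> \<le> M"
    if bu: "\<exists>M. \<forall>\<beta>\<in>Phi. \<bar>bil \<beta> u\<bar> \<le> M" and bv: "\<exists>M. \<forall>\<beta>\<in>Phi. \<bar>bil \<beta> v\<bar> \<le> M" for u v k
  proof -
    obtain M1 where M1: "\<forall>\<beta>\<in>Phi. \<bar>bil \<beta> u\<bar> \<le> M1" using bu ..
    obtain M2 where M2: "\<forall>\<beta>\<in>Phi. \<bar>bil \<beta> v\<bar> \<le> M2" using bv ..
    have "\<bar>bil \<beta> (\<lambda>x. u x + k * v x)\<bar> \<le> M1 + \<bar>k\<bar> * M2" if "\<beta> \<in> Phi" for \<beta>
    proof -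
      have "\<bar>k * bil \<beta> v\<bar> \<le> \<bar>k\<bar> * M2" using M2 that by (simp add: abs_mult mult_left_mono)
      moreover have "\<bar>bil \<beta> u\<bar> \<le> M1" using M1 that by blast
      ultimately show ?thesis by simp
    qed
    then show ?thesis by blast
  qed
  have "\<exists>M. \<forall>\<beta>\<in>Phi. \<bar>bil \<beta> (alpha t)\<bar> \<le> M" if "t \<in> compo r" for t
  proof (rule irreducible_subspace[where P = "\<lambda>u. \<exists>M. \<forall>\<beta>\<in>Phi. \<bar>bil \<beta> u\<bar> \<le> M", OF lin _ Pu u that])
    fix u s assume s: "s \<in> compo r" and "\<exists>M. \<forall>\<beta>\<in>Phi. \<bar>bil \<beta> u\<bar> \<le> M"
    then obtain M where M: "\<And>\<beta>. \<beta> \<in> Phi \<Longrightarrow> \<bar>bil \<beta> u\<bar> \<le> M" by blast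
    have sS: "s \<in> S" using s comp_subset by blast
    have "\<bar>bil \<beta> (srefl s u)\<bar> \<le> M" if "\<beta> \<in> Phi" for \<beta>
    proof -
      have "act [s] \<beta> \<in> Phi" using sS that by (intro act_root) auto
      then show ?thesis using M[of "srefl s \<beta>"] bil_srefl[OF sS, of "srefl s \<beta>" u] sS by simp
    qed
    then show "\<exists>M. \<forall>\<beta>\<in>Phi. \<bar>bil \<beta> (srefl s u)\<bar> \<le> M" by blast
  qed
  note al = this
  have "\<exists>M. \<forall>\<beta>\<in>Phi. \<bar>bil \<beta> c\<bar> \<le> M"
  proof (rule subspace_spanned[where P = "\<lambda>u. \<exists>M. \<forall>\<beta>\<in>Phi. \<bar>bil \<beta> u\<bar> \<le> M" and T = "compo r", OF lin])
    show "compo r \<noteq> {}" using comp_self[OF r] by blast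
    show "\<exists>M. \<forall>\<beta>\<in>Phi. \<bar>bil \<beta> (alpha t)\<bar> \<le> M" if "t \<in> compo r" for t by (rule al[OF that])
  qed (use c_out in simp_all)
  then obtain M where M: "\<And>\<beta>. \<beta> \<in> Phi \<Longrightarrow> \<bar>bil \<beta> c\<bar> \<le> M" by blast
  obtain \<delta> where d: "\<delta> > 0"
    "\<And>w. reduced w \<Longrightarrow> bil (act w c) c \<le> bil c c - \<delta> * real (length (filter (\<lambda>s. s \<in> compo r) w))"
    by (rule bil_act_c_decreases) (rule that)
  define D where "D = (\<Sum>s\<in>compo r. c s) * M + bil c c"
  obtain n :: nat where n: "D / \<delta> < real n" using reals_Archimedean2 by blast
  obtain w where w: "reduced w" "w \<in> lists (compo r)" "length w = n" using ex_long_reduced by blast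
  have "filter (\<lambda>s. s \<in> compo r) w = w" using w(2) by (auto simp: filter_id_conv in_lists_conv_set)
  then have "bil (act w c) c \<le> bil c c - \<delta> * real n" using d(2)[OF w(1)] w(3) by simp
  moreover have "bil (act w c) c = (\<Sum>s\<in>compo r. c s * bil (act w (alpha s)) c)"
    using act_expand[of "compo r" c w] c_out by (simp add: bil_sum1)
  moreover have "(\<Sum>s\<in>compo r. c s * bil (act w (alpha s)) c) \<ge> (\<Sum>s\<in>compo r. c s * (- M))"
  proof (intro sum_mono mult_left_mono)
    fix s assume "s \<in> compo r"
    then have "act w (alpha s) \<in> Phi" by (intro act_root reduced_lists[OF w(1)] alpha_root)
    then show "- M \<le> bil (act w (alpha s)) c" using M by fastforce
  qed (use c_nonneg in simp)
  ultimately have "\<delta> * real n \<le> D" by (simp add: D_def sum_distrib_right sum_negf)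
  then show False using n d(1) by (simp add: field_simps)
qed

text \<open>If \<open>h\<close> sends each simple root of the component to plus or minus itself
  modulo the radical, the product is l times a signed sum of squares, and as l < 0 a minus sign can
  only increase it.\<close>

lemma bil_c_c_le:
  assumes sg: "\<And>s. s \<in> compo r \<Longrightarrow> sg s = 1 \<or> sg s = (-1 :: real)"
    and h: "h \<in> lists S"
    and rad: "\<And>s t. s \<in> compo r \<Longrightarrow> t \<in> compo r \<Longrightarrow> bil (alpha t) (act h (alpha s)) = sg s * bil (alpha t) (alpha s)"
  shows "bil c c \<le> bil (act h c) c"
proof -
  have "bil (act h c) c = (\<Sum>s\<in>compo r. c s * bil c (act h (alpha s)))"
    using act_expand[of "compo r" c h] c_out by (simp add: bil_sum1 bil_sym[of c])
  also have "\<dots> = (\<Sum>s\<in>compo r. c s * (sg s * (l * c s)))"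
  proof (intro sum.cong HOL.refl)
    fix s assume s: "s \<in> compo r"
    have "bil c (act h (alpha s)) = sg s * bil c (alpha s)"
    proof (rule bil_supported_cong[of r])
      show "c x = 0" if "x \<notin> compo r" for x using c_out that by blast
    qed (rule rad[OF s])
    then show "c s * bil c (act h (alpha s)) = c s * (sg s * (l * c s))"
      using eig s by (simp add: bil_sym[of c])
  qed
  also have "\<dots> \<ge> (\<Sum>s\<in>compo r. l * (c s * c s))"
  proof (intro sum_mono)
    fix s assume s: "s \<in> compo r"
    have "l * (c s * c s) \<le> 0" using l by (simp add: mult_nonpos_nonneg)
    then show "l * (c s * c s) \<le> c s * (sg s * (l * c s))" using sg[OF s] by (auto simp: algebra_simps)
  qed
  moreover have "bil c c = (\<Sum>s\<in>compo r. l * (c s * c s))"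
  proof -
    have "(\<Sum>s\<in>S. c s * c s) = (\<Sum>s\<in>compo r. c s * c s)"
      using c_out comp_subset by (intro sum.mono_neutral_right) auto
    then show ?thesis by (simp add: bil_c sum_distrib_left)
  qed
  ultimately show ?thesis by simp
qed

text \<open>As \<open>h\<close> acts nontrivially, some simple root \<open>a\<close> has an image
  \<open>g\<close> that is not plus or minus \<open>a\<close> modulo the radical. If their product
  is not beyond 1, the commutator \<open>z\<close> of \<open>h\<close> and \<open>s\<close> is the
  product of the reflections in \<open>g\<close> and \<open>a\<close>, and it moves a root with
  large product with \<open>g + a\<close> or \<open>g - a\<close> far enough.\<close>

lemma ex_hyperbolic_pair:
  assumes h: "h \<in> words" and t: "t \<in> compo r" "act h (alpha t) \<noteq> alpha t"
  obtains h' \<beta> where "h' \<in> words" "\<beta> \<in> Phi" "\<bar>bil (act h' \<beta>) \<beta>\<bar> > 1"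
proof -
  have hS: "h \<in> lists S" using h by (rule words_lists)
  define bad where "bad s e \<longleftrightarrow> (\<forall>t\<in>compo r. bil (alpha t) (act h (alpha s)) = e * bil (alpha t) (alpha s))" for s and e :: real
  have "\<exists>s\<in>compo r. \<not> bad s 1 \<and> \<not> bad s (-1)"
  proof (rule ccontr)
    assume "\<not> (\<exists>s\<in>compo r. \<not> bad s 1 \<and> \<not> bad s (-1))"
    then have "bil c c \<le> bil (act h c) c"
      by (intro bil_c_c_le[of "\<lambda>s. if bad s 1 then 1 else -1", OF _ hS]) (auto simp: bad_def)
    then show False using act_trivial_of_bil_c[OF hS _ t(1)] t(2) by blast
  qed
  then obtain s where s: "s \<in> compo r" "\<not> bad s 1" "\<not> bad s (-1)" by blast
  have sS: "s \<in> S" using s(1) comp_subset by blast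
  define a g where "a = alpha s" and "g = act h (alpha s)"
  define k where "k = bil g a"
  have gP: "g \<in> Phi" unfolding g_def by (intro act_root hS alpha_root s)
  have aP: "a \<in> Phi" unfolding a_def by (intro alpha_root s)
  show ?thesis
  proof (cases "\<bar>k\<bar> > 1")
    case True
    then show ?thesis using that[OF h aP] by (simp add: k_def g_def a_def)
  next
    case False
    define z where "z = h @ ([s] @ rev h @ [s])"
    have "[s] @ rev h @ rev [s] \<in> words" using sS by (intro words_conj words_rev h) auto
    then have z: "z \<in> words" using words_append[OF h, of "[s] @ rev h @ [s]"] by (simp add: z_def)
    have act_z: "act z v = root_refl g (root_refl a v)" for v
    proof -
      have "act z v = act (h @ [s] @ rev h) (act [s] v)" by (simp add: z_def act_append)
      also have "\<dots> = root_refl g (root_refl a v)"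
        unfolding act_conj_refl[OF hS sS] by (simp add: g_def a_def root_refl_def srefl_def)
      finally show ?thesis .
    qed
    have val: "bil (act z \<beta>) \<beta> = 1 - 2 * ((bil a \<beta>)\<^sup>2 + (bil g \<beta>)\<^sup>2 - 2 * k * bil a \<beta> * bil g \<beta>)"
      if "\<beta> \<in> Phi" for \<beta>
      using bil_root_self[OF comp_roots[OF that]]
      by (simp add: act_z root_refl_def k_def power2_eq_square algebra_simps)
    \<comment> \<open>The sign e is opposite to that of k. As \<bar>k\<bar> \<le> 1, the form
      \<open>p\<^sup>2 + q\<^sup>2 - 2 * k * p * q\<close> is then at least half of
      \<open>(q + e * p)\<^sup>2\<close>, and a value of \<open>q + e * p\<close> beyond 2 brings
      the product with the image below -1.\<close>
    define e where "e = (if k \<ge> 0 then -1 else 1 :: real)"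
    have e: "e * e = 1" "k = - e * \<bar>k\<bar>" by (auto simp: e_def)
    have "\<not> bad s (- e)" using s by (simp add: e_def)
    then obtain t where "t \<in> compo r" "bil (alpha t) (\<lambda>x. g x + e * a x) \<noteq> 0"
      by (auto simp: bad_def g_def a_def)
    then obtain \<beta> where b: "\<beta> \<in> Phi" "2 < \<bar>bil \<beta> (\<lambda>x. g x + e * a x)\<bar>"
      using roots_unbounded by blast
    define p q where "p = bil a \<beta>" and "q = bil g \<beta>"
    have "2 < \<bar>q + e * p\<bar>" using b by (simp add: p_def q_def bil_sym[of \<beta>])
    then have "2\<^sup>2 < (q + e * p)\<^sup>2" by (metis abs_numeral abs_le_square_iff not_le)
    then have "4 < (q + e * p)\<^sup>2" by simp
    moreover have "p\<^sup>2 + q\<^sup>2 - 2 * (- e * j) * p * q =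
        (q + e * p)\<^sup>2 / 2 + j * (q + e * p)\<^sup>2 / 2 + (1 - j) * (q - e * p)\<^sup>2 / 2" for j
      by (auto simp: e_def power2_eq_square field_simps)
    from this[of "\<bar>k\<bar>"] have "p\<^sup>2 + q\<^sup>2 - 2 * k * p * q =
        (q + e * p)\<^sup>2 / 2 + \<bar>k\<bar> * (q + e * p)\<^sup>2 / 2 + (1 - \<bar>k\<bar>) * (q - e * p)\<^sup>2 / 2"
      unfolding e(2)[symmetric] .
    moreover have "\<bar>k\<bar> * (q + e * p)\<^sup>2 / 2 \<ge> 0" "(1 - \<bar>k\<bar>) * (q - e * p)\<^sup>2 / 2 \<ge> 0"
      using False by auto
    ultimately have "p\<^sup>2 + q\<^sup>2 - 2 * k * p * q > 1" by linarith
    then show ?thesis using that[OF z b(1)] val[OF b(1)] by (simp add: p_def q_def)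
  qed
qed

section \<open>Hyperbolic elements\<close>

lemma act_power:
  assumes "act w v = (\<lambda>x. k * v x)"
  shows "act (concat (replicate n w)) v = (\<lambda>x. k ^ n * v x)"
  using assms by (induction n) (auto simp: act_append act_scale)

lemma act_power_fixed: "act w v = v \<Longrightarrow> act (concat (replicate n w)) v = v"
  using act_power[of w v 1 n] by simp

lemma act_rev_eigenvector:
  assumes "w \<in> lists S" "act w v = (\<lambda>x. k * v x)" "k \<noteq> 0"
  shows "act (rev w) v = (\<lambda>x. (1 / k) * v x)"
proof -
  have "v = act (rev w) (\<lambda>x. k * v x)" using act_rev_act[OF assms(1), of v] assms(2) by simp
  then have "v x = k * act (rev w) v x" for x unfolding act_scale by (simp add: fun_eq_iff)
  then have "act (rev w) v x = (1 / k) * v x" for x using assms(3) by (simp add: field_simps)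
  then show ?thesis by blast
qed

lemma power_lists: "w \<in> lists S \<Longrightarrow> concat (replicate n w) \<in> lists S"
  by (induction n) auto

text \<open>The sum again has a nonnegative orbit, so its norm is nonpositive; for isotropic vectors
  this norm is twice their product.\<close>

lemma bil_nonpos_of_nonneg_orbits:
  assumes "\<forall>w\<in>lists S. nonneg (act w u)" "\<forall>w\<in>lists S. nonneg (act w v)"
    and "bil u u = 0" "bil v v = 0"
  shows "bil u v \<le> 0"
proof -
  have "bil (\<lambda>x. u x + v x) (\<lambda>x. u x + v x) \<le> 0"
    using assms(1,2) by (intro bil_self_nonpos_of_nonneg_orbit) (auto simp: act_add nonneg_def)
  then show ?thesis using assms(3,4) by (simp add: bil_sym[of v u])
qed

text \<open>The roots in question converge projectively to v. Infinitely many of them have the same sign,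
  and each group element changes the sign of only finitely many positive roots.\<close>
lemma nonneg_orbit_of_limit_root:
  assumes roots: "\<And>n::nat. (\<lambda>x. a * \<mu> ^ n * v x + b * (1 / \<mu>) ^ n * v' x) \<in> roots_of S"
    and a: "a > 0" and \<mu>: "\<mu> > 1" and v: "bil v v' \<noteq> 0" "bil v' v' = 0"
  shows "\<exists>e\<in>{1, -1::real}. \<forall>w\<in>lists S. nonneg (act w (\<lambda>x. e * v x))"
proof -
  define B where "B n = (\<lambda>x. a * \<mu> ^ n * v x + b * (1 / \<mu>) ^ n * v' x)" for n :: nat
  have BR: "B n \<in> roots_of S" for n using roots by (simp add: B_def)
  have bB: "bil (B n) v' = a * \<mu> ^ n * bil v v'" for n by (simp add: B_def v(2))
  \<comment> \<open>The product with \<open>v'\<close> isolates the growing term, so the roots are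
    pairwise distinct.\<close>
  have inj: "inj B"
  proof (rule injI)
    fix i j assume "B i = B j"
    then have "a * \<mu> ^ i * bil v v' = a * \<mu> ^ j * bil v v'" using bB by metis
    then have "\<mu> ^ i = \<mu> ^ j" using a v(1) by simp
    then show "i = j" using \<mu> by simp
  qed
  have "UNIV = {n. nonneg (\<lambda>x. 1 * B n x)} \<union> {n. nonneg (\<lambda>x. -1 * B n x)}"
    using root_cases[OF BR] by auto
  then have "infinite {n. nonneg (\<lambda>x. 1 * B n x)} \<or> infinite {n. nonneg (\<lambda>x. -1 * B n x)}"
    by (metis finite_Un infinite_UNIV_nat)
  then obtain e :: real where e: "e \<in> {1, -1}" and inf: "infinite {n. nonneg (\<lambda>x. e * B n x)}"
    by blast
  define I where "I = {n. nonneg (\<lambda>x. e * B n x)}"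
  have eBR: "(\<lambda>x. e * B n x) \<in> roots_of S" for n
    using e root_uminus[OF _ BR[of n]] BR[of n] by auto
  have "nonneg (act w (\<lambda>x. e * v x))" if w: "w \<in> lists S" for w
  proof -
    define Bad where "Bad = {n \<in> I. \<not> nonneg (act w (\<lambda>x. e * B n x))}"
    have "inj_on (\<lambda>n. \<lambda>x. e * B n x) Bad"
    proof (rule inj_onI)
      fix i j assume "(\<lambda>x. e * B i x) = (\<lambda>x. e * B j x)"
      then have "B i = B j" using e by (auto simp: fun_eq_iff)
      then show "i = j" using inj by (simp add: inj_eq)
    qed
    moreover have sub: "(\<lambda>n. \<lambda>x. e * B n x) ` Bad \<subseteq> {\<beta> \<in> roots_of S. nonneg \<beta> \<and> \<not> nonneg (act w \<beta>)}"
      using eBR by (auto simp: Bad_def I_def)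
    ultimately have "finite Bad"
      using finite_imageD[OF finite_subset[OF sub finite_inversions[OF w]]] by blast
    moreover have "infinite I" using inf by (simp add: I_def)
    ultimately have good: "infinite (I - Bad)" by simp
    have "e * act w v x \<ge> 0" for x
    proof (rule ccontr)
      assume neg: "\<not> e * act w v x \<ge> 0"
      define d where "d = - (e * act w v x) * a"
      have d: "d > 0" using neg a by (simp add: d_def mult_neg_pos)
      define M where "M = \<bar>b * act w v' x\<bar>"
      obtain N where N: "M / d < \<mu> ^ N" using real_arch_pow[OF \<mu>] by blast
      \<comment> \<open>For a large good n the growing term dominates the other one, which stays
        within M, so a negative coordinate of the limit would show in the root.\<close>
      obtain n where n: "n \<in> I - Bad" "N \<le> n" using good infinite_nat_iff_unbounded_le by blast
      then have "0 \<le> act w (\<lambda>x. e * B n x) x" by (auto simp: Bad_def nonneg_def)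
      also have "\<dots> = - d * \<mu> ^ n + e * (1 / \<mu>) ^ n * (b * act w v' x)"
      proof -
        have "act w (\<lambda>x. e * B n x) =
            (\<lambda>x. e * (a * \<mu> ^ n * act w v x + b * (1 / \<mu>) ^ n * act w v' x))"
          by (simp only: B_def act_add act_scale)
        then show ?thesis by (simp add: d_def algebra_simps)
      qed
      finally have "d * \<mu> ^ n \<le> e * (1 / \<mu>) ^ n * (b * act w v' x)" by simp
      also have "\<dots> \<le> \<bar>e * (1 / \<mu>) ^ n * (b * act w v' x)\<bar>" by (rule abs_ge_self)
      also have "\<dots> = \<bar>(1 / \<mu>) ^ n\<bar> * M" using e by (auto simp: abs_mult M_def)
      also have "\<dots> \<le> 1 * M" using \<mu> by (intro mult_right_mono) (auto simp: power_le_one M_def power_abs)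
      finally have "\<mu> ^ n \<le> M / d" using d by (simp add: field_simps)
      moreover have "\<mu> ^ N \<le> \<mu> ^ n" using \<mu> n(2) by (intro power_increasing) auto
      ultimately show False using N by linarith
    qed
    then show ?thesis by (simp add: nonneg_def act_scale)
  qed
  then show ?thesis using e by blast
qed

lemma root_refl_eq_act:
  assumes "\<theta> \<in> roots_of S"
  obtains w where "w \<in> lists S" "\<And>v. act w v = root_refl \<theta> v"
proof -
  obtain u t where u: "\<theta> = act u (alpha t)" "u \<in> lists S" "t \<in> S" using assms by (rule roots_ofE)
  then have "u @ [t] @ rev u \<in> lists S" by auto
  then show ?thesis using that[of "u @ [t] @ rev u"] act_conj_refl[OF u(2,3)] u(1) by simp
qed

text \<open>In a word in four reflections without repeated neighbours, acting on the root of a further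
  letter, the coefficient of the outermost root stays dominant.\<close>
lemma reflection_free_product:
  fixes R :: "nat \<Rightarrow> 'a list" and B :: "nat \<Rightarrow> 'a \<Rightarrow> real"
  assumes root: "\<And>j. j < n \<Longrightarrow> B j \<in> roots_of S" and pos: "\<And>j. j < n \<Longrightarrow> nonneg (B j)"
    and sep: "\<And>i j. i < n \<Longrightarrow> j < n \<Longrightarrow> i \<noteq> j \<Longrightarrow> bil (B i) (B j) \<le> -1"
    and R: "\<And>j v. j < n \<Longrightarrow> act (R j) v = root_refl (B j) v"
    and js: "js \<in> lists {..<n}" "distinct_adj js" "js \<noteq> []"
  shows "\<not> eqv (concat (map R js)) []"
proof -
  have claim: "\<exists>C. act (concat (map R ks)) (B i) = (\<lambda>x. \<Sum>j<n. C j * B j x) \<and>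
      (\<forall>j<n. 0 \<le> C j \<and> C j \<le> C (hd (ks @ [i]))) \<and> 1 \<le> C (hd (ks @ [i]))"
    if "ks @ [i] \<in> lists {..<n}" "distinct_adj (ks @ [i])" for ks i
    using that
  proof (induction ks rule: list.induct)
    case Nil
    then have "i < n" by simp
    then have "B i = (\<lambda>x. \<Sum>j<n. (if j = i then 1 else 0) * B j x)"
      by (simp add: if_distrib[of "\<lambda>y. y * _"] cong: if_cong)
    then show ?case by (intro exI[of _ "\<lambda>j. if j = i then 1 else 0"]) auto
  next
    case (Cons k ks)
    have k: "k < n" using Cons.prems by simp
    obtain C where C: "act (concat (map R ks)) (B i) = (\<lambda>x. \<Sum>j<n. C j * B j x)"
       "\<And>j. j < n \<Longrightarrow> 0 \<le> C j" "\<And>j. j < n \<Longrightarrow> C j \<le> C (hd (ks @ [i]))" "1 \<le> C (hd (ks @ [i]))"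
      using Cons by (auto simp: distinct_adj_Cons)
    \<comment> \<open>Invariant: the outermost root has the largest coefficient. As p differs from
      k, the sum y is at most \<open>C k - C p\<close>, so the new coefficient of k is at least
      \<open>2 * C p - C k\<close>, hence at least \<open>C p\<close>.\<close>
    define p where "p = hd (ks @ [i])"
    have p: "p < n" "p \<noteq> k" using Cons.prems by (cases ks; auto simp: p_def)+
    define y where "y = (\<Sum>j<n. C j * bil (B k) (B j))"
    define C' where "C' = C(k := C k - 2 * y)"
    have Bk: "bil (B k) (B k) = 1" using bil_root_self[OF root[OF k]] .
    have "act (concat (map R (k # ks))) (B i) = root_refl (B k) (\<lambda>x. \<Sum>j<n. C j * B j x)"
      using R[OF k] C(1) by (simp add: act_append)
    also have "\<dots> = (\<lambda>x. (\<Sum>j<n. C j * B j x) - 2 * y * B k x)"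
      by (simp add: root_refl_def bil_sum2 y_def)
    also have "\<dots> = (\<lambda>x. \<Sum>j<n. C' j * B j x)"
    proof
      fix x
      have "(\<Sum>j<n. C' j * B j x) = C' k * B k x + (\<Sum>j\<in>{..<n} - {k}. C j * B j x)"
        using k by (subst sum.remove[of _ k]) (auto simp: C'_def intro!: sum.cong)
      moreover have "(\<Sum>j<n. C j * B j x) = C k * B k x + (\<Sum>j\<in>{..<n} - {k}. C j * B j x)"
        using k by (subst sum.remove[of _ k]) auto
      ultimately show "(\<Sum>j<n. C j * B j x) - 2 * y * B k x = (\<Sum>j<n. C' j * B j x)"
        by (simp add: C'_def algebra_simps)
    qed
    finally have act': "act (concat (map R (k # ks))) (B i) = (\<lambda>x. \<Sum>j<n. C' j * B j x)" .
    have "y = C k + (\<Sum>j\<in>{..<n} - {k}. C j * bil (B k) (B j))"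
      unfolding y_def using k Bk by (subst sum.remove[of _ k]) auto
    also have "\<dots> = C k + (C p * bil (B k) (B p) + (\<Sum>j\<in>{..<n} - {k} - {p}. C j * bil (B k) (B j)))"
      using p by (subst sum.remove[of _ p]) auto
    also have "\<dots> \<le> C k + (C p * (- 1) + 0)"
    proof (intro add_left_mono add_mono mult_left_mono)
      show "bil (B k) (B p) \<le> - 1" using sep p k by simp
      show "0 \<le> C p" using C(2) p by simp
      show "(\<Sum>j\<in>{..<n} - {k} - {p}. C j * bil (B k) (B j)) \<le> 0"
      proof (intro sum_nonpos mult_nonneg_nonpos)
        fix j assume j: "j \<in> {..<n} - {k} - {p}"
        then show "0 \<le> C j" using C(2) by simp
        have "bil (B k) (B j) \<le> - 1" using sep[OF k, of j] j by auto
        then show "bil (B k) (B j) \<le> 0" by simp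
      qed
    qed
    finally have "C' k \<ge> 2 * C p - C k" by (simp add: C'_def)
    then have C'k: "C' k \<ge> C p" using C(3)[OF k] by (simp add: p_def)
    have "0 \<le> C' j \<and> C' j \<le> C' k" if "j < n" for j
      using C(2)[OF that] C(3)[OF that] C'k C(4) by (cases "j = k") (auto simp: C'_def p_def)
    moreover have "1 \<le> C' k" using C'k C(4) by (simp add: p_def)
    ultimately show ?case using act' by (intro exI[of _ C']) auto
  qed
  show ?thesis
  proof
    assume e: "eqv (concat (map R js)) []"
    obtain ks i where ki: "js = ks @ [i]" using js(3) by (cases js rule: rev_cases) auto
    have i: "i < n" using js(1) ki by simp
    obtain C where C: "act (concat (map R ks)) (B i) = (\<lambda>x. \<Sum>j<n. C j * B j x)"
       "\<And>j. j < n \<Longrightarrow> 0 \<le> C j" "1 \<le> C (hd (ks @ [i]))"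
      using claim[of ks i] js ki by auto
    define p where "p = hd (ks @ [i])"
    have p: "p < n" using js(1) ki by (cases ks) (auto simp: p_def)
    \<comment> \<open>The last reflection negates its own root, so a trivial word would make
      \<open>B i\<close> minus a nonnegative combination of positive roots in which
      \<open>B p\<close> has coefficient at least one.\<close>
    have "B i = act (concat (map R ks)) (root_refl (B i) (B i))"
      using act_eqv[OF e, of "B i"] R[OF i] by (simp add: ki act_append)
    also have "root_refl (B i) (B i) = (\<lambda>x. - B i x)"
      using bil_root_self[OF root[OF i]] by (simp add: root_refl_def)
    finally have Bi: "B i x = - (\<Sum>j<n. C j * B j x)" for x
      using C(1) by (simp add: act_uminus fun_eq_iff)
    have "B p x = 0" for x
    proof -
      have terms: "0 \<le> C j * B j x" if "j < n" for j using C(2) pos that by (simp add: nonneg_def)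
      have "C p * B p x \<le> (\<Sum>j<n. C j * B j x)"
        using p terms by (intro member_le_sum) auto
      moreover have "0 \<le> B i x" using pos[OF i] by (simp add: nonneg_def)
      ultimately have "C p * B p x \<le> 0" using Bi[of x] by simp
      moreover have "0 \<le> B p x" using pos[OF p] by (simp add: nonneg_def)
      ultimately show ?thesis using C(3) by (simp add: p_def mult_le_0_iff)
    qed
    then have "B p = (\<lambda>x. 0)" by blast
    then show False using bil_root_self[OF root[OF p]] by simp
  qed
qed

end

text \<open>A translation along an axis in W with endpoints vp and vm.\<close>
locale hyperbolic_element = generic_component +
  fixes \<tau> :: "'a list" and \<mu> :: real and vp vm :: "'a \<Rightarrow> real" and a b :: real
  assumes tau: "\<tau> \<in> words" and mu: "\<mu> > 1"
    and vp_out: "\<forall>x. x \<notin> compo r \<longrightarrow> vp x = 0" and vm_out: "\<forall>x. x \<notin> compo r \<longrightarrow> vm x = 0"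
    and iso_p: "bil vp vp = 0" and iso_m: "bil vm vm = 0" and neg: "bil vp vm < 0"
    and act_p: "act \<tau> vp = (\<lambda>x. \<mu> * vp x)" and act_m: "act \<tau> vm = (\<lambda>x. (1 / \<mu>) * vm x)"
    and act_orth: "\<forall>v. bil v vp = 0 \<longrightarrow> bil v vm = 0 \<longrightarrow> act \<tau> v = v"
    and beta: "(\<lambda>x. a * vp x + b * vm x) \<in> Phi" and a: "a > 0" and b: "b < 0"
    and orbit_p: "\<forall>w\<in>lists S. nonneg (act w vp)" and orbit_m: "\<forall>w\<in>lists S. nonneg (act w vm)"

context generic_component
begin

text \<open>The commutator of the reflection in \<beta> with \<open>h'\<close> is the product of the
  reflections in \<beta> and \<gamma>, the image of \<beta> with the sign that makes
  \<open>bil \<gamma> \<beta> = - K\<close> negative. On their plane, which is indefinite as K > 1,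
  it is diagonal along the two isotropic lines.\<close>

lemma ex_hyperbolic_element:
  assumes h: "h \<in> words" and t: "t \<in> compo r" "act h (alpha t) \<noteq> alpha t"
  shows "\<exists>\<tau> \<mu> vp vm a b. hyperbolic_element S m H r l c \<tau> \<mu> vp vm a b"
proof -
  obtain h' \<beta> where h': "h' \<in> words" and \<beta>: "\<beta> \<in> Phi" and big: "\<bar>bil (act h' \<beta>) \<beta>\<bar> > 1"
    by (rule ex_hyperbolic_pair[OF h t])
  have h'S: "h' \<in> lists S" using h' by (rule words_lists)
  obtain w s where w: "\<beta> = act w (alpha s)" "w \<in> lists S" "s \<in> compo r" using \<beta> by (rule roots_ofE)
  have sS: "s \<in> S" using w(3) comp_subset by blast
  define \<rho> where "\<rho> = w @ [s] @ rev w"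
  have \<rho>S: "\<rho> \<in> lists S" using w(2) sS by (auto simp: \<rho>_def)
  have rev\<rho>: "rev \<rho> = \<rho>" by (simp add: \<rho>_def)
  define e0 where "e0 = (if bil (act h' \<beta>) \<beta> < 0 then 1 else (-1::real))"
  have e0: "e0 * e0 = 1" by (simp add: e0_def)
  define \<gamma> where "\<gamma> = (\<lambda>x. e0 * act h' \<beta> x)"
  define K where "K = \<bar>bil (act h' \<beta>) \<beta>\<bar>"
  have K: "K > 1" using big by (simp add: K_def)
  have bb: "bil \<beta> \<beta> = 1" by (rule bil_root_self[OF comp_roots[OF \<beta>]])
  have gg: "bil \<gamma> \<gamma> = 1" using e0 bil_act[OF h'S, of \<beta> \<beta>] bb by (simp add: \<gamma>_def flip: mult.assoc)
  have gb: "bil \<gamma> \<beta> = - K" by (simp add: \<gamma>_def K_def e0_def)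
  have bg: "bil \<beta> \<gamma> = - K" using gb by (simp add: bil_sym)
  define \<tau> where "\<tau> = \<rho> @ h' @ \<rho> @ rev h'"
  have \<tau>W: "\<tau> \<in> words"
    using words_append[OF words_conj[OF \<rho>S h'] words_rev[OF h']] rev\<rho> by (simp add: \<tau>_def)
  have \<tau>S: "\<tau> \<in> lists S" using \<tau>W by (rule words_lists)
  have act\<tau>: "act \<tau> v = root_refl \<beta> (root_refl \<gamma> v)" for v
  proof -
    have 1: "act \<rho> v = root_refl \<beta> v" for v unfolding \<rho>_def act_conj_refl[OF w(2) sS] w(1) ..
    have e: "(h' @ w) @ [s] @ rev (h' @ w) = h' @ \<rho> @ rev h'" by (simp add: \<rho>_def)
    have "act (h' @ \<rho> @ rev h') v = root_refl (act (h' @ w) (alpha s)) v"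
      using act_conj_refl[OF append_lists[OF h'S w(2)] sS, of v] unfolding e .
    then have "act (h' @ \<rho> @ rev h') v = root_refl (act h' \<beta>) v"
      by (simp only: act_append[of h' w] w(1))
    moreover have "root_refl (act h' \<beta>) v = root_refl \<gamma> v"
      by (simp add: root_refl_def \<gamma>_def e0_def)
    ultimately show ?thesis using 1[of "act (h' @ \<rho> @ rev h') v"] by (simp add: \<tau>_def act_append)
  qed
  \<comment> \<open>The larger zero of \<open>L * L - 2 * K * L + 1\<close>. It makes
    \<open>L * \<beta> + \<gamma>\<close> and \<open>\<beta> + L * \<gamma>\<close> isotropic, and
    each of the two reflections exchanges their lines.\<close>
  define L where "L = K + sqrt (K\<^sup>2 - 1)"
  have K2: "K\<^sup>2 > 1" using K by simp
  have sq: "sqrt (K\<^sup>2 - 1) > 0" using K2 by simp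
  have L: "L > 1" using K sq unfolding L_def by linarith
  have LK: "L * L = 2 * K * L - 1"
  proof -
    have "sqrt (K\<^sup>2 - 1) * sqrt (K\<^sup>2 - 1) = K\<^sup>2 - 1" using K2 by simp
    then show ?thesis by (simp add: L_def power2_eq_square algebra_simps)
  qed
  define vp0 where "vp0 = (\<lambda>x. L * \<beta> x + \<gamma> x)"
  define vm0 where "vm0 = (\<lambda>x. \<beta> x + L * \<gamma> x)"
  define \<mu> where "\<mu> = L * L"
  have L2: "L * L > 1" using L by (simp add: less_1_mult)
  have \<mu>: "\<mu> > 1" using L2 by (simp add: \<mu>_def)
  note bils = bb gg gb bg
  have iso: "bil vp0 vp0 = 0" "bil vm0 vm0 = 0"
    using LK by (simp_all add: vp0_def vm0_def bils algebra_simps)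
  have pm: "bil vp0 vm0 = 2 * L * (1 - K\<^sup>2)"
  proof -
    have "bil vp0 vm0 = 2 * L - K * (L * L + 1)"
      by (simp add: vp0_def vm0_def bils algebra_simps)
    then show ?thesis by (simp add: LK power2_eq_square algebra_simps)
  qed
  have neg: "bil vp0 vm0 < 0" unfolding pm using L K2 by (simp add: mult_pos_neg)
  have ap: "act \<tau> vp0 = (\<lambda>x. \<mu> * vp0 x)"
  proof
    fix x
    have g1: "root_refl \<gamma> vp0 = (\<lambda>x. L * vm0 x)"
    proof
      fix x
      have "root_refl \<gamma> vp0 x = L * \<beta> x + (2 * K * L - 1) * \<gamma> x"
        by (simp add: root_refl_def vp0_def bils algebra_simps)
      then show "root_refl \<gamma> vp0 x = L * vm0 x"
        unfolding LK[symmetric] by (simp add: vm0_def algebra_simps)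
    qed
    have "root_refl \<beta> (\<lambda>x. L * vm0 x) x = L * ((2 * K * L - 1) * \<beta> x + L * \<gamma> x)"
      by (simp add: root_refl_def vm0_def bils algebra_simps)
    also have "\<dots> = \<mu> * vp0 x" unfolding LK[symmetric] by (simp add: \<mu>_def vp0_def algebra_simps)
    finally show "act \<tau> vp0 x = \<mu> * vp0 x" by (simp add: act\<tau> g1)
  qed
  have am: "act \<tau> vm0 = (\<lambda>x. (1 / \<mu>) * vm0 x)"
  proof
    fix x
    have L1: "2 * K - L = 1 / L" using LK L by (simp add: field_simps)
    have g1: "root_refl \<gamma> vm0 = (\<lambda>x. (1 / L) * vp0 x)"
    proof
      fix x
      have "root_refl \<gamma> vm0 x = \<beta> x + (2 * K - L) * \<gamma> x"
        by (simp add: root_refl_def vm0_def bils algebra_simps)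
      then show "root_refl \<gamma> vm0 x = (1 / L) * vp0 x" unfolding L1 using L by (simp add: vp0_def field_simps)
    qed
    have "bil \<beta> vp0 = L - K" by (simp add: vp0_def bils)
    then have "root_refl \<beta> (\<lambda>x. (1 / L) * vp0 x) x = (1 / L) * vp0 x - 2 * ((1 / L) * (L - K)) * \<beta> x"
      by (simp only: root_refl_def bil_scale2)
    also have "\<dots> = (1 / L) * (vp0 x - 2 * (L - K) * \<beta> x)"
      using L by (simp add: diff_divide_distrib right_diff_distrib left_diff_distrib)
    also have "vp0 x - 2 * (L - K) * \<beta> x = (2 * K - L) * \<beta> x + \<gamma> x"
      by (simp add: vp0_def algebra_simps)
    also have "1 / L * ((2 * K - L) * \<beta> x + \<gamma> x) = (1 / \<mu>) * vm0 x" unfolding L1 using L by (simp add: \<mu>_def vm0_def field_simps)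
    finally show "act \<tau> vm0 x = (1 / \<mu>) * vm0 x" by (simp add: act\<tau> g1)
  qed
  \<comment> \<open>Read off from \<open>L * vp0 - vm0 = (L * L - 1) * \<beta>\<close>.\<close>
  define a where "a = L / (L * L - 1)"
  define b where "b = - 1 / (L * L - 1)"
  have ab: "a > 0" "b < 0" using L L2 by (auto simp: a_def b_def)
  have \<beta>ab: "\<beta> = (\<lambda>x. a * vp0 x + b * vm0 x)"
  proof
    fix x
    have Da: "(L * L - 1) * a = L" and Db: "(L * L - 1) * b = - 1"
      using L2 by (auto simp: a_def b_def)
    have "(L * L - 1) * (a * vp0 x + b * vm0 x) = ((L * L - 1) * a) * vp0 x + ((L * L - 1) * b) * vm0 x"
      by (simp only: distrib_left mult.assoc)
    also have "\<dots> = L * vp0 x - vm0 x" unfolding Da Db by simp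
    also have "\<dots> = (L * L - 1) * \<beta> x" by (simp add: vp0_def vm0_def algebra_simps)
    finally show "\<beta> x = a * vp0 x + b * vm0 x" using L2 by simp
  qed
  have orth: "act \<tau> v = v" if "bil v vp0 = 0" "bil v vm0 = 0" for v
  proof -
    have 1: "bil \<beta> v = 0" using that by (subst \<beta>ab) (simp add: bil_sym[of _ v])
    have "\<gamma> = (\<lambda>x. vp0 x - L * \<beta> x)" by (simp add: vp0_def)
    then have "bil \<gamma> v = bil vp0 v - L * bil \<beta> v" by simp
    then have "bil \<gamma> v = 0" using 1 that by (simp add: bil_sym[of _ v])
    then show ?thesis using 1 by (simp add: act\<tau> root_refl_def)
  qed
  have orbit1: "\<exists>e\<in>{1, -1::real}. \<forall>w\<in>lists S. nonneg (act w (\<lambda>x. e * vp0 x))"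
  proof (rule nonneg_orbit_of_limit_root[of a \<mu> _ b vm0])
    fix n :: nat
    have "act (concat (replicate n \<tau>)) \<beta> \<in> roots_of S"
      by (rule act_root[OF power_lists[OF \<tau>S] comp_roots[OF \<beta>]])
    moreover have "act (concat (replicate n \<tau>)) \<beta> = (\<lambda>x. a * \<mu> ^ n * vp0 x + b * (1 / \<mu>) ^ n * vm0 x)"
      using act_power[OF ap, of n] act_power[OF am, of n] by (subst \<beta>ab) (simp add: act_linear mult.assoc)
    ultimately show "(\<lambda>x. a * \<mu> ^ n * vp0 x + b * (1 / \<mu>) ^ n * vm0 x) \<in> roots_of S" by simp
  qed (use ab \<mu> neg iso in auto)
  have inv_p: "act (rev \<tau>) vp0 = (\<lambda>x. (1 / \<mu>) * vp0 x)"
    using act_rev_eigenvector[OF \<tau>S ap] \<mu> by simp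
  have inv_m: "act (rev \<tau>) vm0 = (\<lambda>x. \<mu> * vm0 x)"
    using act_rev_eigenvector[OF \<tau>S am] \<mu> by simp
  \<comment> \<open>\<open>vm0\<close> is the limit direction of the negatives of the roots obtained
    from \<beta> by powers of the inverse of \<tau>; the negation turns the leading coefficient b
    into a positive one.\<close>
  have orbit2: "\<exists>e\<in>{1, -1::real}. \<forall>w\<in>lists S. nonneg (act w (\<lambda>x. e * vm0 x))"
  proof (rule nonneg_orbit_of_limit_root[of "- b" \<mu> _ "- a" vp0])
    fix n :: nat
    have "rev \<tau> \<in> lists S" using \<tau>S by (rule rev_lists)
    then have "(\<lambda>x. - act (concat (replicate n (rev \<tau>))) \<beta> x) \<in> roots_of S"
      by (intro root_uminus act_root power_lists comp_roots[OF \<beta>] order.refl)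
    moreover have "(\<lambda>x. - act (concat (replicate n (rev \<tau>))) \<beta> x) =
         (\<lambda>x. - b * \<mu> ^ n * vm0 x + - a * (1 / \<mu>) ^ n * vp0 x)"
      using act_power[OF inv_p, of n] act_power[OF inv_m, of n] by (subst \<beta>ab) (simp add: act_linear mult.assoc fun_eq_iff)
    ultimately show "(\<lambda>x. - b * \<mu> ^ n * vm0 x + - a * (1 / \<mu>) ^ n * vp0 x) \<in> roots_of S" by simp
  qed (use ab \<mu> neg iso in \<open>auto simp: bil_sym[of vm0 vp0]\<close>)
  obtain e1 where e1: "e1 \<in> {1, -1::real}" "\<forall>w\<in>lists S. nonneg (act w (\<lambda>x. e1 * vp0 x))" using orbit1 by blast
  obtain e2 where e2: "e2 \<in> {1, -1::real}" "\<forall>w\<in>lists S. nonneg (act w (\<lambda>x. e2 * vm0 x))" using orbit2 by blast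
  \<comment> \<open>Since \<open>bil vp0 vm0 < 0\<close>, nonpositivity forces the two signs to
    agree, and one common change of sign serves both vectors.\<close>
  have "bil (\<lambda>x. e1 * vp0 x) (\<lambda>x. e2 * vm0 x) \<le> 0"
    by (rule bil_nonpos_of_nonneg_orbits[OF e1(2) e2(2)]) (simp_all add: iso)
  then have "e1 * e2 \<ge> 0" using neg by (simp add: mult_le_0_iff zero_le_mult_iff)
  then have e12: "e2 = e1" "e1 * e1 = 1" using e1(1) e2(1) by auto
  have sup: "\<beta> x = 0" "\<gamma> x = 0" if "x \<notin> compo r" for x
    using root_supported[OF \<beta> that] root_supported[OF act_root[OF h'S \<beta>] that] by (auto simp: \<gamma>_def)
  have e\<beta>: "(\<lambda>x. a * (e1 * vp0 x) + b * (e1 * vm0 x)) \<in> Phi"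
  proof -
    have "(\<lambda>x. a * (e1 * vp0 x) + b * (e1 * vm0 x)) = (\<lambda>x. e1 * \<beta> x)"
      by (subst \<beta>ab) (simp add: algebra_simps)
    then show ?thesis using e1(1) \<beta> root_uminus[OF comp_subset \<beta>] by auto
  qed
  have "hyperbolic_element S m H r l c \<tau> \<mu> (\<lambda>x. e1 * vp0 x) (\<lambda>x. e1 * vm0 x) a b"
  proof unfold_locales
    show "bil (\<lambda>x. e1 * vp0 x) (\<lambda>x. e1 * vm0 x) < 0" using neg e12(2) by (simp flip: mult.assoc)
    show "act \<tau> (\<lambda>x. e1 * vp0 x) = (\<lambda>x. \<mu> * (e1 * vp0 x))" by (simp add: act_scale ap mult.left_commute)
    show "act \<tau> (\<lambda>x. e1 * vm0 x) = (\<lambda>x. 1 / \<mu> * (e1 * vm0 x))"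
      unfolding act_scale am by (simp add: mult.left_commute)
    show "\<forall>v. bil v (\<lambda>x. e1 * vp0 x) = 0 \<longrightarrow> bil v (\<lambda>x. e1 * vm0 x) = 0 \<longrightarrow> act \<tau> v = v"
      using orth e1(1) by auto
    show "\<forall>w\<in>lists S. nonneg (act w (\<lambda>x. e1 * vm0 x))" using e2(2) e12(1) by simp
    show "\<forall>x. x \<notin> compo r \<longrightarrow> e1 * vp0 x = 0" "\<forall>x. x \<notin> compo r \<longrightarrow> e1 * vm0 x = 0"
      using sup by (simp_all add: vp0_def vm0_def)
  qed (simp_all add: \<tau>W \<mu> iso e\<beta> ab e1(2))
  then show ?thesis by blast
qed

end

section \<open>Free subgroups of normal subgroups\<close>

context hyperbolic_element
begin

section \<open>Roots in coordinates along the axis\<close>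

abbreviation "sv \<equiv> bil vp vm"

text \<open>As \<open>vp\<close> and \<open>vm\<close> are isotropic, the component of \<theta> in
  their plane is \<open>Q \<theta> / sv * vp + P \<theta> / sv * vm\<close>: \<open>P\<close>
  belongs to \<open>vm\<close> and \<open>Q\<close> to \<open>vp\<close>.\<close>

abbreviation "P \<theta> \<equiv> bil \<theta> vp"

abbreviation "Q \<theta> \<equiv> bil \<theta> vm"

lemma tau_lists: "\<tau> \<in> lists S"
  using tau by (rule words_lists)

lemma inv_p: "act (rev \<tau>) vp = (\<lambda>x. (1 / \<mu>) * vp x)"
  using act_rev_eigenvector[OF tau_lists act_p] mu by simp

lemma inv_m: "act (rev \<tau>) vm = (\<lambda>x. \<mu> * vm x)"
  using act_rev_eigenvector[OF tau_lists act_m] mu by simp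

lemma ab_sv: "2 * a * b * sv = 1"
  using bil_root_self[OF comp_roots[OF beta]] by (simp add: iso_p iso_m bil_sym[of vm vp])

lemma P_beta: "P (\<lambda>x. A * vp x + B * vm x) = B * sv" and Q_beta: "Q (\<lambda>x. A * vp x + B * vm x) = A * sv"
  by (simp_all add: iso_p iso_m bil_sym[of vm vp])

lemma root_refl_Phi:
  assumes "\<theta> \<in> Phi" "\<phi> \<in> Phi" shows "root_refl \<theta> \<phi> \<in> Phi"
proof -
  obtain w where "w \<in> lists S" "\<And>v. act w v = root_refl \<theta> v"
    by (rule root_refl_eq_act[OF comp_roots[OF assms(1)]]) (rule that)
  then show ?thesis using act_root assms(2) by metis
qed

lemma P_root_refl: "P (root_refl \<theta> \<phi>) = P \<phi> - 2 * bil \<theta> \<phi> * P \<theta>"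
  and Q_root_refl: "Q (root_refl \<theta> \<phi>) = Q \<phi> - 2 * bil \<theta> \<phi> * Q \<theta>"
  by (simp_all add: root_refl_def)

lemma orbit_act:
  assumes "\<forall>w\<in>lists S. nonneg (act w v)" "u \<in> lists S" shows "\<forall>w\<in>lists S. nonneg (act w (act u v))"
  using assms append_lists by (simp flip: act_append)

lemma orbit_root_refl:
  assumes "\<theta> \<in> Phi" "\<forall>w\<in>lists S. nonneg (act w v)"
  shows "\<forall>w\<in>lists S. nonneg (act w (root_refl \<theta> v))"
proof -
  obtain w where "w \<in> lists S" "\<And>v. act w v = root_refl \<theta> v"
    by (rule root_refl_eq_act[OF comp_roots[OF assms(1)]]) (rule that)
  then show ?thesis using orbit_act[OF assms(2)] by metis
qed

lemma bil_root_refl_same: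
  assumes "\<theta> \<in> Phi" shows "bil (root_refl \<theta> v) (root_refl \<theta> v) = bil v v"
proof -
  obtain w where "w \<in> lists S" "\<And>v. act w v = root_refl \<theta> v"
    by (rule root_refl_eq_act[OF comp_roots[OF assms(1)]]) (rule that)
  then show ?thesis using bil_act by metis
qed

text \<open>Reflecting \<open>vm\<close> in \<theta> keeps its orbit nonnegative, so its product
  with \<open>vp\<close> stays nonpositive. Geometrically, the projection of a root to the plane has
  norm at most one.\<close>

lemma PQ_ge:
  assumes "\<theta> \<in> Phi" shows "sv \<le> 2 * (P \<theta> * Q \<theta>)"
proof -
  have "bil vp (root_refl \<theta> vm) \<le> 0"
    by (rule bil_nonpos_of_nonneg_orbits[OF orbit_p orbit_root_refl[OF assms orbit_m] iso_p])
      (simp add: bil_root_refl_same[OF assms] iso_m)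
  then show ?thesis by (simp add: root_refl_def bil_sym[of vp \<theta>] mult_ac)
qed

text \<open>The images of \<open>vm\<close> under two reflections still have nonnegative orbits,
  hence a nonpositive product.\<close>

lemma bil_vm_refl:
  assumes "\<theta> \<in> Phi" "\<phi> \<in> Phi"
  shows "2 * Q \<theta> * Q \<phi> * bil \<theta> \<phi> \<le> (Q \<theta>)\<^sup>2 + (Q \<phi>)\<^sup>2"
proof -
  have "bil (root_refl \<theta> vm) (root_refl \<phi> vm) \<le> 0"
    by (rule bil_nonpos_of_nonneg_orbits[OF orbit_root_refl[OF assms(1) orbit_m] orbit_root_refl[OF assms(2) orbit_m]])
      (simp_all add: bil_root_refl_same assms iso_m)
  then show ?thesis
    by (simp add: root_refl_def iso_m bil_sym[of vm \<theta>] bil_sym[of vm \<phi>] power2_eq_square algebra_simps)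
qed

lemma axis_roots:
  "(\<lambda>x. a * \<mu> ^ n * vp x + b * (1 / \<mu>) ^ n * vm x) \<in> Phi"
  "(\<lambda>x. a * (1 / \<mu>) ^ n * vp x + b * \<mu> ^ n * vm x) \<in> Phi"
proof -
  have "act (concat (replicate n \<tau>)) (\<lambda>x. a * vp x + b * vm x) \<in> Phi"
    by (rule act_root[OF power_lists[OF tau_lists] beta])
  then show "(\<lambda>x. a * \<mu> ^ n * vp x + b * (1 / \<mu>) ^ n * vm x) \<in> Phi"
    unfolding act_add act_scale act_power[OF act_p] act_power[OF act_m] by (simp add: mult.assoc)
  have "act (concat (replicate n (rev \<tau>))) (\<lambda>x. a * vp x + b * vm x) \<in> Phi"
    by (rule act_root[OF power_lists[OF rev_lists[OF tau_lists]] beta])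
  then show "(\<lambda>x. a * (1 / \<mu>) ^ n * vp x + b * \<mu> ^ n * vm x) \<in> Phi"
    unfolding act_add act_scale act_power[OF inv_p] act_power[OF inv_m] by (simp add: mult.assoc)
qed

lemma exponential_unbounded:
  fixes p q :: real
  assumes "p \<noteq> 0" shows "\<exists>n. M < \<bar>p * \<mu> ^ n + q * (1 / \<mu>) ^ n\<bar>"
proof -
  obtain n where n: "(M + \<bar>q\<bar>) / \<bar>p\<bar> < \<mu> ^ n" using real_arch_pow[OF mu] by blast
  have "\<bar>q * (1 / \<mu>) ^ n\<bar> \<le> \<bar>q\<bar> * 1"
    unfolding abs_mult using mu by (intro mult_left_mono) (auto simp: power_le_one power_abs)
  moreover have "M + \<bar>q\<bar> < \<bar>p * \<mu> ^ n\<bar>"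
    using n assms mu by (simp add: abs_mult field_simps)
  ultimately have "M < \<bar>p * \<mu> ^ n + q * (1 / \<mu>) ^ n\<bar>" by linarith
  then show ?thesis ..
qed

text \<open>The number 2 P Q / sv is the norm of the projection of a root to the plane spanned by vp and
  vm. If no root had P Q > 0, every root would have projection of norm 1 or 0. The components
  orthogonal to the plane of the roots of norm 1 would lie in the radical, so by irreducibility the
  form would have rank at most two, which forces all simple roots to be proportional modulo the
  radical.\<close>
lemma ex_good_root: "\<exists>\<theta>\<in>Phi. P \<theta> * Q \<theta> > 0"
proof (rule ccontr)
  assume "\<not> (\<exists>\<theta>\<in>Phi. P \<theta> * Q \<theta> > 0)"
  then have bad: "P \<theta> * Q \<theta> \<le> 0" if "\<theta> \<in> Phi" for \<theta> using that by (auto simp: not_less)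
  \<comment> \<open>The sign assumption for the reflection in \<theta> of a root in the plane. It
    bounds the product of \<theta> with that root as soon as
    \<open>2 * (P \<theta> * Q \<theta>) > sv\<close>.\<close>
  have axis: "2 * (bil \<theta> (\<lambda>x. A * vp x + B * vm x))\<^sup>2 * (2 * (P \<theta> * Q \<theta>) - sv) \<le> - sv / 2"
    if "\<theta> \<in> Phi" "(\<lambda>x. A * vp x + B * vm x) \<in> Phi" "A * B = a * b" for \<theta> A B
  proof -
    define x where "x = (\<lambda>x. A * vp x + B * vm x)"
    define y where "y = bil \<theta> x"
    have y: "y = A * P \<theta> + B * Q \<theta>" by (simp add: y_def x_def)
    have "P (root_refl \<theta> x) * Q (root_refl \<theta> x) \<le> 0"
      using that by (intro bad root_refl_Phi) (auto simp: x_def)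
    then have "(B * sv - 2 * y * P \<theta>) * (A * sv - 2 * y * Q \<theta>) \<le> 0"
      unfolding P_root_refl Q_root_refl y_def[symmetric] unfolding x_def P_beta Q_beta .
    moreover have "(B * sv - 2 * y * P \<theta>) * (A * sv - 2 * y * Q \<theta>)
       = (A * B) * sv * sv - 2 * y * sv * (A * P \<theta> + B * Q \<theta>) + 4 * y * y * (P \<theta> * Q \<theta>)"
      by (simp add: algebra_simps)
    moreover have "(A * B) * sv = 1 / 2" using ab_sv that(3) by simp
    ultimately have "1 / 2 * sv - 2 * y * sv * y + 4 * y * y * (P \<theta> * Q \<theta>) \<le> 0"
      unfolding y[symmetric] by simp
    then show ?thesis unfolding x_def[symmetric] y_def[symmetric] by (simp add: power2_eq_square algebra_simps)
  qed
  \<comment> \<open>Outside the extreme case \<theta> has bounded products with the translates of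
    the axis root in both directions, but these grow exponentially unless \<open>P \<theta>\<close>
    and \<open>Q \<theta>\<close> vanish.\<close>
  have dich: "2 * (P \<theta> * Q \<theta>) = sv \<or> (P \<theta> = 0 \<and> Q \<theta> = 0)" if \<theta>: "\<theta> \<in> Phi" for \<theta>
  proof (rule ccontr)
    assume no: "\<not> ?thesis"
    define D where "D = 2 * (P \<theta> * Q \<theta>) - sv"
    have D: "D > 0" using PQ_ge[OF \<theta>] no by (auto simp: D_def)
    define M where "M = - sv / (4 * D)"
    have M: "M > 0" using D neg by (simp add: M_def divide_neg_pos)
    have bound: "\<bar>y\<bar> \<le> M + 1" if "2 * y\<^sup>2 * D \<le> - sv / 2" for y
    proof -
      have "y\<^sup>2 \<le> M" using that D by (simp add: M_def field_simps)
      also have "\<dots> \<le> (M + 1)\<^sup>2" using M by (simp add: power2_eq_square algebra_simps)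
      finally show ?thesis using M abs_le_square_iff[of y "M + 1"] by simp
    qed
    have "a * b = a * \<mu> ^ n * (b * (1 / \<mu>) ^ n)" "a * b = a * (1 / \<mu>) ^ n * (b * \<mu> ^ n)" for n
      using mu by (simp_all add: power_divide)
    note AB = this[symmetric]
    have 1: "\<bar>(a * P \<theta>) * \<mu> ^ n + (b * Q \<theta>) * (1 / \<mu>) ^ n\<bar> \<le> M + 1" for n
    proof (rule bound)
      have "bil \<theta> (\<lambda>x. a * \<mu> ^ n * vp x + b * (1 / \<mu>) ^ n * vm x) = (a * P \<theta>) * \<mu> ^ n + (b * Q \<theta>) * (1 / \<mu>) ^ n"
        unfolding bil_add2 bil_scale2 by (simp only: mult_ac)
      then show "2 * ((a * P \<theta>) * \<mu> ^ n + (b * Q \<theta>) * (1 / \<mu>) ^ n)\<^sup>2 * D \<le> - sv / 2"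
        using axis[OF \<theta> axis_roots(1) AB(1), of n] by (simp only: D_def)
    qed
    have 2: "\<bar>(b * Q \<theta>) * \<mu> ^ n + (a * P \<theta>) * (1 / \<mu>) ^ n\<bar> \<le> M + 1" for n
    proof (rule bound)
      have "bil \<theta> (\<lambda>x. a * (1 / \<mu>) ^ n * vp x + b * \<mu> ^ n * vm x) = (b * Q \<theta>) * \<mu> ^ n + (a * P \<theta>) * (1 / \<mu>) ^ n"
        unfolding bil_add2 bil_scale2 by (simp only: mult_ac)
      then show "2 * ((b * Q \<theta>) * \<mu> ^ n + (a * P \<theta>) * (1 / \<mu>) ^ n)\<^sup>2 * D \<le> - sv / 2"
        using axis[OF \<theta> axis_roots(2) AB(2), of n] by (simp only: D_def)
    qed
    have "a * P \<theta> = 0"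
      using exponential_unbounded[of "a * P \<theta>" "M + 1" "b * Q \<theta>"] 1 by (meson not_le)
    moreover have "b * Q \<theta> = 0"
      using exponential_unbounded[of "b * Q \<theta>" "M + 1" "a * P \<theta>"] 2 by (meson not_le)
    ultimately have "P \<theta> = 0 \<and> Q \<theta> = 0" using a b by simp
    then show False using no by simp
  qed
  \<comment> \<open>The product of the components orthogonal to the plane.\<close>
  define E where "E \<theta> \<phi> = bil \<theta> \<phi> - (P \<theta> * Q \<phi> + Q \<theta> * P \<phi>) / sv" for \<theta> \<phi>
  have sv0: "sv \<noteq> 0" using neg by simp
  have E_le: "Q \<theta> * Q \<phi> * E \<theta> \<phi> \<le> 0"
    if "\<theta> \<in> Phi" "\<phi> \<in> Phi" "2 * (P \<theta> * Q \<theta>) = sv" "2 * (P \<phi> * Q \<phi>) = sv" for \<theta> \<phi>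
  proof -
    have "Q \<theta> * Q \<phi> * E \<theta> \<phi> = Q \<theta> * Q \<phi> * bil \<theta> \<phi> - ((P \<theta> * Q \<theta>) * (Q \<phi>)\<^sup>2 + (P \<phi> * Q \<phi>) * (Q \<theta>)\<^sup>2) / sv"
      by (simp add: E_def power2_eq_square algebra_simps)
    also have "P \<theta> * Q \<theta> = sv / 2" using that by simp
    also have "P \<phi> * Q \<phi> = sv / 2" using that by simp
    also have "(sv / 2 * (Q \<phi>)\<^sup>2 + sv / 2 * (Q \<theta>)\<^sup>2) / sv = ((Q \<phi>)\<^sup>2 + (Q \<theta>)\<^sup>2) / 2"
      using sv0 by (simp add: field_simps)
    finally show ?thesis using bil_vm_refl[OF that(1,2)] by simp
  qed
  have E0: "E \<theta> \<phi> = 0"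
    if "\<theta> \<in> Phi" "\<phi> \<in> Phi" "2 * (P \<theta> * Q \<theta>) = sv" "2 * (P \<phi> * Q \<phi>) = sv" for \<theta> \<phi>
  proof -
    define \<beta> where "\<beta> = (\<lambda>x. a * vp x + b * vm x)"
    \<comment> \<open>Reflection in \<beta>, which lies in the plane, leaves E unchanged but
      replaces \<open>Q \<phi>\<close> by a positive multiple of \<open>P \<phi>\<close>, which has
      the opposite sign. So \<open>E_le\<close> for \<phi> and for its image gives opposite
      inequalities for E.\<close>
    define \<phi>' where "\<phi>' = root_refl \<beta> \<phi>"
    have b\<phi>: "bil \<beta> \<phi> = a * P \<phi> + b * Q \<phi>" and b\<theta>: "bil \<theta> \<beta> = a * P \<theta> + b * Q \<theta>"
      by (simp_all add: \<beta>_def bil_sym[of vp \<phi>] bil_sym[of vm \<phi>])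
    have PQ\<beta>: "P \<beta> = b * sv" "Q \<beta> = a * sv" unfolding \<beta>_def by (rule P_beta, rule Q_beta)
    have \<phi>'P: "\<phi>' \<in> Phi" unfolding \<phi>'_def using beta that(2) by (intro root_refl_Phi) (simp_all add: \<beta>_def)
    have P': "P \<phi>' = - 2 * b * b * sv * Q \<phi>"
    proof -
      have "P \<phi>' = P \<phi> - (2 * a * b * sv) * P \<phi> - 2 * b * b * sv * Q \<phi>"
        unfolding \<phi>'_def P_root_refl b\<phi> PQ\<beta> by (simp add: algebra_simps)
      then show ?thesis unfolding ab_sv by simp
    qed
    have Q': "Q \<phi>' = - 2 * a * a * sv * P \<phi>"
    proof -
      have "Q \<phi>' = Q \<phi> - (2 * a * b * sv) * Q \<phi> - 2 * a * a * sv * P \<phi>"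
        unfolding \<phi>'_def Q_root_refl b\<phi> PQ\<beta> by (simp add: algebra_simps)
      then show ?thesis unfolding ab_sv by simp
    qed
    have "P \<phi>' * Q \<phi>' = (2 * a * b * sv) * (2 * a * b * sv) * (P \<phi> * Q \<phi>)"
      unfolding P' Q' by (simp add: algebra_simps)
    then have PQ': "2 * (P \<phi>' * Q \<phi>') = sv" unfolding ab_sv using that(4) by simp
    have "E \<theta> \<phi>' = bil \<theta> \<phi> - 2 * (a * P \<phi> + b * Q \<phi>) * (a * P \<theta> + b * Q \<theta>)
          + 2 * a * a * P \<theta> * P \<phi> + 2 * b * b * Q \<theta> * Q \<phi>"
      unfolding E_def P' Q' using sv0
      by (simp add: \<phi>'_def root_refl_def b\<phi> b\<theta> field_simps)
    also have "\<dots> = bil \<theta> \<phi> - (2 * a * b) * (P \<theta> * Q \<phi> + Q \<theta> * P \<phi>)" by (simp add: algebra_simps)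
    also have "2 * a * b = 1 / sv" using ab_sv sv0 by (simp add: field_simps)
    finally have EE: "E \<theta> \<phi>' = E \<theta> \<phi>" by (simp add: E_def)
    have "Q \<theta> * Q \<phi>' * E \<theta> \<phi> \<le> 0" using E_le[OF that(1) \<phi>'P that(3) PQ'] EE by simp
    then have "0 \<le> (2 * a * a * sv) * (Q \<theta> * P \<phi> * E \<theta> \<phi>)" unfolding Q' by (simp add: algebra_simps)
    moreover have "2 * a * a * sv < 0" using a neg by (simp add: mult_pos_neg)
    ultimately have 1: "Q \<theta> * P \<phi> * E \<theta> \<phi> \<le> 0" by (metis mult_neg_pos not_le)
    have 2: "Q \<theta> * Q \<phi> * E \<theta> \<phi> \<le> 0" using E_le that by blast
    have "(Q \<theta> * P \<phi> * E \<theta> \<phi>) * (Q \<theta> * Q \<phi> * E \<theta> \<phi>) \<ge> 0" using 1 2 by (rule mult_nonpos_nonpos)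
    then have "(P \<phi> * Q \<phi>) * (Q \<theta> * E \<theta> \<phi>)\<^sup>2 \<ge> 0" by (simp add: power2_eq_square algebra_simps)
    moreover have "P \<phi> * Q \<phi> < 0" using that(4) neg by simp
    ultimately have "Q \<theta> * E \<theta> \<phi> = 0" by (metis mult_neg_pos not_le zero_less_power2)
    moreover have "Q \<theta> \<noteq> 0" using that(3) sv0 by auto
    ultimately show ?thesis by simp
  qed
  have orth: "bil \<theta> \<phi> = 0"
    if \<theta>: "\<theta> \<in> Phi" "2 * (P \<theta> * Q \<theta>) = sv" and \<phi>: "\<phi> \<in> Phi" "P \<phi> = 0" "Q \<phi> = 0" for \<theta> \<phi>
  proof -
    \<comment> \<open>The reflection in \<phi> does not move the plane component of \<theta>, so
      \<open>E0\<close> applies to \<theta> and its image, where E equals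
      \<open>- 2 * (bil \<theta> \<phi>)\<^sup>2\<close>.\<close>
    have "E \<theta> (root_refl \<phi> \<theta>) = 0"
      using \<theta> \<phi> by (intro E0 root_refl_Phi) (simp_all add: P_root_refl Q_root_refl)
    moreover have "E \<theta> (root_refl \<phi> \<theta>) = 1 - 2 * (bil \<theta> \<phi>)\<^sup>2 - 2 * (P \<theta> * Q \<theta>) / sv"
      unfolding E_def P_root_refl Q_root_refl \<phi> using bil_root_self[OF comp_roots[OF \<theta>(1)]]
      by (simp add: root_refl_def bil_sym[of \<phi> \<theta>] power2_eq_square)
    ultimately show ?thesis using \<theta>(2) sv0 by simp
  qed
  \<comment> \<open>Adjacent simple roots are not orthogonal, so by \<open>orth\<close> they are of
    the same kind.\<close>
  have same: "2 * (P (alpha t) * Q (alpha t)) = sv \<longleftrightarrow> 2 * (P (alpha r) * Q (alpha r)) = sv" if "t \<in> compo r" for t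
  proof -
    have "(r, t) \<in> (cox_edge S m)\<^sup>*" using that by (auto simp: component_def)
    then show ?thesis
    proof (induction rule: rtrancl_induct)
      case (step y z)
      have yS: "y \<in> S" "z \<in> S" "y \<noteq> z" using step by (auto simp: cox_edge_def)
      have yz: "y \<in> compo r" "z \<in> compo r"
        using step yS by (auto simp: component_def intro: rtrancl_into_rtrancl)
      have ne: "bil (alpha y) (alpha z) \<noteq> 0"
        using step form_eq_0_iff[of y z] yS by (auto simp: cox_edge_def bil_alpha_alpha)
      have "bil (alpha z) (alpha y) \<noteq> 0" using ne by (simp add: bil_sym)
      then have "2 * (P (alpha z) * Q (alpha z)) = sv \<longleftrightarrow> 2 * (P (alpha y) * Q (alpha y)) = sv"
        using ne dich[OF alpha_root[OF yz(1)]] dich[OF alpha_root[OF yz(2)]]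
          orth[OF alpha_root[OF yz(1)] _ alpha_root[OF yz(2)]]
          orth[OF alpha_root[OF yz(2)] _ alpha_root[OF yz(1)]] by argo
      then show ?case using step.IH by simp
    qed simp
  qed
  have all: "2 * (P (alpha t) * Q (alpha t)) = sv" if t: "t \<in> compo r" for t
  proof (rule ccontr)
    assume "\<not> ?thesis"
    then have "\<not> 2 * (P (alpha t') * Q (alpha t')) = sv" if "t' \<in> compo r" for t'
      using same t that by blast
    then have z: "P (alpha t') = 0" if "t' \<in> compo r" for t' using dich alpha_root that by blast
    have "P vm = 0 * P vm" by (rule bil_supported_cong[of r]) (use z vm_out in auto)
    then show False using neg by (simp add: bil_sym[of vm vp])
  qed
  define q where "q = Q (alpha r)"
  have q0: "q \<noteq> 0" using all[OF comp_self[OF r]] sv0 by (auto simp: q_def)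
  have Qsq: "(Q (alpha t))\<^sup>2 = q\<^sup>2" if t: "t \<in> compo r" for t
  proof (cases "t = r")
    case True
    then show ?thesis by (simp add: q_def)
  next
    case False
    have tS: "t \<in> S" using t comp_subset by blast
    have "E (alpha t) (alpha r) = 0"
      using all t comp_self[OF r] by (intro E0 alpha_root) auto
    then have k: "bil (alpha t) (alpha r) * sv = P (alpha t) * q + Q (alpha t) * P (alpha r)"
      using sv0 by (simp add: E_def q_def field_simps)
    define k where "k = bil (alpha t) (alpha r)"
    have k1: "- 1 \<le> k" "k \<le> 0"
      using form_ge form_nonpos[OF tS r False] by (auto simp: k_def bil_alpha_alpha tS r)
    define u where "u = Q (alpha t)"
    \<comment> \<open>Multiplying by \<open>2 * u * q\<close> turns the products of \<open>P\<close>
      and \<open>Q\<close> into sv / 2 and leaves \<open>k * (2 * u * q) = q * q + u * u\<close>.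
      With k between -1 and 0 this forces u = - q.\<close>
    have "k * sv * (2 * u * q) = (2 * (P (alpha t) * u)) * (q * q) + (2 * (P (alpha r) * q)) * (u * u)"
      unfolding k_def k by (simp add: u_def algebra_simps)
    also have "\<dots> = sv * (q * q + u * u)"
      using all[OF t] all[OF comp_self[OF r]] by (simp add: u_def q_def algebra_simps)
    finally have "k * sv * (2 * u * q) = sv * (q * q + u * u)" .
    moreover have "k * sv * (2 * u * q) = sv * (k * (2 * u * q))" by (simp only: mult_ac)
    ultimately have "sv * (k * (2 * u * q)) = sv * (q * q + u * u)" by (simp only:)
    then have ku: "k * (2 * u * q) = q * q + u * u" using sv0 mult_left_cancel[OF sv0] by blast
    have "q * q > 0" using q0 not_real_square_gt_zero by blast
    then have "k * (2 * u * q) > 0" using ku by (metis add_pos_nonneg zero_le_square)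
    then have "u * q < 0" using k1 by (simp add: zero_less_mult_iff mult_less_0_iff split: if_splits)
    then have "2 * u * q \<le> 0" by (simp only: mult.assoc)
    then have "k * (2 * u * q) \<le> (-1) * (2 * u * q)" using k1 by (intro mult_right_mono_neg)
    then have "(u + q) * (u + q) \<le> 0" using ku by (simp add: algebra_simps)
    then have "u + q = 0" by (metis linorder_not_le not_real_square_gt_zero order.antisym zero_le_square mult_eq_0_iff)
    then have "u = - q" by simp
    then show ?thesis by (simp add: u_def)
  qed
  \<comment> \<open>The factor by which \<open>P\<close> and \<open>Q\<close> are proportional on
    the simple roots of the component. Then \<open>vp\<close> is \<kappa> times \<open>vm\<close>
    modulo the radical, and isotropy of \<open>vp\<close> gives
    \<open>\<kappa> * sv = 0\<close>.\<close>
  define \<kappa> where "\<kappa> = sv / (2 * q\<^sup>2)"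
  have PQk: "P (alpha t) = \<kappa> * Q (alpha t)" if t: "t \<in> compo r" for t
  proof -
    have "Q (alpha t) \<noteq> 0" using all[OF t] sv0 by auto
    moreover have "P (alpha t) * Q (alpha t) = \<kappa> * Q (alpha t) * Q (alpha t)"
    proof -
      have "\<kappa> * Q (alpha t) * Q (alpha t) = \<kappa> * (Q (alpha t))\<^sup>2" by (simp add: power2_eq_square)
      also have "\<dots> = sv / 2" unfolding Qsq[OF t] using q0 by (simp add: \<kappa>_def)
      also have "sv / 2 = P (alpha t) * Q (alpha t)" using all[OF t] by simp
      finally show ?thesis ..
    qed
    ultimately show ?thesis by simp
  qed
  have "bil vp vp = \<kappa> * bil vp vm" by (rule bil_supported_cong[of r]) (use PQk vp_out in auto)
  then show False using iso_p sv0 q0 by (simp add: \<kappa>_def)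
qed

lemma act_power_tau:
  fixes \<theta> :: "'a \<Rightarrow> real" and n :: nat
  defines "\<theta>' \<equiv> (\<lambda>x. \<theta> x - (Q \<theta> / sv * vp x + P \<theta> / sv * vm x))"
  shows "act (concat (replicate n \<tau>)) \<theta> =
    (\<lambda>x. \<theta>' x + (Q \<theta> / sv * \<mu> ^ n * vp x + P \<theta> / sv * (1 / \<mu>) ^ n * vm x))"
proof -
  have sv0: "sv \<noteq> 0" using neg by simp
  have "bil \<theta>' vp = 0" "bil \<theta>' vm = 0"
    using sv0 by (simp_all add: \<theta>'_def iso_p iso_m bil_sym[of vm vp])
  then have fixed: "act (concat (replicate n \<tau>)) \<theta>' = \<theta>'" using act_orth act_power_fixed by blast
  have "\<theta> = (\<lambda>x. \<theta>' x + (Q \<theta> / sv * vp x + P \<theta> / sv * vm x))" by (simp add: \<theta>'_def)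
  then have "act (concat (replicate n \<tau>)) \<theta> =
      act (concat (replicate n \<tau>)) (\<lambda>x. \<theta>' x + (Q \<theta> / sv * vp x + P \<theta> / sv * vm x))" by simp
  also have "\<dots> = (\<lambda>x. \<theta>' x + (Q \<theta> / sv * (\<mu> ^ n * vp x) + P \<theta> / sv * ((1 / \<mu>) ^ n * vm x)))"
    unfolding act_add act_scale fixed act_power[OF act_p] act_power[OF act_m] ..
  finally show ?thesis by (simp add: mult.assoc)
qed

lemma power_words: "concat (replicate n \<tau>) \<in> words"
  by (induction n) (auto simp: words_Nil intro: words_append tau)

theorem not_narrow: "\<not> narrow W H"
proof -
  have sv0: "sv \<noteq> 0" using neg by simp
  \<comment> \<open>Of a good root and its negative, take the one with negative products: then the
    growing coefficient \<open>Q \<theta> / sv\<close> is positive and the translates are eventually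
    positive roots.\<close>
  obtain \<theta> where \<theta>: "\<theta> \<in> Phi" "P \<theta> < 0" "Q \<theta> < 0"
  proof -
    obtain \<theta>0 where t: "\<theta>0 \<in> Phi" "P \<theta>0 * Q \<theta>0 > 0" using ex_good_root by blast
    show ?thesis
    proof (cases "P \<theta>0 < 0")
      case True
      then show ?thesis using that t by (simp add: zero_less_mult_iff)
    next
      case False
      then show ?thesis using that[OF root_uminus[OF comp_subset t(1)]] t by (auto simp: zero_less_mult_iff)
    qed
  qed
  obtain w t where w: "\<theta> = act w (alpha t)" "w \<in> lists S" "t \<in> compo r" using \<theta>(1) by (rule roots_ofE)
  have tS: "t \<in> S" using w(3) comp_subset by blast
  define \<theta>' where "\<theta>' = (\<lambda>x. \<theta> x - (Q \<theta> / sv * vp x + P \<theta> / sv * vm x))"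
  define T where "T n = concat (replicate n \<tau>)" for n
  have TS: "T n \<in> lists S" for n unfolding T_def by (rule power_lists[OF tau_lists])
  define B where "B n = act (T n) \<theta>" for n
  have B_eq: "B n = (\<lambda>x. \<theta>' x + (Q \<theta> / sv * \<mu> ^ n * vp x + P \<theta> / sv * (1 / \<mu>) ^ n * vm x))" for n
    unfolding B_def T_def \<theta>'_def by (rule act_power_tau)
  have Brt: "B n \<in> roots_of S" for n
    unfolding B_def by (intro act_root TS comp_roots[OF \<theta>(1)])
  define N where "N = P \<theta> * Q \<theta> / sv"
  have N: "N < 0" unfolding N_def using \<theta> neg by (simp add: divide_pos_neg mult_neg_neg)
  \<comment> \<open>\<open>1 - 2 * N\<close> is the norm of the part fixed by \<tau>. As N < 0, the
    products tend to minus infinity as d grows.\<close>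
  have inner: "bil (B i) (B (i + d)) = 1 - 2 * N + N * (\<mu> ^ d + (1 / \<mu>) ^ d)" for i d
  proof -
    have o: "bil \<theta>' vp = 0" "bil \<theta>' vm = 0"
      using sv0 by (simp_all add: \<theta>'_def iso_p iso_m bil_sym[of vm vp])
    have ot: "bil \<theta> \<theta>' = 1 - 2 * N"
      using bil_root_self[OF comp_roots[OF \<theta>(1)]] by (simp add: \<theta>'_def N_def algebra_simps)
    have "T (i + d) = T i @ T d" by (simp add: T_def replicate_add)
    then have "bil (B i) (B (i + d)) = bil \<theta> (B d)"
      using bil_act[OF TS[of i], of \<theta> "B d"] by (simp add: B_def act_append)
    also have "\<dots> = 1 - 2 * N + (Q \<theta> / sv * \<mu> ^ d * P \<theta> + P \<theta> / sv * (1 / \<mu>) ^ d * Q \<theta>)"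
      unfolding B_eq bil_add2 bil_scale2 ot ..
    finally show ?thesis by (simp add: N_def algebra_simps add_divide_distrib)
  qed
  obtain k where k: "(2 - 2 * N) / - N < \<mu> ^ k" using real_arch_pow[OF mu] by blast
  have far: "bil (B i) (B (i + d)) \<le> -1" if "k \<le> d" for i d
  proof -
    have "\<mu> ^ k \<le> \<mu> ^ d" using mu that by (intro power_increasing) auto
    then have "(2 - 2 * N) / - N < \<mu> ^ d + (1 / \<mu>) ^ d" using k mu by (smt (verit) zero_le_power zero_le_divide_1_iff)
    then have "2 - 2 * N < (\<mu> ^ d + (1 / \<mu>) ^ d) * - N" using N by (subst (asm) pos_divide_less_eq) auto
    then show ?thesis unfolding inner by (simp add: mult.commute)
  qed
  have vp0: "nonneg vp" and vm0: "nonneg vm"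
    using orbit_p[rule_format, of "[]"] orbit_m[rule_format, of "[]"] by auto
  \<comment> \<open>One coordinate suffices, because a root with a positive coordinate is
    positive.\<close>
  obtain x where x: "vp x > 0"
  proof -
    have "\<exists>x. vp x \<noteq> 0"
    proof (rule ccontr)
      assume "\<not> (\<exists>x. vp x \<noteq> 0)"
      then have "vp = (\<lambda>x. 0)" by blast
      then show False using neg by simp
    qed
    then show ?thesis using vp0 that unfolding nonneg_def by (metis order.strict_iff_order)
  qed
  define z where "z = Q \<theta> / sv * vp x"
  have z: "z > 0" unfolding z_def using \<theta> neg x by (intro mult_pos_pos divide_neg_neg)
  obtain n0 where n0: "- \<theta>' x / z < \<mu> ^ n0" using real_arch_pow[OF mu] by blast
  have Bpos: "nonneg (B n)" if "n0 \<le> n" for n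
  proof (rule root_nonnegI[OF Brt])
    have "\<mu> ^ n0 \<le> \<mu> ^ n" using mu that by (intro power_increasing) auto
    then have "- \<theta>' x / z < \<mu> ^ n" using n0 by linarith
    then have "0 < \<theta>' x + z * \<mu> ^ n" using z by (simp add: field_simps)
    moreover have "0 \<le> P \<theta> / sv * (1 / \<mu>) ^ n * vm x"
      using \<theta> neg mu vm0 by (intro mult_nonneg_nonneg) (auto simp: nonneg_def divide_nonpos_neg)
    ultimately show "0 < B n x" unfolding B_eq by (simp add: z_def mult.assoc mult.left_commute[of "\<mu> ^ n"] mult.commute[of "\<mu> ^ n"])
  qed
  define \<rho> where "\<rho> = w @ [t] @ rev w"
  have rev\<rho>: "rev \<rho> = \<rho>" by (simp add: \<rho>_def)
  have \<rho>S: "\<rho> \<in> lists S" using w(2) tS by (auto simp: \<rho>_def)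
  \<comment> \<open>The start at n0 gives positivity, the steps of length k keep the roots
    separated.\<close>
  define g where "g j = n0 + j * k" for j :: nat
  define R where "R j = T (g j) @ \<rho> @ rev (T (g j))" for j :: nat
  have R_eq: "R j = (T (g j) @ w) @ [t] @ rev (T (g j) @ w)" for j by (simp add: R_def \<rho>_def)
  have Rw: "T (g j) @ w \<in> lists S" for j using append_lists TS w(2) by blast
  have R_S: "R j \<in> lists S" for j unfolding R_def by (intro append_lists TS \<rho>S rev_lists)
  have R_act: "act (R j) v = root_refl (B (g j)) v" for j v
    unfolding R_eq act_conj_refl[OF Rw tS] by (simp add: B_def act_append w(1))
  have R_sq: "eqv (R j @ R j) []" for j unfolding R_eq by (rule conj_refl_square[OF Rw tS])
  \<comment> \<open>The word is a product of \<open>T (g i)\<close>, a conjugate by \<rho> of an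
    element of H, and the inverse of \<open>T (g j)\<close>; normality puts the middle factor into
    H.\<close>
  have R_words: "R i @ R j \<in> words" for i j
  proof -
    have "\<rho> @ (rev (T (g i)) @ T (g j)) @ rev \<rho> \<in> words"
      unfolding T_def by (intro words_conj \<rho>S words_append words_rev power_words)
    then have "T (g i) @ (\<rho> @ (rev (T (g i)) @ T (g j)) @ rev \<rho>) @ rev (T (g j)) \<in> words"
      unfolding T_def by (rule words_append[OF power_words words_append[OF _ words_rev[OF power_words]]])
    then show ?thesis by (simp add: R_def rev\<rho>)
  qed
  show ?thesis
  proof (rule not_narrow_of_free_product[OF subgroup_H, of R])
    show "cls (R 0 @ R 1) \<in> H" "cls (R 2 @ R 3) \<in> H" using R_words by (simp_all add: cls_mem_H)
    fix js assume js: "js \<in> lists {..<4::nat}" "distinct_adj js" "js \<noteq> []"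
    show "\<not> eqv (concat (map R js)) []"
    proof (rule reflection_free_product[of 4 "\<lambda>j. B (g j)", OF _ _ _ _ js])
      show "nonneg (B (g j))" for j by (rule Bpos) (simp add: g_def)
      have "bil (B (g i)) (B (g j)) \<le> -1" if "i < j" for i j
      proof -
        have "g j = g i + (j - i) * k" using that by (simp add: g_def flip: add_mult_distrib)
        moreover have "1 * k \<le> (j - i) * k" using that by (intro mult_le_mono1) linarith
        ultimately show ?thesis using far by simp
      qed
      then show "bil (B (g i)) (B (g j)) \<le> -1" if "i \<noteq> j" for i j
        using that by (metis bil_sym linorder_neqE_nat)
    qed (use Brt R_act in auto)
  qed (use R_S R_sq in auto)
qed

end

context coxeter_normal
begin

lemma not_narrow_of_generic:
  assumes r: "r \<in> S" "\<not> pos_semidef_on m (compo r)"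
    and h: "h \<in> words" and t: "t \<in> compo r" "act h (alpha t) \<noteq> alpha t"
  shows "\<not> narrow W H"
proof -
  obtain l c where "\<forall>x. c x \<ge> 0" "\<forall>x. x \<notin> compo r \<longrightarrow> c x = 0" "\<exists>x\<in>compo r. c x > 0"
      "\<forall>s\<in>compo r. bil (alpha s) c = l * c s"
      "pos_def_on m (compo r) \<or> l \<le> 0" "pos_semidef_on m (compo r) \<or> l < 0"
    by (rule component_eigenvector[OF r(1)])
  then interpret generic_component S m H r l c
    by unfold_locales (use r in auto)
  obtain \<tau> \<mu> vp vm a b where "hyperbolic_element S m H r l c \<tau> \<mu> vp vm a b"
    using ex_hyperbolic_element[OF h t] by blast
  then show ?thesis by (rule hyperbolic_element.not_narrow)
qed

theorem narrow_iff_aff_sph: "narrow W H \<longleftrightarrow> H \<subseteq> W_aff_sph S m"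
proof
  let ?T = "S_aff S m \<union> S_sph S m"
  assume nar: "narrow W H"
  show "H \<subseteq> W_aff_sph S m"
  proof
    fix A assume "A \<in> H"
    then obtain w where w: "w \<in> words" "A = cls w" by (rule H_cases)
    have "separated ?T"
      using S_sph_subset S_aff_subset comp_S_sph comp_S_aff by (intro separated_of_closed) blast+
    then have "cls w \<in> parabolic S m ?T"
    proof (rule word_in_separated[OF _ words_lists[OF w(1)]])
      fix s assume "s \<in> S - ?T"
      then have "s \<in> S" "\<not> pos_semidef_on m (compo s)" by (auto simp: S_sph_def S_aff_def)
      then show "act w (alpha s) = alpha s"
        using not_narrow_of_generic[OF _ _ w(1)] nar comp_self by blast
    qed
    then show "A \<in> W_aff_sph S m" using w by (simp add: W_aff_sph_def)
  qed
next
  assume "H \<subseteq> W_aff_sph S m"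
  then show "narrow W H"
    unfolding W_aff_sph_def using S_sph_subset S_aff_subset
    by (intro narrow_of_semidef[OF _ pos_semidef_aff_sph]) auto
qed

end

theorem theorem3p4:
  fixes S :: "'a set" and m :: "'a \<Rightarrow> 'a \<Rightarrow> enat" and H :: "'a list set set"
  assumes "coxeter_matrix S m"
    and "normal H (cox_group S m)"
  shows "(finite H \<longleftrightarrow> H \<subseteq> W_sph S m)
       \<and> (narrow (cox_group S m) H \<longleftrightarrow> H \<subseteq> W_aff_sph S m)"
proof -
  interpret coxeter_normal S m H
    by (intro coxeter_normal.intro coxeter_system.intro coxeter_normal_axioms.intro assms)
  show ?thesis using finite_iff_sph narrow_iff_aff_sph by blast
qed

end
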